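(* Let $p$ be a prime and let $s\in(0,1]$, $t\in(0,2]$ with $s+t\ge 2$. If $E\subset\mathbb{Q}_p^2$ is an $(s,t)$-Furstenberg set, then $$\dim_H E\ge s+1 .$$ Moreover this bound is sharp: for every such $s,t$ there exists an $(s,t)$-Furstenberg set $E\subset\mathbb{Q}_p^2$ with $\dim_H E=s+1$.
   Context: $\mathbb{Q}_p$ carries the $p$-adic norm $\|x\|=p^{-\mathrm{val}_p(x)}$, and $\mathbb{Q}_p^2$ carries the metric induced by $\|(a,b)\|=\max\{\|a\|,\|b\|\}$; $\dim_H$ denotes Hausdorff dimension with respect to this metric. For $s\in(0,1]$ and $t\in(0,2]$, an $(s,t)$-Furstenberg set is a set $E\subset\mathbb{Q}_p^2$ for which there exists a family $\mathcal{L}$ of (affine) lines in $\mathbb{Q}_p^2$ with $\dim_H\mathcal{L}\ge t$ such that $\dim_H(E\cap l)\ge s$ for all $l\in\mathcal{L}$. The Hausdorff dimension of a family of lines is taken with respect to the natural two-parameter coordinates on the set of lines: $\dim_H\mathcal{L}$ is the maximum of $\dim_H\{(a,b)\in\mathbb{Q}_p^2:\{(x,y): y=ax+b\}\in\mathcal{L}\}$ and $\dim_H\{(a,b)\in\mathbb{Q}_p^2:\{(x,y): x=ay+b\}\in\mathcal{L}\}$. *)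

theory Defs
  imports "HOL-Analysis.Analysis" "Berlekamp_Zassenhaus.Finite_Field"
begin

section \<open>The p-adic absolute value on the rationals\<close>

definition rat_padic_val :: "nat \<Rightarrow> rat \<Rightarrow> int" where
  "rat_padic_val p x =
     int (multiplicity (int p) (fst (quotient_of x))) - int (multiplicity (int p) (snd (quotient_of x)))"

definition rat_padic_abs :: "nat \<Rightarrow> rat \<Rightarrow> real" where
  "rat_padic_abs p x = (if x = 0 then 0 else real p powi (- rat_padic_val p x))"

lemma rat_padic_abs_0 [simp]: "rat_padic_abs p 0 = 0"
  by (simp add: rat_padic_abs_def)

context
  fixes p :: nat
  assumes p: "prime p"
begin

lemma rat_padic_val_Fract:
  assumes "a \<noteq> 0" "b \<noteq> 0"
  shows "rat_padic_val p (Rat.Fract a b) = int (multiplicity (int p) a) - int (multiplicity (int p) b)"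
proof -
  obtain c d where cd: "quotient_of (Rat.Fract a b) = (c, d)" by (cases "quotient_of (Rat.Fract a b)")
  have d: "d > 0" using quotient_of_denom_pos[OF cd] .
  have eq: "Rat.Fract c d = Rat.Fract a b" using quotient_of_eq[OF cd] .
  hence eq': "c * b = a * d" using d assms by (simp add: eq_rat)
  hence c: "c \<noteq> 0" using d assms by auto
  have pe: "prime_elem (int p)" using p by auto
  have "multiplicity (int p) c + multiplicity (int p) b = multiplicity (int p) a + multiplicity (int p) d"
    using prime_elem_multiplicity_mult_distrib[OF pe c assms(2)]
      prime_elem_multiplicity_mult_distrib[OF pe assms(1), of d] d eq' by simp
  thus ?thesis unfolding rat_padic_val_def cd by simp
qed

lemma rat_padic_abs_pos: "x \<noteq> 0 \<Longrightarrow> rat_padic_abs p x > 0"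
  using prime_gt_0_nat[OF p] by (simp add: rat_padic_abs_def)

lemma rat_padic_abs_nonneg [simp]: "rat_padic_abs p x \<ge> 0"
  using rat_padic_abs_pos[of x] by (cases "x = 0") auto

lemma rat_padic_abs_eq_0 [simp]: "rat_padic_abs p x = 0 \<longleftrightarrow> x = 0"
  using rat_padic_abs_pos[of x] by (cases "x = 0") auto

lemma rat_padic_abs_1 [simp]: "rat_padic_abs p 1 = 1"
  by (simp add: rat_padic_abs_def rat_padic_val_def)

lemma rat_padic_abs_mult: "rat_padic_abs p (x * y) = rat_padic_abs p x * rat_padic_abs p y"
proof (cases "x = 0 \<or> y = 0")
  case False
  obtain a b where x: "x = Rat.Fract a b" "b > 0" by (cases x) auto
  obtain c d where y: "y = Rat.Fract c d" "d > 0" by (cases y) auto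
  have nz: "a \<noteq> 0" "c \<noteq> 0" using False x y by (auto simp: rat_number_collapse)
  have pe: "prime_elem (int p)" using p by auto
  have "rat_padic_val p (x * y) = rat_padic_val p x + rat_padic_val p y"
    using x y nz by (simp add: rat_padic_val_Fract prime_elem_multiplicity_mult_distrib[OF pe])
  thus ?thesis using False prime_gt_0_nat[OF p]
    by (simp add: rat_padic_abs_def power_int_add[symmetric] add.commute)
qed auto

lemma rat_padic_abs_minus [simp]: "rat_padic_abs p (- x) = rat_padic_abs p x"
proof -
  have "rat_padic_abs p (- 1) ^ 2 = 1"
    unfolding power2_eq_square rat_padic_abs_mult[symmetric] by simp
  hence "rat_padic_abs p (- 1) = 1"
    using rat_padic_abs_nonneg[of "- 1"] by (simp add: power2_eq_1_iff)
  thus ?thesis using rat_padic_abs_mult[of "- 1" x] by simp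
qed

lemma rat_padic_abs_minus_commute: "rat_padic_abs p (x - y) = rat_padic_abs p (y - x)"
  using rat_padic_abs_minus[of "x - y"] by simp

lemma rat_padic_abs_inverse: "rat_padic_abs p (inverse x) = inverse (rat_padic_abs p x)"
proof (cases "x = 0")
  case False
  have "rat_padic_abs p x * rat_padic_abs p (inverse x) = 1"
    using False by (simp flip: rat_padic_abs_mult)
  thus ?thesis by (metis inverse_unique)
qed auto

lemma rat_padic_abs_ultra: "rat_padic_abs p (x + y) \<le> max (rat_padic_abs p x) (rat_padic_abs p y)"
proof (cases "x = 0 \<or> y = 0 \<or> x + y = 0")
  case False
  obtain a b where x: "x = Rat.Fract a b" "b > 0" by (cases x) auto
  obtain c d where y: "y = Rat.Fract c d" "d > 0" by (cases y) auto
  have nz: "a \<noteq> 0" "c \<noteq> 0" using False x y by (auto simp: rat_number_collapse)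
  have pe: "prime_elem (int p)" using p by auto
  have xy: "x + y = Rat.Fract (a * d + c * b) (b * d)" using x y by simp
  have s: "a * d + c * b \<noteq> 0" using False xy by (auto simp: rat_number_collapse)
  let ?m = "multiplicity (int p)"
  have nu: "\<not> is_unit (int p)" using pe by (auto simp: prime_elem_def)
  have "int p ^ min (?m (a*d)) (?m (c*b)) dvd a*d + c*b"
    by (intro dvd_add multiplicity_dvd') auto
  hence "min (?m (a*d)) (?m (c*b)) \<le> ?m (a*d+c*b)"
    using multiplicity_geI[OF _ _ ] s nu by (meson multiplicity_geI)
  hence "min (rat_padic_val p x) (rat_padic_val p y) \<le> rat_padic_val p (x + y)"
    unfolding xy unfolding x y using x(2) y(2) nz s
    by (simp add: rat_padic_val_Fract prime_elem_multiplicity_mult_distrib[OF pe])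
  hence "- rat_padic_val p (x + y) \<le> max (- rat_padic_val p x) (- rat_padic_val p y)" by linarith
  hence "real p powi (- rat_padic_val p (x + y)) \<le> real p powi (- rat_padic_val p x) \<or>
         real p powi (- rat_padic_val p (x + y)) \<le> real p powi (- rat_padic_val p y)"
    unfolding le_max_iff_disj using prime_gt_0_nat[OF p] by (auto intro!: power_int_increasing)
  thus ?thesis using False by (auto simp: rat_padic_abs_def le_max_iff_disj)
qed (auto simp: le_max_iff_disj)

lemma rat_padic_abs_triangle: "rat_padic_abs p (x + y) \<le> rat_padic_abs p x + rat_padic_abs p y"
  using rat_padic_abs_ultra[of x y] rat_padic_abs_nonneg[of x] rat_padic_abs_nonneg[of y] by linarith

lemma rat_padic_abs_triangle_diff:
  "\<bar>rat_padic_abs p x - rat_padic_abs p y\<bar> \<le> rat_padic_abs p (x - y)"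
  using rat_padic_abs_triangle[of "x - y" y] rat_padic_abs_triangle[of "y - x" x]
    rat_padic_abs_minus_commute[of x y] by simp

end


section \<open>Cauchy and null sequences\<close>

definition padic_cauchy :: "nat \<Rightarrow> (nat \<Rightarrow> rat) \<Rightarrow> bool" where
  "padic_cauchy p X \<longleftrightarrow> (\<forall>e>0. \<exists>M. \<forall>m\<ge>M. \<forall>n\<ge>M. rat_padic_abs p (X m - X n) < e)"

definition padic_null :: "nat \<Rightarrow> (nat \<Rightarrow> rat) \<Rightarrow> bool" where
  "padic_null p X \<longleftrightarrow> (\<lambda>n. rat_padic_abs p (X n)) \<longlonglongrightarrow> 0"

definition padic_rel :: "nat \<Rightarrow> (nat \<Rightarrow> rat) \<Rightarrow> (nat \<Rightarrow> rat) \<Rightarrow> bool" where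
  "padic_rel p X Y \<longleftrightarrow> padic_cauchy p X \<and> padic_cauchy p Y \<and> padic_null p (\<lambda>n. X n - Y n)"

lemma padic_cauchy_const [simp]: "padic_cauchy p (\<lambda>n. c)"
  by (auto simp: padic_cauchy_def)

lemma padic_null_0 [simp]: "padic_null p (\<lambda>n. 0)"
  by (simp add: padic_null_def)

context
  fixes p :: nat
  assumes p: "prime p"
begin

lemma padic_null_minus: "padic_null p X \<Longrightarrow> padic_null p (\<lambda>n. - X n)"
  using p by (simp add: padic_null_def)

lemma padic_null_add:
  assumes "padic_null p X" "padic_null p Y" shows "padic_null p (\<lambda>n. X n + Y n)"
proof -
  have "(\<lambda>n. rat_padic_abs p (X n) + rat_padic_abs p (Y n)) \<longlonglongrightarrow> 0"
    using tendsto_add[OF assms[unfolded padic_null_def]] by simp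
  thus ?thesis unfolding padic_null_def
    by (rule tendsto_sandwich[OF _ _ tendsto_const, rotated 2])
       (auto simp: p rat_padic_abs_triangle[OF p])
qed

lemma padic_null_diff:
  assumes "padic_null p X" "padic_null p Y" shows "padic_null p (\<lambda>n. X n - Y n)"
  using padic_null_add[OF assms(1) padic_null_minus[OF assms(2)]] by simp

lemma padic_cauchy_minus: "padic_cauchy p X \<Longrightarrow> padic_cauchy p (\<lambda>n. - X n)"
  using rat_padic_abs_minus_commute[OF p] by (simp add: padic_cauchy_def)

lemma padic_cauchy_add:
  assumes "padic_cauchy p X" "padic_cauchy p Y" shows "padic_cauchy p (\<lambda>n. X n + Y n)"
  unfolding padic_cauchy_def
proof (intro allI impI)
  fix e :: real assume e: "e > 0"
  obtain M where M: "\<forall>m\<ge>M. \<forall>n\<ge>M. rat_padic_abs p (X m - X n) < e"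
    using assms(1) e unfolding padic_cauchy_def by meson
  obtain N where N: "\<forall>m\<ge>N. \<forall>n\<ge>N. rat_padic_abs p (Y m - Y n) < e"
    using assms(2) e unfolding padic_cauchy_def by meson
  have "rat_padic_abs p (X m + Y m - (X n + Y n)) < e" if "m \<ge> max M N" "n \<ge> max M N" for m n
  proof -
    have "rat_padic_abs p (X m + Y m - (X n + Y n)) \<le> max (rat_padic_abs p (X m - X n)) (rat_padic_abs p (Y m - Y n))"
      using rat_padic_abs_ultra[OF p, of "X m - X n" "Y m - Y n"] by (simp add: algebra_simps)
    thus ?thesis using M N that by (auto intro: order.strict_trans1)
  qed
  thus "\<exists>M. \<forall>m\<ge>M. \<forall>n\<ge>M. rat_padic_abs p (X m + Y m - (X n + Y n)) < e" by blast
qed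

lemma padic_cauchy_abs_Cauchy:
  assumes "padic_cauchy p X" shows "Cauchy (\<lambda>n. rat_padic_abs p (X n))"
  unfolding Cauchy_def dist_real_def
  using assms rat_padic_abs_triangle_diff[OF p] unfolding padic_cauchy_def
  by (meson order.strict_trans1)

lemma padic_cauchy_abs_convergent:
  "padic_cauchy p X \<Longrightarrow> (\<lambda>n. rat_padic_abs p (X n)) \<longlonglongrightarrow> lim (\<lambda>n. rat_padic_abs p (X n))"
  using padic_cauchy_abs_Cauchy Cauchy_convergent convergent_LIMSEQ_iff by blast

lemma padic_cauchy_bounded:
  assumes "padic_cauchy p X" shows "\<exists>B>0. \<forall>n. rat_padic_abs p (X n) < B"
proof -
  have "Bseq (\<lambda>n. rat_padic_abs p (X n))"
    using padic_cauchy_abs_Cauchy[OF assms] by (rule Cauchy_Bseq)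
  then obtain K where "K > 0" "\<forall>n. norm (rat_padic_abs p (X n)) < K"
    using Bseq_def by (meson BseqE gt_ex order.strict_trans1 order.strict_trans)
  thus ?thesis using p by auto
qed

lemma padic_null_mult_bounded:
  assumes "padic_cauchy p X" "padic_null p Y" shows "padic_null p (\<lambda>n. X n * Y n)"
proof -
  have "(\<lambda>n. rat_padic_abs p (X n) * rat_padic_abs p (Y n)) \<longlonglongrightarrow> lim (\<lambda>n. rat_padic_abs p (X n)) * 0"
    using padic_cauchy_abs_convergent[OF assms(1)] assms(2)[unfolded padic_null_def]
    by (rule tendsto_mult)
  thus ?thesis unfolding padic_null_def rat_padic_abs_mult[OF p] by simp
qed

lemma padic_cauchy_mult:
  assumes "padic_cauchy p X" "padic_cauchy p Y" shows "padic_cauchy p (\<lambda>n. X n * Y n)"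
  unfolding padic_cauchy_def
proof (intro allI impI)
  fix e :: real assume e: "e > 0"
  obtain A where A: "A > 0" "\<forall>n. rat_padic_abs p (X n) < A" using padic_cauchy_bounded[OF assms(1)] by blast
  obtain B where B: "B > 0" "\<forall>n. rat_padic_abs p (Y n) < B" using padic_cauchy_bounded[OF assms(2)] by blast
  obtain M where M: "\<forall>m\<ge>M. \<forall>n\<ge>M. rat_padic_abs p (X m - X n) < e / B"
    using assms(1) e B(1) unfolding padic_cauchy_def by (meson divide_pos_pos)
  obtain N where N: "\<forall>m\<ge>N. \<forall>n\<ge>N. rat_padic_abs p (Y m - Y n) < e / A"
    using assms(2) e A(1) unfolding padic_cauchy_def by (meson divide_pos_pos)
  have "rat_padic_abs p (X m * Y m - X n * Y n) < e" if mn: "m \<ge> max M N" "n \<ge> max M N" for m n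
  proof -
    have eq: "X m * Y m - X n * Y n = X m * (Y m - Y n) + (X m - X n) * Y n" by (simp add: algebra_simps)
    have 1: "rat_padic_abs p (X m * (Y m - Y n)) < A * (e / A)"
      unfolding rat_padic_abs_mult[OF p] using A N mn p by (intro mult_strict_mono') auto
    have 2: "rat_padic_abs p ((X m - X n) * Y n) < (e / B) * B"
      unfolding rat_padic_abs_mult[OF p] using B M mn p by (intro mult_strict_mono') auto
    show ?thesis unfolding eq
      using rat_padic_abs_ultra[OF p, of "X m * (Y m - Y n)" "(X m - X n) * Y n"] 1 2 A(1) B(1) by auto
  qed
  thus "\<exists>M. \<forall>m\<ge>M. \<forall>n\<ge>M. rat_padic_abs p (X m * Y m - X n * Y n) < e" by blast
qed

lemma padic_not_null:
  assumes "padic_cauchy p X" "\<not> padic_null p X"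
  shows "\<exists>b>0. \<exists>M. \<forall>n\<ge>M. b < rat_padic_abs p (X n)"
proof -
  let ?L = "lim (\<lambda>n. rat_padic_abs p (X n))"
  have L: "(\<lambda>n. rat_padic_abs p (X n)) \<longlonglongrightarrow> ?L" using padic_cauchy_abs_convergent[OF assms(1)] .
  have "?L \<ge> 0" using L by (rule LIMSEQ_le_const) (auto simp: p)
  moreover have "?L \<noteq> 0" using L assms(2) unfolding padic_null_def by auto
  ultimately have "?L > 0" by simp
  hence "?L / 2 > 0" "?L / 2 < ?L" by auto
  thus ?thesis using order_tendstoD(1)[OF L, of "?L / 2"] unfolding eventually_sequentially by blast
qed

lemma padic_null_inverse_diff:
  assumes "padic_cauchy p X" "\<not> padic_null p X" "padic_cauchy p Y" "\<not> padic_null p Y"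
  shows "\<exists>C>0. \<exists>M. \<forall>m\<ge>M. \<forall>n\<ge>M. X m \<noteq> 0 \<and> Y n \<noteq> 0 \<and>
     rat_padic_abs p (inverse (X m) - inverse (Y n)) \<le> C * rat_padic_abs p (X m - Y n)"
proof -
  obtain a M where a: "a > 0" "\<forall>n\<ge>M. a < rat_padic_abs p (X n)"
    using padic_not_null[OF assms(1,2)] by blast
  obtain b N where b: "b > 0" "\<forall>n\<ge>N. b < rat_padic_abs p (Y n)"
    using padic_not_null[OF assms(3,4)] by blast
  have "X m \<noteq> 0 \<and> Y n \<noteq> 0 \<and>
     rat_padic_abs p (inverse (X m) - inverse (Y n)) \<le> inverse a * inverse b * rat_padic_abs p (X m - Y n)"
    if "m \<ge> max M N" "n \<ge> max M N" for m n
  proof -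
    have x: "a < rat_padic_abs p (X m)" and y: "b < rat_padic_abs p (Y n)" using a b that by auto
    have nz: "X m \<noteq> 0" "Y n \<noteq> 0" using x y a(1) b(1) by auto
    have "inverse (X m) - inverse (Y n) = - (inverse (X m) * (X m - Y n) * inverse (Y n))"
      using nz by (rule inverse_diff_inverse)
    hence "rat_padic_abs p (inverse (X m) - inverse (Y n)) =
       inverse (rat_padic_abs p (X m)) * inverse (rat_padic_abs p (Y n)) * rat_padic_abs p (X m - Y n)"
      by (simp add: rat_padic_abs_mult[OF p] rat_padic_abs_inverse[OF p] p rat_padic_abs_minus[OF p])
    also have "\<dots> \<le> inverse a * inverse b * rat_padic_abs p (X m - Y n)"
      using x y a(1) b(1) p by (intro mult_right_mono mult_mono le_imp_inverse_le) auto
    finally show ?thesis using nz by simp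
  qed
  moreover have "inverse a * inverse b > 0" using a b by simp
  ultimately show ?thesis by blast
qed

lemma padic_cauchy_inverse:
  assumes "padic_cauchy p X" "\<not> padic_null p X" shows "padic_cauchy p (\<lambda>n. inverse (X n))"
  unfolding padic_cauchy_def
proof (intro allI impI)
  fix e :: real assume e: "e > 0"
  obtain C M where C: "C > 0" "\<forall>m\<ge>M. \<forall>n\<ge>M. 
     rat_padic_abs p (inverse (X m) - inverse (X n)) \<le> C * rat_padic_abs p (X m - X n)"
    using padic_null_inverse_diff[OF assms assms] by blast
  obtain N where N: "\<forall>m\<ge>N. \<forall>n\<ge>N. rat_padic_abs p (X m - X n) < e / C"
    using assms(1) e C(1) unfolding padic_cauchy_def by (meson divide_pos_pos)
  have "rat_padic_abs p (inverse (X m) - inverse (X n)) < e" if "m \<ge> max M N" "n \<ge> max M N" for m n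
  proof -
    have "rat_padic_abs p (X m - X n) < e / C" using N that by auto
    hence "C * rat_padic_abs p (X m - X n) < e" using C(1) by (simp add: field_simps)
    moreover have "rat_padic_abs p (inverse (X m) - inverse (X n)) \<le> C * rat_padic_abs p (X m - X n)"
      using C(2) that by auto
    ultimately show ?thesis by linarith
  qed
  thus "\<exists>M. \<forall>m\<ge>M. \<forall>n\<ge>M. rat_padic_abs p (inverse (X m) - inverse (X n)) < e" by blast
qed

lemma padic_rel_inverse:
  assumes "padic_rel p X Y" "\<not> padic_null p X" "\<not> padic_null p Y"
  shows "padic_rel p (\<lambda>n. inverse (X n)) (\<lambda>n. inverse (Y n))"
proof -
  have X: "padic_cauchy p X" and Y: "padic_cauchy p Y" and XY: "padic_null p (\<lambda>n. X n - Y n)"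
    using assms(1) by (auto simp: padic_rel_def)
  obtain C M where C: "C > 0" "\<forall>m\<ge>M. \<forall>n\<ge>M.
     rat_padic_abs p (inverse (X m) - inverse (Y n)) \<le> C * rat_padic_abs p (X m - Y n)"
    using padic_null_inverse_diff[OF X assms(2) Y assms(3)] by blast
  have lim: "(\<lambda>n. C * rat_padic_abs p (X n - Y n)) \<longlonglongrightarrow> 0"
    using tendsto_mult[OF tendsto_const[of C] XY[unfolded padic_null_def]] by simp
  have "(\<lambda>n. rat_padic_abs p (inverse (X n) - inverse (Y n))) \<longlonglongrightarrow> 0"
    by (rule tendsto_sandwich[OF _ _ tendsto_const lim])
       (use C(2) in \<open>auto simp: eventually_sequentially p\<close>)
  thus ?thesis using padic_cauchy_inverse X Y assms unfolding padic_rel_def padic_null_def by auto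
qed

lemma padic_null_cong: "padic_null p (\<lambda>n. X n - Y n) \<Longrightarrow> padic_null p X \<longleftrightarrow> padic_null p Y"
  using padic_null_add[of "\<lambda>n. X n - Y n" Y] padic_null_diff[of X "\<lambda>n. X n - Y n"] by auto

lemma part_equivp_padic_rel: "part_equivp (padic_rel p)"
proof (rule part_equivpI)
  show "\<exists>X. padic_rel p X X" by (rule exI[of _ "\<lambda>n. 0"]) (simp add: padic_rel_def)
  show "symp (padic_rel p)"
    by (auto simp: symp_def padic_rel_def padic_null_def rat_padic_abs_minus_commute[OF p])
  show "transp (padic_rel p)"
  proof (rule transpI)
    fix X Y Z assume "padic_rel p X Y" "padic_rel p Y Z"
    thus "padic_rel p X Z"
      using padic_null_add[of "\<lambda>n. X n - Y n" "\<lambda>n. Y n - Z n"] by (simp add: padic_rel_def)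
  qed
qed

lemma padic_rel_lim:
  assumes "padic_rel p X Y"
  shows "lim (\<lambda>n. rat_padic_abs p (X n)) = lim (\<lambda>n. rat_padic_abs p (Y n))"
proof -
  have X: "padic_cauchy p X" and Y: "padic_cauchy p Y" and XY: "padic_null p (\<lambda>n. X n - Y n)"
    using assms by (auto simp: padic_rel_def)
  have "(\<lambda>n. \<bar>rat_padic_abs p (X n) - rat_padic_abs p (Y n)\<bar>) \<longlonglongrightarrow> 0"
    by (rule tendsto_sandwich[OF _ _ tendsto_const XY[unfolded padic_null_def]])
       (auto simp: rat_padic_abs_triangle_diff[OF p])
  hence "(\<lambda>n. rat_padic_abs p (X n) - rat_padic_abs p (Y n)) \<longlonglongrightarrow> 0"
    by (simp add: tendsto_rabs_zero_iff)
  moreover have "(\<lambda>n. rat_padic_abs p (X n) - rat_padic_abs p (Y n)) \<longlonglongrightarrow>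
      lim (\<lambda>n. rat_padic_abs p (X n)) - lim (\<lambda>n. rat_padic_abs p (Y n))"
    by (intro tendsto_diff padic_cauchy_abs_convergent X Y)
  ultimately show ?thesis using LIMSEQ_unique by fastforce
qed

end


section \<open>The field of p-adic numbers\<close>

text \<open>
  The prime is carried by the type parameter: with \<open>p = CARD('p)\<close>, the type \<open>'p padic\<close> is the
  completion of the rationals for the p-adic absolute value. A type variable of class
  \<open>prime_card\<close> ranges over all types with prime cardinality, hence over all primes.
\<close>

text \<open>
  The command \<open>quotient_type\<close> does not cope with a type parameter that occurs in the relation but
  not in the representing type, so the quotient is set up by hand.
\<close>

typedef 'a padic = "{C. \<exists>X. padic_cauchy CARD('a::prime_card) X \<and> C = Collect (padic_rel CARD('a) X)}"
  morphisms padic_class Abs_padic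
  using padic_cauchy_const by blast

definition Padic :: "(nat \<Rightarrow> rat) \<Rightarrow> 'a::prime_card padic" where
  "Padic X = Abs_padic (Collect (padic_rel CARD('a) X))"

definition rep_padic :: "'a::prime_card padic \<Rightarrow> nat \<Rightarrow> rat" where
  "rep_padic x = (SOME X. X \<in> padic_class x)"

definition cr_padic :: "(nat \<Rightarrow> rat) \<Rightarrow> 'a::prime_card padic \<Rightarrow> bool" where
  "cr_padic X x \<longleftrightarrow> padic_rel CARD('a) X X \<and> Padic X = x"

lemma Quotient_padic:
  "Quotient (padic_rel CARD('a)) (Padic :: _ \<Rightarrow> 'a::prime_card padic) rep_padic cr_padic"
proof -
  let ?R = "padic_rel CARD('a)"
  have pe: "part_equivp ?R" by (rule part_equivp_padic_rel[OF prime_card])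
  have sym: "?R Y X" if "?R X Y" for X Y using part_equivp_symp[OF pe] that by blast
  have trans: "?R X Z" if "?R X Y" "?R Y Z" for X Y Z using part_equivp_transp[OF pe] that by blast
  have eqc: "Collect (?R X) = Collect (?R Y)" if xy: "?R X Y" for X Y
  proof (intro Collect_cong iffI)
    fix Z
    show "?R Y Z" if "?R X Z" by (rule trans[OF sym[OF xy] that])
    show "?R X Z" if "?R Y Z" by (rule trans[OF xy that])
  qed
  have refl: "?R X X \<longleftrightarrow> padic_cauchy CARD('a) X" for X by (simp add: padic_rel_def)
  have cls: "padic_class (Padic X :: 'a padic) = Collect (?R X)" if "?R X X" for X
    unfolding Padic_def using that by (subst Abs_padic_inverse) (auto simp: refl)
  have ex: "\<exists>X. ?R X X \<and> padic_class x = Collect (?R X)" for x :: "'a padic"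
    using padic_class[of x] by (auto simp: refl)
  have rep: "?R (rep_padic x) (rep_padic x) \<and> padic_class x = Collect (?R (rep_padic x))"
    for x :: "'a padic"
  proof -
    obtain X where X: "?R X X" "padic_class x = Collect (?R X)" using ex[of x] by (elim exE conjE)
    hence "rep_padic x \<in> padic_class x" unfolding rep_padic_def by (intro someI[of "\<lambda>X. X \<in> padic_class x" X]) simp
    hence h: "?R X (rep_padic x)" using X by simp
    have "?R (rep_padic x) (rep_padic x)" by (rule trans[OF sym[OF h] h])
    thus ?thesis using X(2) eqc[OF h] by simp
  qed
  have abs_rep: "Padic (rep_padic x) = x" for x :: "'a padic"
    using cls[of "rep_padic x"] rep[of x] by (simp flip: padic_class_inject)
  have rel: "?R X Y \<longleftrightarrow> ?R X X \<and> ?R Y Y \<and> (Padic X :: 'a padic) = Padic Y" for X Y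
  proof
    assume a: "?R X Y"
    have "?R X X" "?R Y Y" using trans[OF a sym[OF a]] trans[OF sym[OF a] a] .
    thus "?R X X \<and> ?R Y Y \<and> (Padic X :: 'a padic) = Padic Y"
      unfolding Padic_def eqc[OF a] by simp
  next
    assume a: "?R X X \<and> ?R Y Y \<and> (Padic X :: 'a padic) = Padic Y"
    hence "Collect (?R X) = Collect (?R Y)" using cls[of X] cls[of Y] by simp
    moreover have "Y \<in> Collect (?R Y)" using a by simp
    ultimately have "Y \<in> Collect (?R X)" by (simp only:)
    thus "?R X Y" by simp
  qed
  have cr: "cr_padic = (\<lambda>X y. ?R X X \<and> (Padic X :: 'a padic) = y)"
    by (intro ext) (rule cr_padic_def)
  show ?thesis
    by (rule QuotientI[OF abs_rep conjunct1[OF rep] rel cr])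
qed

setup_lifting Quotient_padic

instantiation padic :: (prime_card) field
begin

lift_definition zero_padic :: "'a padic" is "\<lambda>n. 0"
  by (simp add: padic_rel_def)

lift_definition one_padic :: "'a padic" is "\<lambda>n. 1"
  by (simp add: padic_rel_def)

lift_definition plus_padic :: "'a padic \<Rightarrow> 'a padic \<Rightarrow> 'a padic" is "\<lambda>X Y n. X n + Y n"
  unfolding padic_rel_def add_diff_add
  by (auto intro: padic_cauchy_add padic_null_add prime_card)

lift_definition uminus_padic :: "'a padic \<Rightarrow> 'a padic" is "\<lambda>X n. - X n"
  unfolding padic_rel_def minus_diff_minus
  by (intro conjI padic_cauchy_minus padic_null_minus prime_card; blast)

lift_definition times_padic :: "'a padic \<Rightarrow> 'a padic \<Rightarrow> 'a padic" is "\<lambda>X Y n. X n * Y n"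
proof -
  fix X X' Y Y' :: "nat \<Rightarrow> rat"
  assume a: "padic_rel CARD('a) X X'" "padic_rel CARD('a) Y Y'"
  have "padic_null CARD('a) (\<lambda>n. X n * (Y n - Y' n) + Y' n * (X n - X' n))"
    using a unfolding padic_rel_def
    by (intro padic_null_add padic_null_mult_bounded prime_card) auto
  moreover have "X n * (Y n - Y' n) + Y' n * (X n - X' n) = X n * Y n - X' n * Y' n" for n
    by (simp add: algebra_simps)
  ultimately show "padic_rel CARD('a) (\<lambda>n. X n * Y n) (\<lambda>n. X' n * Y' n)"
    using a unfolding padic_rel_def by (auto intro: padic_cauchy_mult prime_card)
qed

lift_definition inverse_padic :: "'a padic \<Rightarrow> 'a padic"
  is "\<lambda>X. if padic_null CARD('a) X then (\<lambda>n. 0) else (\<lambda>n. inverse (X n))"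
proof -
  fix X Y :: "nat \<Rightarrow> rat"
  assume a: "padic_rel CARD('a) X Y"
  hence "padic_null CARD('a) X \<longleftrightarrow> padic_null CARD('a) Y"
    by (auto simp: padic_rel_def padic_null_cong[OF prime_card])
  thus "padic_rel CARD('a) (if padic_null CARD('a) X then (\<lambda>n. 0) else (\<lambda>n. inverse (X n)))
          (if padic_null CARD('a) Y then (\<lambda>n. 0) else (\<lambda>n. inverse (Y n)))"
    using padic_rel_inverse[OF prime_card a] by (auto simp: padic_rel_def)
qed

definition minus_padic :: "'a padic \<Rightarrow> 'a padic \<Rightarrow> 'a padic" where
  "minus_padic x y = x + (- y)"

definition divide_padic :: "'a padic \<Rightarrow> 'a padic \<Rightarrow> 'a padic" where
  "divide_padic x y = x * inverse y"

instance
proof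
  fix a b c :: "'a padic"
  show "a + b = b + a"
    by transfer (simp add: padic_rel_def add.commute padic_cauchy_add[OF prime_card])
  show "a + b + c = a + (b + c)"
    by transfer (simp add: padic_rel_def ac_simps padic_cauchy_add[OF prime_card])
  show "0 + a = a" by transfer (simp add: padic_rel_def)
  show "- a + a = 0" by transfer (simp add: padic_rel_def)
  show "a - b = a + - b" by (fact minus_padic_def)
  show "a * b * c = a * (b * c)"
    by transfer (simp add: padic_rel_def ac_simps padic_cauchy_mult[OF prime_card])
  show "a * b = b * a"
    by transfer (simp add: padic_rel_def mult.commute padic_cauchy_mult[OF prime_card])
  show "1 * a = a" by transfer (simp add: padic_rel_def)
  show "(a + b) * c = a * c + b * c"
    by transfer (simp add: padic_rel_def distrib_right padic_cauchy_mult[OF prime_card] padic_cauchy_add[OF prime_card])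
  show "(0::'a padic) \<noteq> 1"
    by transfer (simp add: padic_rel_def padic_null_def rat_padic_abs_minus[OF prime_card] rat_padic_abs_1[OF prime_card] LIMSEQ_const_iff)
  show "a \<noteq> 0 \<Longrightarrow> inverse a * a = 1"
  proof transfer
    fix X :: "nat \<Rightarrow> rat"
    assume a: "padic_rel CARD('a) X X" "\<not> padic_rel CARD('a) X (\<lambda>n. 0)"
    hence X: "padic_cauchy CARD('a) X" "\<not> padic_null CARD('a) X" by (auto simp: padic_rel_def)
    obtain M where "\<forall>n\<ge>M. X n \<noteq> 0"
      using padic_null_inverse_diff[OF prime_card X X] by blast
    hence "eventually (\<lambda>n. inverse (X n) * X n - 1 = 0) sequentially"
      unfolding eventually_sequentially by (intro exI[of _ M]) auto
    hence "padic_null CARD('a) (\<lambda>n. inverse (X n) * X n - 1)"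
      unfolding padic_null_def
      by (intro tendsto_eventually) (auto elim: eventually_mono)
    thus "padic_rel CARD('a) (\<lambda>n. (if padic_null CARD('a) X then \<lambda>n. 0 else (\<lambda>n. inverse (X n))) n * X n) (\<lambda>n. 1)"
      using X by (simp add: padic_rel_def padic_cauchy_mult[OF prime_card] padic_cauchy_inverse[OF prime_card])
  qed
  show "a div b = a * inverse b" by (fact divide_padic_def)
  show "inverse (0::'a padic) = 0" by transfer (simp add: padic_rel_def)
qed

end

text \<open>
  The absolute value is extended from the rationals by continuity; the sequence of absolute values
  of a Cauchy sequence converges.
\<close>

lift_definition padic_norm :: "'a::prime_card padic \<Rightarrow> real"
  is "\<lambda>X. lim (\<lambda>n. rat_padic_abs CARD('a) (X n))"
  by (rule padic_rel_lim[OF prime_card])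

lemma padic_norm_of_nat_prime: "padic_norm (of_nat CARD('p) :: 'p::prime_card padic) = 1 / real CARD('p)"
proof -
  have of_nat: "of_nat k = (Padic (\<lambda>n. of_nat k) :: 'p padic)" for k
    by (induction k) (simp_all add: zero_padic.abs_eq one_padic.abs_eq plus_padic.abs_eq padic_rel_def eq_onp_def)
  have p: "prime CARD('p)" by (rule prime_card)
  have pe: "prime_elem (int CARD('p))" using p by auto
  have "multiplicity (int CARD('p)) (int CARD('p)) = 1" using pe by (rule multiplicity_prime)
  hence "rat_padic_abs CARD('p) (of_nat CARD('p)) = 1 / real CARD('p)"
    using prime_gt_0_nat[OF p]
    by (simp add: rat_padic_abs_def rat_padic_val_def power_int_minus field_simps)
  thus ?thesis unfolding of_nat
    by (simp add: padic_norm.abs_eq padic_rel_def)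
qed

lemma padic_norm_eq_0 [simp]: "padic_norm x = 0 \<longleftrightarrow> x = 0" for x :: "'p::prime_card padic"
proof transfer
  fix X assume "padic_rel CARD('p) X X"
  thus "lim (\<lambda>n. rat_padic_abs CARD('p) (X n)) = 0 \<longleftrightarrow> padic_rel CARD('p) X (\<lambda>n. 0)"
    using padic_cauchy_abs_convergent[OF prime_card, of X]
    by (auto simp: padic_rel_def padic_null_def intro: limI)
qed

lemma padic_norm_mult: "padic_norm (x * y) = padic_norm x * padic_norm y" for x y :: "'p::prime_card padic"
proof transfer
  fix X Y assume "padic_rel CARD('p) X X" "padic_rel CARD('p) Y Y"
  thus "lim (\<lambda>n. rat_padic_abs CARD('p) (X n * Y n)) =
    lim (\<lambda>n. rat_padic_abs CARD('p) (X n)) * lim (\<lambda>n. rat_padic_abs CARD('p) (Y n))"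
    unfolding rat_padic_abs_mult[OF prime_card] padic_rel_def
    by (intro limI tendsto_mult padic_cauchy_abs_convergent[OF prime_card]) auto
qed

lemma padic_norm_ultra: "padic_norm (x + y) \<le> max (padic_norm x) (padic_norm y)" for x y :: "'p::prime_card padic"
proof transfer
  fix X Y assume "padic_rel CARD('p) X X" "padic_rel CARD('p) Y Y"
  hence XY: "padic_cauchy CARD('p) X" "padic_cauchy CARD('p) Y" by (auto simp: padic_rel_def)
  show "lim (\<lambda>n. rat_padic_abs CARD('p) (X n + Y n)) \<le>
    max (lim (\<lambda>n. rat_padic_abs CARD('p) (X n))) (lim (\<lambda>n. rat_padic_abs CARD('p) (Y n)))"
    by (rule LIMSEQ_le[OF padic_cauchy_abs_convergent[OF prime_card padic_cauchy_add[OF prime_card XY]]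
          tendsto_max[OF padic_cauchy_abs_convergent[OF prime_card XY(1)] padic_cauchy_abs_convergent[OF prime_card XY(2)]]])
       (auto simp: rat_padic_abs_ultra[OF prime_card])
qed


section \<open>Hausdorff dimension\<close>

text \<open>
  The distance function \<open>d\<close> is an explicit argument, since the metric that the library puts on a
  product type is the Euclidean combination of the two distances rather than their maximum.
  Diameters are only used below for sets on which \<open>d\<close> is bounded. The conventions are
  \<open>diam {} ^ s = 0\<close> for all \<open>s\<close> and \<open>diam U ^ 0 = 1\<close> for nonempty \<open>U\<close>, so that the empty set has
  dimension 0.
\<close>

definition diam_powr :: "('a \<Rightarrow> 'a \<Rightarrow> real) \<Rightarrow> real \<Rightarrow> 'a set \<Rightarrow> real" where
  "diam_powr d s U =
     (if U = {} then 0 else if s = 0 then 1 else (SUP (x, y)\<in>U \<times> U. d x y) powr s)"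

definition hausdorff_premeasure ::
    "('a \<Rightarrow> 'a \<Rightarrow> real) \<Rightarrow> real \<Rightarrow> real \<Rightarrow> 'a set \<Rightarrow> ennreal" where
  "hausdorff_premeasure d s \<delta> S =
     (INF U \<in> {U :: nat \<Rightarrow> 'a set. S \<subseteq> (\<Union>i. U i) \<and> (\<forall>i. \<forall>x\<in>U i. \<forall>y\<in>U i. d x y \<le> \<delta>)}.
        \<Sum>i. ennreal (diam_powr d s (U i)))"

definition hausdorff_measure :: "('a \<Rightarrow> 'a \<Rightarrow> real) \<Rightarrow> real \<Rightarrow> 'a set \<Rightarrow> ennreal" where
  "hausdorff_measure d s S = (SUP \<delta> \<in> {0<..}. hausdorff_premeasure d s \<delta> S)"

definition hausdorff_dim :: "('a \<Rightarrow> 'a \<Rightarrow> real) \<Rightarrow> 'a set \<Rightarrow> ereal" where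
  "hausdorff_dim d S = Inf {ereal s | s. s \<ge> 0 \<and> hausdorff_measure d s S = 0}"


section \<open>The p-adic plane, lines and Furstenberg sets\<close>

type_synonym 'p padic_plane = "'p padic \<times> 'p padic"

definition plane_norm :: "'p::prime_card padic_plane \<Rightarrow> real" where
  "plane_norm u = max (padic_norm (fst u)) (padic_norm (snd u))"

definition plane_dist :: "'p::prime_card padic_plane \<Rightarrow> 'p padic_plane \<Rightarrow> real" where
  "plane_dist u v = plane_norm (fst u - fst v, snd u - snd v)"

definition affine_line :: "'p::prime_card padic_plane set \<Rightarrow> bool" where
  "affine_line l \<longleftrightarrow>
     (\<exists>x0 y0 u v. (u, v) \<noteq> (0, 0) \<and> l = {(x0 + r * u, y0 + r * v) | r. True})"

definition line_family_dim :: "'p::prime_card padic_plane set set \<Rightarrow> ereal" where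
  "line_family_dim L =
     max (hausdorff_dim plane_dist {(a, b). {(x, y). y = a * x + b} \<in> L})
         (hausdorff_dim plane_dist {(a, b). {(x, y). x = a * y + b} \<in> L})"

definition furstenberg_set :: "real \<Rightarrow> real \<Rightarrow> 'p::prime_card padic_plane set \<Rightarrow> bool" where
  "furstenberg_set s t E \<longleftrightarrow>
     (\<exists>L. (\<forall>l\<in>L. affine_line l) \<and> line_family_dim L \<ge> ereal t \<and>
          (\<forall>l\<in>L. hausdorff_dim plane_dist (E \<inter> l) \<ge> ereal s))"

end

theory Submission
  imports Defs
begin

text \<open>
  Write \<open>q\<close> for the prime. The lower bound is reduced to a discretised point-line incidence estimate at
  a single well-chosen scale, which is possible because an economical cover of \<open>E\<close> by balls can be
  made evenly spread.

  Suppose that the \<open>\<sigma>\<close>-dimensional measure of \<open>E\<close> vanishes for some \<open>\<sigma> < s + 1\<close>. After a dilation,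
  \<open>E\<close> and the parameters of the lines lie in the unit square, where balls of radius \<open>q\<^sup>-\<^sup>k\<close> are residue
  classes modulo \<open>q\<^sup>k\<close> (\<open>graph_family_lower_bound\<close>). A cheap cover of \<open>E\<close> is coarsened: whenever
  the covering balls inside a ball \<open>B\<close> together cost at least as much as \<open>B\<close>, they are replaced by \<open>B\<close>.
  In the result, a ball of radius \<open>\<rho>\<close> contains at most \<open>(\<rho>/\<delta>)\<^sup>\<sigma>\<close> of the covering balls of radius \<open>\<delta>\<close>
  (\<open>balanced_cover\<close>). By pigeonholing over the scales there is one \<open>\<delta> = q\<^sup>-\<^sup>k\<close> such that a set of
  lines of almost full dimension \<open>t\<close> is left, each of which meets about \<open>\<delta>\<^sup>-\<^sup>s\<close> covering balls of radius
  \<open>\<delta>\<close>. On the residue classes of these lines, a greedy procedure yields weights that satisfy a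
  Frostman condition with exponent \<open>t\<close> (\<open>discrete_frostman\<close>). What remains is a weighted count of
  incidences modulo \<open>q\<^sup>k\<close> (\<open>incidence_bound\<close>).

  That count is a high-low argument. The weight of the lines through a point is written as its mean
  plus the differences \<open>D\<^sub>j\<close> between its averages over classes modulo \<open>q\<^sup>j\<close> and modulo \<open>q\<^sup>j\<^sup>-\<^sup>1\<close>. The sum of
  \<open>D\<^sub>j\<^sup>2\<close> over all classes expands into a sum over pairs of lines of the increment \<open>R\<^sub>j - R\<^sub>j\<^sub>-\<^sub>1\<close>, with \<open>R\<^sub>j\<close>
  the number of common points of the two lines modulo \<open>q\<^sup>j\<close>; this number can only grow with \<open>j\<close> when the
  lines agree modulo \<open>q\<^sup>j\<close> (\<open>root_count_step\<close>), and the Frostman condition bounds the weight of such pairs.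
  Cauchy-Schwarz and the even spread of the balls then show that a line meets at most about
  \<open>\<delta>\<^sup>-\<^sup>\<theta>\<close> balls on average, with \<open>\<theta>\<close> the maximum of \<open>\<sigma> - 1\<close> and \<open>(\<sigma> + 1 - t)/2\<close>. If \<open>s + t \<ge> 2\<close> and \<open>\<sigma> < s + 1\<close>
  then both are smaller than \<open>s\<close>, which is a contradiction for small \<open>\<delta>\<close>.

  For the sharpness, let \<open>C\<close> be the set of p-adic integers whose digits vanish outside a set of
  positions of density \<open>s\<close>, and let \<open>E\<close> be the product of \<open>C\<close> with the p-adic integers. Every line
  \<open>y = a x + b\<close> with integral \<open>a\<close> and \<open>b\<close> meets \<open>E\<close> in a graph over \<open>C\<close>, of dimension \<open>s\<close>, and these lines
  form a family of dimension 2. Counting residues gives dimension at most \<open>s + 1\<close> for \<open>E\<close>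
  (\<open>digit_set_null\<close>), and lower bounds for dimensions of digit sets come from Lebesgue measure on the
  unit interval (\<open>digit_set_content_pos\<close>).
\<close>

section \<open>Point-line incidences modulo prime powers\<close>

lemma sum_periodic:
  fixes g :: "int \<Rightarrow> real"
  assumes m: "m > 0" and per: "\<And>x. g (x mod m) = g x"
  shows "(\<Sum>x\<in>{0..<m * int q}. g x) = real q * (\<Sum>x\<in>{0..<m}. g x)"
proof -
  have "(\<Sum>x\<in>{0..<m * int q}. g x) = (\<Sum>(i, x)\<in>{0..<int q} \<times> {0..<m}. g x)"
  proof (rule sum.reindex_bij_witness[of _ "\<lambda>(i, x). m * i + x" "\<lambda>x. (x div m, x mod m)"])
    fix x assume x: "x \<in> {0..<m * int q}"
    show "(case (x div m, x mod m) of (i, x) \<Rightarrow> m * i + x) = x" by simp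
    have "x div m < int q"
    proof (rule ccontr)
      assume "\<not> x div m < int q"
      hence "m * int q \<le> m * (x div m)" using m by (intro mult_left_mono) auto
      also have "\<dots> \<le> x" using mult_div_mod_eq[of m x] pos_mod_sign[OF m, of x] by linarith
      finally show False using x by simp
    qed
    thus "(x div m, x mod m) \<in> {0..<int q} \<times> {0..<m}"
      using x m by (auto simp: pos_imp_zdiv_nonneg_iff)
    show "(case (x div m, x mod m) of (i, x) \<Rightarrow> g x) = g x" using per by simp
  next
    fix ix assume "ix \<in> {0..<int q} \<times> {0..<m}"
    then obtain i x where ix: "ix = (i, x)" "0 \<le> i" "i < int q" "0 \<le> x" "x < m" by auto
    show "((case ix of (i, x) \<Rightarrow> m * i + x) div m, (case ix of (i, x) \<Rightarrow> m * i + x) mod m) = ix"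
      using ix m by simp
    have "m * i + x < m * (i + 1)" using ix by (simp add: algebra_simps)
    also have "\<dots> \<le> m * int q" using ix m by (intro mult_left_mono) auto
    finally show "(case ix of (i, x) \<Rightarrow> m * i + x) \<in> {0..<m * int q}" using ix m by auto
  qed
  also have "\<dots> = real q * (\<Sum>x\<in>{0..<m}. g x)"
    by (simp flip: sum.cartesian_product)
  finally show ?thesis .
qed

text \<open>
  Two lines with slopes differing by \<open>\<alpha>\<close> and intercepts differing by \<open>\<beta>\<close> have this number of common
  points modulo \<open>m\<close>.
\<close>

definition root_count :: "int \<Rightarrow> int \<Rightarrow> int \<Rightarrow> nat" where
  "root_count m \<alpha> \<beta> = card {x \<in> {0..<m}. m dvd \<alpha> * x + \<beta>}"

text \<open>
  If \<open>\<alpha>\<close> is not divisible by the higher power, then differences of solutions are divisible by \<open>q\<close>, and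
  dividing them by \<open>q\<close> (around a fixed solution) embeds the solutions modulo \<open>q\<^sup>j\<^sup>+\<^sup>1\<close> into those modulo \<open>q\<^sup>j\<close>.
  So new common points of two lines appear only where the lines have the same class.
\<close>

lemma root_count_step:
  fixes \<alpha> \<beta> :: int
  assumes q: "prime q"
  shows "real (root_count (int q ^ Suc j) \<alpha> \<beta>) - real (root_count (int q ^ j) \<alpha> \<beta>)
    \<le> (if int q ^ Suc j dvd \<alpha> \<and> int q ^ Suc j dvd \<beta> then real q ^ Suc j else 0)"
proof -
  let ?m = "int q ^ Suc j" and ?n = "int q ^ j"
  let ?A = "{x \<in> {0..<?m}. ?m dvd \<alpha> * x + \<beta>}" and ?B = "{x \<in> {0..<?n}. ?n dvd \<alpha> * x + \<beta>}"
  have q0: "q > 0" using q prime_gt_0_nat by blast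
  have "card ?A \<le> card {0..<?m}" by (intro card_mono) auto
  hence "card ?A \<le> q ^ Suc j" by (simp add: nat_power_eq nat_mult_distrib)
  hence triv: "real (card ?A) \<le> real q ^ Suc j" by (metis of_nat_le_iff of_nat_power)
  show ?thesis
  proof (cases "?m dvd \<alpha>")
    case True
    show ?thesis
    proof (cases "?m dvd \<beta>")
      case False
      hence "?A = {}" using True by (auto simp: dvd_add_right_iff simp del: power_Suc)
      hence "card ?A = 0" by (simp only: card.empty)
      thus ?thesis using False by (simp add: root_count_def del: power_Suc)
    qed (use True triv in \<open>simp add: root_count_def\<close>)
  next
    case nd: False
    have "card ?A \<le> card ?B"
    proof (cases "?A = {}")
      case False
      then obtain x0 where x0: "x0 \<in> ?A" by blast
      have qd: "int q dvd x - x0" if "x \<in> ?A" for x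
      proof (rule ccontr)
        assume "\<not> int q dvd x - x0"
        hence "coprime (int q) (x - x0)" using q by (simp add: prime_imp_coprime)
        hence cp: "coprime ?m (x - x0)" by simp
        have "?m dvd (\<alpha> * x + \<beta>) - (\<alpha> * x0 + \<beta>)" using that x0 by (intro dvd_diff) auto
        hence "?m dvd \<alpha> * (x - x0)" by (simp add: algebra_simps)
        thus False using cp nd coprime_dvd_mult_left_iff by blast
      qed
      have qx: "x = x0 + int q * ((x - x0) div int q)" if "x \<in> ?A" for x
        using qd[OF that] by simp
      \<comment> \<open>The contraction by \<open>1 / q\<close> about the solution \<open>x0\<close>.\<close>
      let ?f = "\<lambda>x. (x0 + (x - x0) div int q) mod ?n"
      have inj: "inj_on ?f ?A"
      proof (rule inj_onI)
        fix x y assume xy: "x \<in> ?A" "y \<in> ?A" "?f x = ?f y"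
        have "?n dvd (x0 + (x - x0) div int q) - (x0 + (y - x0) div int q)"
          using xy(3) by (simp add: mod_eq_dvd_iff)
        hence "int q * ?n dvd int q * ((x - x0) div int q - (y - x0) div int q)"
          by (intro mult_dvd_mono) auto
        also have "int q * ((x - x0) div int q - (y - x0) div int q) = x - y"
          using qx[OF xy(1)] qx[OF xy(2)] by (simp add: algebra_simps)
        finally have "x mod ?m = y mod ?m" by (simp add: mod_eq_dvd_iff)
        thus "x = y" using xy by simp
      qed
      have sub: "?f ` ?A \<subseteq> ?B"
      proof (rule image_subsetI)
        fix x assume x: "x \<in> ?A"
        let ?d = "(x - x0) div int q"
        have "?m dvd (\<alpha> * x + \<beta>) - (\<alpha> * x0 + \<beta>)" using x x0 by (intro dvd_diff) auto
        also have "(\<alpha> * x + \<beta>) - (\<alpha> * x0 + \<beta>) = int q * (\<alpha> * ?d)"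
        proof -
          have "(\<alpha> * x + \<beta>) - (\<alpha> * x0 + \<beta>) = \<alpha> * (x - x0)" by (simp add: algebra_simps)
          also have "x - x0 = int q * ?d" using qd[OF x] by simp
          finally show ?thesis by simp
        qed
        finally have "?n dvd \<alpha> * ?d" using q0 by simp
        moreover have "?n dvd \<alpha> * x0 + \<beta>" using x0 dvd_trans[of ?n ?m] by auto
        ultimately have "?n dvd \<alpha> * ?d + (\<alpha> * x0 + \<beta>)" by (rule dvd_add)
        hence "?n dvd \<alpha> * (x0 + ?d) + \<beta>" by (simp add: algebra_simps)
        hence "(\<alpha> * (x0 + ?d) + \<beta>) mod ?n = 0" by simp
        hence "(\<alpha> * ?f x + \<beta>) mod ?n = 0" by (metis mod_add_left_eq mod_mult_right_eq)
        hence "?n dvd \<alpha> * ?f x + \<beta>" by blast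
        thus "?f x \<in> ?B" using q0 by auto
      qed
      have "finite ?B" by (rule finite_subset[of _ "{0..<?n}"]) auto
      thus ?thesis using card_inj_on_le[OF inj sub] by blast
    next
      case True
      hence "card ?A = 0" by (simp only: card.empty)
      thus ?thesis by simp
    qed
    thus ?thesis using nd by (simp add: root_count_def)
  qed
qed

text \<open>
  A pair \<open>(a, b)\<close> stands for the line \<open>y = a x + b\<close>.
\<close>

definition on_line_mod :: "int \<Rightarrow> int \<times> int \<Rightarrow> int \<times> int \<Rightarrow> bool" where
  "on_line_mod m l z \<longleftrightarrow> m dvd fst l * fst z + snd l - snd z"

lemma on_line_mod_cong:
  assumes "fst z mod m = fst z' mod m" "snd z mod m = snd z' mod m"
  shows "on_line_mod m l z \<longleftrightarrow> on_line_mod m l z'"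
proof -
  have "(fst l * fst z + snd l) mod m = (fst l * fst z' + snd l) mod m"
    using assms(1) by (metis mod_add_left_eq mod_mult_right_eq)
  thus ?thesis unfolding on_line_mod_def mod_eq_dvd_iff[symmetric] using assms(2) by simp
qed

definition hits :: "int \<Rightarrow> int \<times> int \<Rightarrow> int \<times> int \<Rightarrow> real" where
  "hits m l z = of_bool (on_line_mod m l z)"

lemma sum_point_on_line:
  assumes m: "m > 0" 
  shows "(\<Sum>y\<in>{0..<m}. of_bool (on_line_mod m l (x, y)) * g y) = (g ((fst l * x + snd l) mod m) :: real)"
proof -
  have "of_bool (on_line_mod m l (x, y)) * g y = (if y = (fst l * x + snd l) mod m then g y else 0)"
    if "y \<in> {0..<m}" for y
    using that m unfolding on_line_mod_def mod_eq_dvd_iff[symmetric] by auto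
  hence "(\<Sum>y\<in>{0..<m}. of_bool (on_line_mod m l (x, y)) * g y) =
     (\<Sum>y\<in>{0..<m}. if y = (fst l * x + snd l) mod m then g y else 0)" by (rule sum.cong[OF refl])
  also have "\<dots> = g ((fst l * x + snd l) mod m)" using m by (simp add: sum.delta')
  finally show ?thesis .
qed

lemma hits_inner:
  assumes m: "m > 0"
  shows "(\<Sum>x\<in>{0..<m}. \<Sum>y\<in>{0..<m}. hits m l (x, y) * hits m l' (x, y))
     = real (root_count m (fst l - fst l') (snd l - snd l'))"
proof -
  have "(\<Sum>y\<in>{0..<m}. hits m l (x, y) * hits m l' (x, y)) =
     of_bool (m dvd (fst l - fst l') * x + (snd l - snd l'))" for x
  proof -
    have "(\<Sum>y\<in>{0..<m}. hits m l (x, y) * hits m l' (x, y)) = hits m l' (x, (fst l * x + snd l) mod m)"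
      unfolding hits_def by (rule sum_point_on_line[OF m])
    also have "\<dots> = hits m l' (x, fst l * x + snd l)"
      unfolding hits_def by (subst on_line_mod_cong[of _ _ "(x, fst l * x + snd l)"]) auto
    also have "\<dots> = of_bool (m dvd (fst l - fst l') * x + (snd l - snd l'))"
      unfolding hits_def on_line_mod_def
      by (subst dvd_minus_iff[symmetric]) (simp add: algebra_simps)
    finally show ?thesis .
  qed
  thus ?thesis by (simp add: root_count_def Int_def sum.If_cases flip: of_bool_def)
qed

text \<open>
  The exact orthogonality behind the incidence bound. Modulo \<open>q\<^sup>j\<^sup>+\<^sup>1\<close>, a line occupies \<open>q\<close> of the \<open>q\<^sup>2\<close> lifts
  of each class that it hits modulo \<open>q\<^sup>j\<close>, so subtracting the average at the coarser level
  subtracts exactly the coarser inner product.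
\<close>

lemma hits_inner_step:
  fixes j :: nat
  assumes q: "q > 0"
  defines "m \<equiv> int q ^ Suc j" and "n \<equiv> int q ^ j"
  shows "(\<Sum>x\<in>{0..<m}. \<Sum>y\<in>{0..<m}.
       (hits m l (x, y) - hits n l (x, y) / real q) * (hits m l' (x, y) - hits n l' (x, y) / real q))
     = real (root_count m (fst l - fst l') (snd l - snd l')) - real (root_count n (fst l - fst l') (snd l - snd l'))"
proof -
  let ?R = "real (root_count n (fst l - fst l') (snd l - snd l'))"
  have m0: "m > 0" and n0: "n > 0" and mn: "m = n * int q" using q by (auto simp: m_def n_def)
  have cross: "(\<Sum>x\<in>{0..<m}. \<Sum>y\<in>{0..<m}. hits m l (x, y) * hits n l' (x, y)) = real q * real (root_count n (fst l - fst l') (snd l - snd l'))" for l l'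
  proof -
    have "(\<Sum>y\<in>{0..<m}. hits m l (x, y) * hits n l' (x, y)) =
       of_bool (n dvd (fst l - fst l') * x + (snd l - snd l'))" for x
    proof -
      have "(\<Sum>y\<in>{0..<m}. hits m l (x, y) * hits n l' (x, y)) = hits n l' (x, (fst l * x + snd l) mod m)"
        unfolding hits_def by (rule sum_point_on_line[OF m0])
      also have "\<dots> = hits n l' (x, fst l * x + snd l)"
        unfolding hits_def by (subst on_line_mod_cong[of _ _ "(x, fst l * x + snd l)"]) (auto simp: mn mod_mod_cancel)
      also have "\<dots> = of_bool (n dvd (fst l - fst l') * x + (snd l - snd l'))"
        unfolding hits_def on_line_mod_def
        by (subst dvd_minus_iff[symmetric]) (simp add: algebra_simps)
      finally show ?thesis .
    qed
    hence "(\<Sum>x\<in>{0..<m}. \<Sum>y\<in>{0..<m}. hits m l (x, y) * hits n l' (x, y)) =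
       (\<Sum>x\<in>{0..<n * int q}. of_bool (n dvd (fst l - fst l') * x + (snd l - snd l')))" by (simp add: mn)
    also have "\<dots> = real q * (\<Sum>x\<in>{0..<n}. of_bool (n dvd (fst l - fst l') * x + (snd l - snd l')))"
    proof (rule sum_periodic[OF n0])
      fix x
      show "of_bool (n dvd (fst l - fst l') * (x mod n) + (snd l - snd l')) =
        (of_bool (n dvd (fst l - fst l') * x + (snd l - snd l')) :: real)"
        unfolding dvd_eq_mod_eq_0 by (metis mod_add_left_eq mod_mult_right_eq)
    qed
    also have "\<dots> = real q * real (root_count n (fst l - fst l') (snd l - snd l'))" by (simp add: root_count_def Int_def sum.If_cases flip: of_bool_def)
    finally show ?thesis .
  qed
  have cross': "(\<Sum>x\<in>{0..<m}. \<Sum>y\<in>{0..<m}. hits n l (x, y) * hits m l' (x, y)) = real q * ?R"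
  proof -
    have "n dvd (fst l' - fst l) * x + (snd l' - snd l) \<longleftrightarrow> n dvd (fst l - fst l') * x + (snd l - snd l')" for x
      by (subst dvd_minus_iff[symmetric]) (simp add: algebra_simps)
    hence "root_count n (fst l' - fst l) (snd l' - snd l) = root_count n (fst l - fst l') (snd l - snd l')"
      by (simp add: root_count_def)
    thus ?thesis using cross[of l' l] by (simp add: mult.commute)
  qed
  have low: "(\<Sum>x\<in>{0..<m}. \<Sum>y\<in>{0..<m}. hits n l (x, y) * hits n l' (x, y)) = real q * (real q * ?R)"
  proof -
    have "(\<Sum>y\<in>{0..<m}. hits n l (x, y) * hits n l' (x, y)) = real q * (\<Sum>y\<in>{0..<n}. hits n l (x, y) * hits n l' (x, y))" for x
      unfolding mn by (rule sum_periodic[OF n0]) (simp add: hits_def on_line_mod_cong[of "(x, _ mod n)" n "(x, _)"])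
    hence "(\<Sum>x\<in>{0..<m}. \<Sum>y\<in>{0..<m}. hits n l (x, y) * hits n l' (x, y)) = real q * (\<Sum>x\<in>{0..<n * int q}. \<Sum>y\<in>{0..<n}. hits n l (x, y) * hits n l' (x, y))"
      by (simp add: sum_distrib_left mn)
    also have "(\<Sum>x\<in>{0..<n * int q}. \<Sum>y\<in>{0..<n}. hits n l (x, y) * hits n l' (x, y)) = real q * (\<Sum>x\<in>{0..<n}. \<Sum>y\<in>{0..<n}. hits n l (x, y) * hits n l' (x, y))"
      by (rule sum_periodic[OF n0]) (simp add: hits_def on_line_mod_cong[of "(_ mod n, _)" n "(_, _)"])
    finally show ?thesis by (simp add: hits_inner[OF n0])
  qed
  have "(\<Sum>x\<in>{0..<m}. \<Sum>y\<in>{0..<m}.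
       (hits m l (x, y) - hits n l (x, y) / real q) * (hits m l' (x, y) - hits n l' (x, y) / real q))
     = (\<Sum>x\<in>{0..<m}. \<Sum>y\<in>{0..<m}. hits m l (x, y) * hits m l' (x, y))
      - (\<Sum>x\<in>{0..<m}. \<Sum>y\<in>{0..<m}. hits m l (x, y) * hits n l' (x, y)) / real q
      - (\<Sum>x\<in>{0..<m}. \<Sum>y\<in>{0..<m}. hits n l (x, y) * hits m l' (x, y)) / real q
      + (\<Sum>x\<in>{0..<m}. \<Sum>y\<in>{0..<m}. hits n l (x, y) * hits n l' (x, y)) / (real q * real q)"
    unfolding sum_divide_distrib sum_subtractf[symmetric] sum.distrib[symmetric]
    by (intro sum.cong refl) (simp add: algebra_simps)
  thus ?thesis using q unfolding hits_inner[OF m0] cross cross' low by simp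
qed

definition pair_mod :: "int \<Rightarrow> int \<times> int \<Rightarrow> int \<times> int" where
  "pair_mod m z = (fst z mod m, snd z mod m)"

text \<open>
  The weights of the lines are compared across scales: \<open>S j\<close> below is the incidence count in which
  points and lines are thickened to classes modulo \<open>q\<^sup>j\<close>, normalised so that \<open>S\<close> would be constant if
  lines were uniformly distributed at finer scales. At \<open>j = 0\<close> everything is incident, which gives the
  first term of the bound; each increment is estimated by Cauchy-Schwarz. The hypotheses
  \<open>spread\<close> and \<open>frostman\<close> are the discrete forms of being at most \<open>\<sigma>\<close>-dimensional and at least
  \<open>t\<close>-dimensional.
\<close>

lemma incidence_bound:
  fixes q k :: nat and P F :: "(int \<times> int) set" and \<mu> :: "int \<times> int \<Rightarrow> real" and \<sigma> t N :: real
  assumes q: "prime q"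
    and P: "P \<subseteq> {0..<int q ^ k} \<times> {0..<int q ^ k}"
    and F: "finite F" and mu: "\<And>l. \<mu> l \<ge> 0"
    and spread: "\<And>j c. j \<le> k \<Longrightarrow>
       real (card {z \<in> P. pair_mod (int q ^ j) z = c}) \<le> real q powr ((real k - real j) * \<sigma>)"
    and frostman: "\<And>j c. j \<le> k \<Longrightarrow>
       (\<Sum>l | l \<in> F \<and> pair_mod (int q ^ j) l = c. \<mu> l) \<le> real q powr (- real j * t)"
    and rich: "\<And>l. l \<in> F \<Longrightarrow> N \<le> real (card {z \<in> P. on_line_mod (int q ^ k) l z})"
  shows "N * sum \<mu> F \<le> real q powr (real k * (\<sigma> - 1)) * sum \<mu> F +
     (\<Sum>j=1..k. real q powr (real k * (\<sigma> - 1) + real j * ((3 - \<sigma> - t) / 2)) * sqrt (sum \<mu> F))"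
proof -
  define M where "M = sum \<mu> F"
  \<comment> \<open>\<open>h j z\<close> is the weight of the lines that hit the class of \<open>z\<close> modulo \<open>q\<^sup>j\<close>.\<close>
  define h where "h j z = (\<Sum>l\<in>F. \<mu> l * hits (int q ^ j) l z)" for j z
  define D where "D j z = h (Suc j) z - h j z / real q" for j z
  define X where "X j = {0..<int q ^ j} \<times> {0..<int q ^ j}" for j
  have q0: "q > 0" using q prime_gt_0_nat by blast
  have finP: "finite P" using P by (rule finite_subset) auto
  have finX: "finite (X j)" for j by (simp add: X_def)
  have M0: "M \<ge> 0" unfolding M_def using mu by (intro sum_nonneg) auto
  have cardP: "real (card P) \<le> real q powr (real k * \<sigma>)"
    using spread[of 0 "(0, 0)"] by (simp add: pair_mod_def)
  have hits_cong: "hits (int q ^ i) l (pair_mod (int q ^ j) z) = hits (int q ^ i) l z" if "i \<le> j" for i j l z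
  proof -
    have "int q ^ i dvd int q ^ j" using that by (rule le_imp_power_dvd)
    thus ?thesis unfolding hits_def pair_mod_def
      by (subst on_line_mod_cong[of _ _ z]) (auto simp: mod_mod_cancel)
  qed
  have D_cong: "D j (pair_mod (int q ^ Suc j) z) = D j z" for j z
    unfolding D_def h_def by (simp add: hits_cong del: power_Suc)
  have energy: "(\<Sum>c\<in>X (Suc j). (D j c)\<^sup>2) \<le> real q powr (real (Suc j) * (1 - t)) * M" if j: "Suc j \<le> k" for j
  proof -
    let ?R = "\<lambda>i l l'. real (root_count (int q ^ i) (fst l - fst l') (snd l - snd l'))"
    let ?e = "\<lambda>l c. hits (int q ^ Suc j) l c - hits (int q ^ j) l c / real q"
    have "(\<Sum>c\<in>X (Suc j). (D j c)\<^sup>2) = (\<Sum>c\<in>X (Suc j). \<Sum>l\<in>F. \<Sum>l'\<in>F. \<mu> l * \<mu> l' * (?e l c * ?e l' c))"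
    proof (rule sum.cong[OF refl])
      fix c
      have "D j c = (\<Sum>l\<in>F. \<mu> l * ?e l c)"
        unfolding D_def h_def sum_divide_distrib sum_subtractf[symmetric] by (simp add: algebra_simps)
      thus "(D j c)\<^sup>2 = (\<Sum>l\<in>F. \<Sum>l'\<in>F. \<mu> l * \<mu> l' * (?e l c * ?e l' c))"
        unfolding power2_eq_square by (simp only: sum_product) (intro sum.cong refl, simp only: ac_simps)
    qed
    also have "\<dots> = (\<Sum>l\<in>F. \<Sum>l'\<in>F. \<Sum>c\<in>X (Suc j). \<mu> l * \<mu> l' * (?e l c * ?e l' c))"
      by (subst sum.swap, rule sum.cong[OF refl], rule sum.swap)
    also have "\<dots> = (\<Sum>l\<in>F. \<Sum>l'\<in>F. \<mu> l * \<mu> l' * (\<Sum>c\<in>X (Suc j). ?e l c * ?e l' c))"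
      by (simp add: sum_distrib_left)
    also have "\<dots> = (\<Sum>l\<in>F. \<Sum>l'\<in>F. \<mu> l * \<mu> l' * (?R (Suc j) l l' - ?R j l l'))"
      unfolding hits_inner_step[OF q0, of j, symmetric] X_def sum.cartesian_product
      by (simp only: case_prod_unfold prod.collapse)
    also have "\<dots> \<le> (\<Sum>l\<in>F. \<Sum>l'\<in>F. \<mu> l * \<mu> l' * (real q ^ Suc j * of_bool (pair_mod (int q ^ Suc j) l' = pair_mod (int q ^ Suc j) l)))"
    proof (intro sum_mono mult_left_mono)
      fix l l'
      have "?R (Suc j) l l' - ?R j l l' \<le> (if int q ^ Suc j dvd fst l - fst l' \<and> int q ^ Suc j dvd snd l - snd l' then real q ^ Suc j else 0)"
        by (rule root_count_step[OF q])
      thus "?R (Suc j) l l' - ?R j l l' \<le> real q ^ Suc j * of_bool (pair_mod (int q ^ Suc j) l' = pair_mod (int q ^ Suc j) l)"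
        unfolding mod_eq_dvd_iff[symmetric] pair_mod_def by (auto split: if_splits)
    qed (use mu in auto)
    also have "\<dots> = (\<Sum>l\<in>F. \<mu> l * real q ^ Suc j * (\<Sum>l' | l' \<in> F \<and> pair_mod (int q ^ Suc j) l' = pair_mod (int q ^ Suc j) l. \<mu> l'))"
    proof (rule sum.cong[OF refl])
      fix l
      have "(\<Sum>l'\<in>F. \<mu> l * \<mu> l' * (real q ^ Suc j * of_bool (pair_mod (int q ^ Suc j) l' = pair_mod (int q ^ Suc j) l))) =
        (\<Sum>l'\<in>F. \<mu> l * real q ^ Suc j * (if pair_mod (int q ^ Suc j) l' = pair_mod (int q ^ Suc j) l then \<mu> l' else 0))"
        by (intro sum.cong refl) auto
      thus "(\<Sum>l'\<in>F. \<mu> l * \<mu> l' * (real q ^ Suc j * of_bool (pair_mod (int q ^ Suc j) l' = pair_mod (int q ^ Suc j) l))) =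
        \<mu> l * real q ^ Suc j * (\<Sum>l' | l' \<in> F \<and> pair_mod (int q ^ Suc j) l' = pair_mod (int q ^ Suc j) l. \<mu> l')"
        unfolding sum_distrib_left[symmetric] sum.inter_filter[OF F] .
    qed
    also have "\<dots> \<le> (\<Sum>l\<in>F. \<mu> l * real q ^ Suc j * real q powr (- real (Suc j) * t))"
      by (intro sum_mono mult_left_mono frostman j) (use mu in auto)
    also have "\<dots> = real q powr (real (Suc j) * (1 - t)) * M"
    proof -
      have "real q ^ Suc j * real q powr (- real (Suc j) * t) = real q powr (real (Suc j) * (1 - t))"
        using q0 unfolding right_diff_distrib by (simp add: powr_diff powr_minus powr_realpow divide_inverse del: power_Suc of_nat_Suc)
      thus ?thesis unfolding M_def by (simp only: mult.assoc sum_distrib_right mult.commute)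
    qed
    finally show ?thesis .
  qed
  define S where "S j = real q ^ j * (\<Sum>z\<in>P. h j z)" for j
  have step: "S (Suc j) - S j \<le> real q powr (real k * \<sigma> + real (Suc j) * ((3 - \<sigma> - t) / 2)) * sqrt M" if j: "Suc j \<le> k" for j
  proof -
    have "(\<Sum>z\<in>P. (D j z)\<^sup>2) = (\<Sum>c\<in>X (Suc j). \<Sum>z | z \<in> P \<and> pair_mod (int q ^ Suc j) z = c. (D j z)\<^sup>2)"
      by (rule sum.group[symmetric]) (use finP finX q0 in \<open>auto simp: X_def pair_mod_def\<close>)
    also have "\<dots> = (\<Sum>c\<in>X (Suc j). real (card {z \<in> P. pair_mod (int q ^ Suc j) z = c}) * (D j c)\<^sup>2)"
    proof (rule sum.cong[OF refl])
      fix c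
      have "(\<Sum>z | z \<in> P \<and> pair_mod (int q ^ Suc j) z = c. (D j z)\<^sup>2) = (\<Sum>z | z \<in> P \<and> pair_mod (int q ^ Suc j) z = c. (D j c)\<^sup>2)"
        using D_cong by (intro sum.cong refl) (auto simp del: power_Suc)
      thus "(\<Sum>z | z \<in> P \<and> pair_mod (int q ^ Suc j) z = c. (D j z)\<^sup>2) = real (card {z \<in> P. pair_mod (int q ^ Suc j) z = c}) * (D j c)\<^sup>2"
        by simp
    qed
    also have "\<dots> \<le> (\<Sum>c\<in>X (Suc j). real q powr ((real k - real (Suc j)) * \<sigma>) * (D j c)\<^sup>2)"
      by (intro sum_mono mult_right_mono spread j) auto
    also have "\<dots> \<le> real q powr ((real k - real (Suc j)) * \<sigma>) * (real q powr (real (Suc j) * (1 - t)) * M)"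
      unfolding sum_distrib_left[symmetric] by (intro mult_left_mono energy j) auto
    finally have L2: "(\<Sum>z\<in>P. (D j z)\<^sup>2) \<le> real q powr ((real k - real (Suc j)) * \<sigma> + real (Suc j) * (1 - t)) * M"
      by (simp add: powr_add mult.assoc)
    have "(\<Sum>z\<in>P. D j z)\<^sup>2 \<le> real (card P) * (\<Sum>z\<in>P. (D j z)\<^sup>2)"
      using sum_squared_le_sum_of_squares[of "D j" P] by (simp add: mult.commute)
    also have "\<dots> \<le> real q powr (real k * \<sigma>) * (real q powr ((real k - real (Suc j)) * \<sigma> + real (Suc j) * (1 - t)) * M)"
      by (intro mult_mono cardP L2) (auto intro: sum_nonneg)
    finally have sq: "(\<Sum>z\<in>P. D j z)\<^sup>2 \<le> real q powr (real k * \<sigma> + (real k - real (Suc j)) * \<sigma> + real (Suc j) * (1 - t)) * M"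
      by (simp add: powr_add mult.assoc)
    have "(\<Sum>z\<in>P. D j z) \<le> sqrt ((\<Sum>z\<in>P. D j z)\<^sup>2)" by simp
    also have "\<dots> \<le> sqrt (real q powr (real k * \<sigma> + (real k - real (Suc j)) * \<sigma> + real (Suc j) * (1 - t)) * M)"
      using sq by (rule real_sqrt_le_mono)
    also have "\<dots> = real q powr ((real k * \<sigma> + (real k - real (Suc j)) * \<sigma> + real (Suc j) * (1 - t)) / 2) * sqrt M"
      by (simp add: real_sqrt_mult powr_half_sqrt_powr)
    finally have DB: "(\<Sum>z\<in>P. D j z) \<le> \<dots>" .
    have "S (Suc j) - S j = real q ^ Suc j * (\<Sum>z\<in>P. D j z)"
      using q0 unfolding S_def D_def sum_subtractf sum_divide_distrib[symmetric] by (simp add: field_simps)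
    also have "\<dots> \<le> real q ^ Suc j * (real q powr ((real k * \<sigma> + (real k - real (Suc j)) * \<sigma> + real (Suc j) * (1 - t)) / 2) * sqrt M)"
      by (intro mult_left_mono DB) auto
    also have "\<dots> = real q powr (real (Suc j) + (real k * \<sigma> + (real k - real (Suc j)) * \<sigma> + real (Suc j) * (1 - t)) / 2) * sqrt M"
      using q0 unfolding powr_add by (simp add: powr_realpow del: of_nat_Suc power_Suc)
    also have "real (Suc j) + (real k * \<sigma> + (real k - real (Suc j)) * \<sigma> + real (Suc j) * (1 - t)) / 2
       = real k * \<sigma> + real (Suc j) * ((3 - \<sigma> - t) / 2)"
      by (simp add: field_simps)
    finally show ?thesis .
  qed
  have tele: "S n \<le> S 0 + (\<Sum>j=1..n. real q powr (real k * \<sigma> + real j * ((3 - \<sigma> - t) / 2)) * sqrt M)" if "n \<le> k" for n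
    using that
  proof (induction n)
    case (Suc n)
    thus ?case using step[of n] by (simp del: of_nat_Suc)
  qed simp
  have S0: "S 0 \<le> real q powr (real k * \<sigma>) * M"
  proof -
    have "S 0 = real (card P) * M" by (simp add: S_def h_def hits_def on_line_mod_def M_def)
    thus ?thesis using cardP M0 by (simp add: mult_right_mono)
  qed
  have Sk: "real q ^ k * (N * M) \<le> S k"
  proof -
    have "N * M = (\<Sum>l\<in>F. \<mu> l * N)" unfolding M_def sum_distrib_right[symmetric] by (rule mult.commute)
    also have "\<dots> \<le> (\<Sum>l\<in>F. \<mu> l * (\<Sum>z\<in>P. hits (int q ^ k) l z))"
    proof (intro sum_mono mult_left_mono mu)
      fix l assume "l \<in> F"
      moreover have "(\<Sum>z\<in>P. hits (int q ^ k) l z) = real (card {z \<in> P. on_line_mod (int q ^ k) l z})"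
        using finP by (simp add: hits_def of_bool_def sum.inter_filter[symmetric])
      ultimately show "N \<le> (\<Sum>z\<in>P. hits (int q ^ k) l z)" using rich by simp
    qed
    also have "\<dots> = (\<Sum>z\<in>P. h k z)"
      unfolding h_def sum_distrib_left by (rule sum.swap)
    finally have "N * M \<le> (\<Sum>z\<in>P. h k z)" .
    thus ?thesis unfolding S_def by (intro mult_left_mono) auto
  qed
  have pk: "real q ^ k = real q powr real k" using q0 by (simp add: powr_realpow)
  have "real q powr (real k * \<sigma>) = real q ^ k * real q powr (real k * (\<sigma> - 1))"
    unfolding pk powr_add[symmetric] by (simp add: algebra_simps)
  moreover have "real q powr (real k * \<sigma> + real j * ((3 - \<sigma> - t) / 2)) =
     real q ^ k * real q powr (real k * (\<sigma> - 1) + real j * ((3 - \<sigma> - t) / 2))" for j :: nat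
    unfolding pk powr_add[symmetric] by (simp add: algebra_simps)
  ultimately have "real q ^ k * (N * M) \<le> real q ^ k * (real q powr (real k * (\<sigma> - 1)) * M +
     (\<Sum>j=1..k. real q powr (real k * (\<sigma> - 1) + real j * ((3 - \<sigma> - t) / 2)) * sqrt M))"
    using order.trans[OF Sk tele[OF order.refl]] S0
    by (simp add: distrib_left sum_distrib_left mult.assoc)
  thus ?thesis using q0 unfolding M_def[symmetric] by (simp only: mult_le_cancel_left_pos zero_less_power of_nat_0_less_iff)
qed

section \<open>Residues of p-adic integers\<close>

lemma padic_norm_nonneg [simp]: "padic_norm (x :: 'p::prime_card padic) \<ge> 0"
proof transfer
  fix X assume "padic_rel CARD('p) X X"
  hence "(\<lambda>n. rat_padic_abs CARD('p) (X n)) \<longlonglongrightarrow> lim (\<lambda>n. rat_padic_abs CARD('p) (X n))"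
    by (intro padic_cauchy_abs_convergent[OF prime_card]) (auto simp: padic_rel_def)
  thus "lim (\<lambda>n. rat_padic_abs CARD('p) (X n)) \<ge> 0"
    by (rule LIMSEQ_le_const) (auto simp: prime_card)
qed

lemma padic_norm_0 [simp]: "padic_norm (0 :: 'p::prime_card padic) = 0"
  by simp

lemma padic_norm_pos: "x \<noteq> 0 \<Longrightarrow> padic_norm (x :: 'p::prime_card padic) > 0"
  using padic_norm_nonneg[of x] by (simp add: less_le)

lemma padic_norm_1 [simp]: "padic_norm (1 :: 'p::prime_card padic) = 1"
  using padic_norm_mult[of "1 :: 'p padic" 1] padic_norm_eq_0[of "1 :: 'p padic"] by simp

lemma padic_norm_minus [simp]: "padic_norm (- x :: 'p::prime_card padic) = padic_norm x"
proof -
  have "padic_norm (- 1 :: 'p padic) ^ 2 = 1"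
    unfolding power2_eq_square padic_norm_mult[symmetric] by simp
  hence "padic_norm (- 1 :: 'p padic) = 1"
    using padic_norm_nonneg[of "- 1 :: 'p padic"] by (simp add: power2_eq_1_iff)
  thus ?thesis using padic_norm_mult[of "- 1" x] by simp
qed

lemma padic_norm_minus_commute: "padic_norm (x - y :: 'p::prime_card padic) = padic_norm (y - x)"
  using padic_norm_minus[of "x - y"] by simp

lemma padic_norm_add_le: "padic_norm x \<le> r \<Longrightarrow> padic_norm y \<le> r \<Longrightarrow> padic_norm (x + y :: 'p::prime_card padic) \<le> r"
  using padic_norm_ultra[of x y] by simp

lemma padic_norm_diff_le: "padic_norm x \<le> r \<Longrightarrow> padic_norm y \<le> r \<Longrightarrow> padic_norm (x - y :: 'p::prime_card padic) \<le> r"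
  using padic_norm_add_le[of x r "- y"] by simp

lemma padic_norm_trans: "padic_norm (x - y) \<le> r \<Longrightarrow> padic_norm (y - z) \<le> r \<Longrightarrow> padic_norm (x - z :: 'p::prime_card padic) \<le> r"
  using padic_norm_add_le[of "x - y" r "y - z"] by simp

lemma padic_norm_power: "padic_norm (x ^ n :: 'p::prime_card padic) = padic_norm x ^ n"
  by (induction n) (simp_all add: padic_norm_mult)

lemma padic_norm_inverse: "padic_norm (inverse x :: 'p::prime_card padic) = inverse (padic_norm x)"
proof (cases "x = 0")
  case False
  hence "padic_norm x * padic_norm (inverse x) = 1" by (simp flip: padic_norm_mult)
  thus ?thesis by (metis inverse_unique)
qed simp

lemma padic_norm_of_int_le_1: "padic_norm (of_int m :: 'p::prime_card padic) \<le> 1"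
proof -
  have nat: "padic_norm (of_nat n :: 'p padic) \<le> 1" for n
    by (induction n) (auto intro: padic_norm_add_le)
  show ?thesis by (cases m rule: int_cases2) (simp_all add: nat)
qed

lemma card_prime_gt_1: "real CARD('p::prime_card) > 1"
  using prime_gt_1_nat[OF prime_card[where 'a = 'p]] by simp

lemma padic_norm_of_int_prime_power: "padic_norm (of_int (int CARD('p) ^ n) :: 'p::prime_card padic) = 1 / real CARD('p) ^ n"
  using padic_norm_of_nat_prime[where 'p = 'p] by (simp add: padic_norm_power power_one_over)

text \<open>
  A Bezout relation \<open>a q + b m = 1\<close> forces \<open>m\<close> to have norm at least 1, since \<open>a q\<close> has norm less than 1.
\<close>

lemma padic_norm_of_int_unit:
  assumes "\<not> int CARD('p) dvd m"
  shows "padic_norm (of_int m :: 'p::prime_card padic) = 1"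
proof -
  have "prime (int CARD('p))" using prime_card[where 'a = 'p] by simp
  hence "coprime (int CARD('p)) m" using assms by (rule prime_imp_coprime)
  then obtain a b where ab: "a * int CARD('p) + b * m = 1"
    using bezout_int[of "int CARD('p)" m] by (auto simp: coprime_iff_gcd_eq_1)
  have "(1 :: 'p padic) = of_int (a * int CARD('p) + b * m)" unfolding ab by simp
  also have "\<dots> = of_int a * of_nat CARD('p) + of_int b * of_int m" by simp
  finally have "1 \<le> max (padic_norm (of_int a * of_nat CARD('p) :: 'p padic)) (padic_norm (of_int b * of_int m :: 'p padic))"
    using padic_norm_ultra[of "of_int a * of_nat CARD('p) :: 'p padic" "of_int b * of_int m"] by (metis padic_norm_1)
  moreover have "padic_norm (of_int a * of_nat CARD('p) :: 'p padic) < 1"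
  proof -
    have "padic_norm (of_int a * of_nat CARD('p) :: 'p padic) \<le> 1 * (1 / real CARD('p))"
      unfolding padic_norm_mult padic_norm_of_nat_prime by (intro mult_right_mono padic_norm_of_int_le_1) auto
    also have "\<dots> < 1" using card_prime_gt_1[where 'p = 'p] by simp
    finally show ?thesis .
  qed
  moreover have "padic_norm (of_int b * of_int m :: 'p padic) \<le> 1 * padic_norm (of_int m :: 'p padic)"
    unfolding padic_norm_mult by (intro mult_right_mono padic_norm_of_int_le_1) auto
  ultimately show ?thesis using padic_norm_of_int_le_1[of m, where 'p = 'p] by linarith
qed

lemma padic_norm_of_int_le_iff:
  "padic_norm (of_int m :: 'p::prime_card padic) \<le> 1 / real CARD('p) ^ n \<longleftrightarrow> int CARD('p) ^ n dvd m"
proof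
  assume "int CARD('p) ^ n dvd m"
  then obtain c where c: "m = int CARD('p) ^ n * c" by blast
  have "padic_norm (of_int m :: 'p padic) = 1 / real CARD('p) ^ n * padic_norm (of_int c :: 'p padic)"
    unfolding c by (simp only: of_int_mult padic_norm_mult padic_norm_of_int_prime_power)
  also have "\<dots> \<le> 1 / real CARD('p) ^ n * 1" by (intro mult_left_mono padic_norm_of_int_le_1) auto
  finally show "padic_norm (of_int m :: 'p padic) \<le> 1 / real CARD('p) ^ n" by simp
next
  assume le: "padic_norm (of_int m :: 'p padic) \<le> 1 / real CARD('p) ^ n"
  show "int CARD('p) ^ n dvd m"
  proof (rule ccontr)
    assume nd: "\<not> int CARD('p) ^ n dvd m"
    hence m: "m \<noteq> 0" by auto
    have nu: "\<not> is_unit (int CARD('p))" using prime_gt_1_nat[OF prime_card[where 'a = 'p]] by simp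
    obtain c where c: "m = int CARD('p) ^ multiplicity (int CARD('p)) m * c" "\<not> int CARD('p) dvd c"
      using multiplicity_decompose'[OF m nu] by blast
    let ?j = "multiplicity (int CARD('p)) m"
    have jn: "?j < n" using nd multiplicity_dvd'[of n "int CARD('p)" m] by (meson not_le_imp_less)
    have "padic_norm (of_int m :: 'p padic) = 1 / real CARD('p) ^ ?j"
      by (subst c(1)) (simp only: of_int_mult padic_norm_mult padic_norm_of_int_prime_power padic_norm_of_int_unit[OF c(2)] mult_1_right)
    moreover have "real CARD('p) ^ ?j < real CARD('p) ^ n"
      using jn card_prime_gt_1[where 'p = 'p] by (rule power_strict_increasing)
    moreover have "0 < real CARD('p) ^ multiplicity (int CARD('p)) m" using card_prime_gt_1[where 'p = 'p] by simp
    ultimately have "1 / real CARD('p) ^ n < padic_norm (of_int m :: 'p padic)" by (simp add: frac_less2)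
    thus False using le by simp
  qed
qed

lemma of_int_padic: "(of_int m :: 'p::prime_card padic) = Padic (\<lambda>n. of_int m)"
proof -
  have nat: "of_nat k = (Padic (\<lambda>n. of_nat k) :: 'p padic)" for k
    by (induction k) (simp_all add: zero_padic.abs_eq one_padic.abs_eq plus_padic.abs_eq padic_rel_def eq_onp_def)
  show ?thesis
    by (cases m rule: int_cases2) (simp_all add: nat uminus_padic.abs_eq padic_rel_def)
qed

lemma padic_norm_diff_Padic:
  assumes "padic_cauchy CARD('p) X" "padic_cauchy CARD('p) Y"
  shows "padic_norm (Padic X - Padic Y :: 'p::prime_card padic) = lim (\<lambda>n. rat_padic_abs CARD('p) (X n - Y n))"
    and "(\<lambda>n. rat_padic_abs CARD('p) (X n - Y n)) \<longlonglongrightarrow> padic_norm (Padic X - Padic Y :: 'p::prime_card padic)"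
proof -
  have rel: "padic_rel CARD('p) X X" "padic_rel CARD('p) Y Y" using assms by (auto simp: padic_rel_def)
  have mY: "padic_cauchy CARD('p) (\<lambda>n. - Y n)" by (rule padic_cauchy_minus[OF prime_card assms(2)])
  have XY: "padic_cauchy CARD('p) (\<lambda>n. X n + - Y n)" by (rule padic_cauchy_add[OF prime_card assms(1) mY])
  have eq: "(Padic X - Padic Y :: 'p padic) = Padic (\<lambda>n. X n + - Y n)"
    using rel mY by (simp add: minus_padic_def uminus_padic.abs_eq plus_padic.abs_eq padic_rel_def)
  show 1: "padic_norm (Padic X - Padic Y :: 'p padic) = lim (\<lambda>n. rat_padic_abs CARD('p) (X n - Y n))"
    unfolding eq using XY by (simp add: padic_norm.abs_eq padic_rel_def)
  show "(\<lambda>n. rat_padic_abs CARD('p) (X n - Y n)) \<longlonglongrightarrow> padic_norm (Padic X - Padic Y :: 'p::prime_card padic)"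
    unfolding 1 using padic_cauchy_abs_convergent[OF prime_card XY] by simp
qed

lemma padic_exhaust: obtains X where "padic_cauchy CARD('p) X" "(x :: 'p::prime_card padic) = Padic X"
  using Quotient_padic[where 'a = 'p] that unfolding Quotient_def padic_rel_def by (metis (no_types, lifting))

text \<open>
  The fraction is taken in the p-adic field itself, which avoids embedding the rationals.
\<close>

lemma rational_approx:
  fixes x :: "'p::prime_card padic"
  assumes "e > 0"
  obtains a b :: int where "coprime a b" "padic_norm (x - of_int a / of_int b) \<le> e" "(of_int b :: 'p padic) \<noteq> 0"
proof -
  obtain X where X: "padic_cauchy CARD('p) X" "x = Padic X" using padic_exhaust .
  obtain M where M: "\<And>m n. m \<ge> M \<Longrightarrow> n \<ge> M \<Longrightarrow> rat_padic_abs CARD('p) (X m - X n) < e"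
    using X(1) assms unfolding padic_cauchy_def by meson
  obtain a b where ab: "quotient_of (X M) = (a, b)" by force
  have b0: "b > 0" using quotient_of_denom_pos[OF ab] .
  have cop: "coprime a b" using quotient_of_coprime[OF ab] .
  have XM: "X M = of_int a / of_int b" using quotient_of_div[OF ab] .
  let ?y = "Padic (\<lambda>n. X M) :: 'p padic"
  have "(\<lambda>n. rat_padic_abs CARD('p) (X n - X M)) \<longlonglongrightarrow> padic_norm (x - ?y)"
    unfolding X(2) by (rule padic_norm_diff_Padic(2)[OF X(1)]) simp
  hence le: "padic_norm (x - ?y) \<le> e"
    by (rule LIMSEQ_le_const2) (use M in \<open>auto intro!: exI[of _ M] less_imp_le\<close>)
  have eq: "?y * of_int b = of_int a"
    using b0 unfolding of_int_padic XM by (simp add: times_padic.abs_eq padic_rel_def)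
  have nz: "(of_int b :: 'p padic) \<noteq> 0"
  proof
    assume z: "(of_int b :: 'p padic) = 0"
    hence "int CARD('p) ^ n dvd b" for n using padic_norm_of_int_le_iff[of b n, where 'p = 'p] by simp
    moreover have "\<not> is_unit (int CARD('p))" using prime_gt_1_nat[OF prime_card[where 'a = 'p]] by simp
    ultimately show False using b0 finite_divisor_powers[of b "int CARD('p)"] by (simp add: infinite_UNIV_nat)
  qed
  have "?y = of_int a / of_int b" using eq nz by (metis nonzero_mult_div_cancel_right)
  hence "padic_norm (x - of_int a / of_int b) \<le> e" using le by simp
  thus ?thesis using cop nz by (intro that)
qed

definition padic_ints :: "'p::prime_card padic set" where
  "padic_ints = {x. padic_norm x \<le> 1}"

lemma padic_ints_add: "x \<in> padic_ints \<Longrightarrow> y \<in> padic_ints \<Longrightarrow> x + y \<in> padic_ints"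
  by (simp add: padic_ints_def padic_norm_add_le)

lemma padic_ints_mult: "x \<in> padic_ints \<Longrightarrow> y \<in> padic_ints \<Longrightarrow> x * y \<in> padic_ints"
  by (simp add: padic_ints_def padic_norm_mult mult_le_one)

text \<open>
  In a reduced fraction of norm at most 1 the denominator is prime to \<open>q\<close>, hence invertible modulo
  \<open>q\<^sup>n\<close>; so the density of the rationals gives the density of the integers.
\<close>

lemma padic_ints_residue_exists:
  fixes x :: "'p::prime_card padic"
  assumes x: "x \<in> padic_ints"
  shows "\<exists>m::int. padic_norm (x - of_int m) \<le> 1 / real CARD('p) ^ n"
proof -
  let ?e = "1 / real CARD('p) ^ n"
  have q1: "real CARD('p) > 1" by (rule card_prime_gt_1)
  have e: "?e > 0" "?e \<le> 1" using q1 by auto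
  obtain a b where ab: "coprime a b" "padic_norm (x - of_int a / of_int b) \<le> ?e" "(of_int b :: 'p padic) \<noteq> 0"
    by (rule rational_approx[OF e(1)])
  have y1: "padic_norm (of_int a / of_int b :: 'p padic) \<le> 1"
    using padic_norm_diff_le[of x 1 "x - of_int a / of_int b"] x ab(2) e by (simp add: padic_ints_def)
  have prime: "prime (int CARD('p))" using prime_card[where 'a = 'p] by simp
  have b: "\<not> int CARD('p) dvd b"
  proof
    assume d: "int CARD('p) dvd b"
    have bn: "padic_norm (of_int b :: 'p padic) \<le> 1 / real CARD('p) ^ 1" using d by (subst padic_norm_of_int_le_iff) simp
    have "padic_norm (of_int a :: 'p padic) = padic_norm (of_int a / of_int b :: 'p padic) * padic_norm (of_int b :: 'p padic)"
      unfolding padic_norm_mult[symmetric] using ab(3) by simp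
    also have "\<dots> \<le> 1 * (1 / real CARD('p) ^ 1)" by (intro mult_mono y1 bn) auto
    finally have "int CARD('p) dvd a" using padic_norm_of_int_le_iff[of a 1, where 'p = 'p] by simp
    thus False using ab(1) d prime by (meson coprime_common_divisor not_prime_unit)
  qed
  hence "coprime (int CARD('p)) b" using prime by (intro prime_imp_coprime)
  hence "coprime b (int CARD('p) ^ n)" by (simp add: coprime_commute)
  then obtain c d where cd: "c * b + d * int CARD('p) ^ n = 1"
    using bezout_int[of b "int CARD('p) ^ n"] by (auto simp: coprime_iff_gcd_eq_1)
  have "(of_int a / of_int b - of_int (a * c)) * of_int b = (of_int (a * (1 - c * b)) :: 'p padic)"
    using ab(3) by (simp add: field_simps)
  hence "padic_norm (of_int a / of_int b - of_int (a * c) :: 'p padic) * padic_norm (of_int b :: 'p padic)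
      = padic_norm (of_int (a * (1 - c * b)) :: 'p padic)"
    by (metis padic_norm_mult)
  also have "\<dots> \<le> ?e"
  proof (subst padic_norm_of_int_le_iff)
    have "1 - c * b = d * int CARD('p) ^ n" using cd by simp
    thus "int CARD('p) ^ n dvd a * (1 - c * b)" by simp
  qed
  finally have "padic_norm (of_int a / of_int b - of_int (a * c) :: 'p padic) \<le> ?e"
    by (simp add: padic_norm_of_int_unit[OF b])
  thus ?thesis using padic_norm_trans[OF ab(2)] by blast
qed

definition residue :: "nat \<Rightarrow> 'p::prime_card padic \<Rightarrow> int" where
  "residue n x = (SOME m. 0 \<le> m \<and> m < int CARD('p) ^ n \<and> padic_norm (x - of_int m) \<le> 1 / real CARD('p) ^ n)"

lemma residue:
  fixes x :: "'p::prime_card padic"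
  assumes x: "x \<in> padic_ints"
  shows "0 \<le> residue n x" "residue n x < int CARD('p) ^ n"
    "padic_norm (x - of_int (residue n x)) \<le> 1 / real CARD('p) ^ n"
proof -
  obtain m where m: "padic_norm (x - of_int m) \<le> 1 / real CARD('p) ^ n"
    using padic_ints_residue_exists[OF x] by blast
  have q0: "int CARD('p) ^ n > 0" using card_prime_gt_1[where 'p = 'p] by simp
  let ?m = "m mod int CARD('p) ^ n"
  have "padic_norm (of_int m - of_int ?m :: 'p padic) \<le> 1 / real CARD('p) ^ n"
    unfolding of_int_diff[symmetric] by (subst padic_norm_of_int_le_iff) (simp add: mod_eq_dvd_iff[symmetric])
  with m have "padic_norm (x - of_int ?m) \<le> 1 / real CARD('p) ^ n" by (rule padic_norm_trans)
  hence "\<exists>m. 0 \<le> m \<and> m < int CARD('p) ^ n \<and> padic_norm (x - of_int m) \<le> 1 / real CARD('p) ^ n"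
    using q0 by (intro exI[of _ ?m]) auto
  from someI_ex[OF this] show "0 \<le> residue n x" "residue n x < int CARD('p) ^ n"
    "padic_norm (x - of_int (residue n x)) \<le> 1 / real CARD('p) ^ n"
    unfolding residue_def by auto
qed

lemma residue_eqI:
  fixes x :: "'p::prime_card padic"
  assumes x: "x \<in> padic_ints" and m: "padic_norm (x - of_int m) \<le> 1 / real CARD('p) ^ n"
  shows "residue n x = m mod int CARD('p) ^ n"
proof -
  have "padic_norm (of_int (residue n x) - of_int m :: 'p padic) \<le> 1 / real CARD('p) ^ n"
    using padic_norm_trans[OF _ m, of "of_int (residue n x)"] residue(3)[OF x, of n] padic_norm_minus_commute by metis
  hence "residue n x mod int CARD('p) ^ n = m mod int CARD('p) ^ n"
    unfolding of_int_diff[symmetric] by (subst (asm) padic_norm_of_int_le_iff) (simp add: mod_eq_dvd_iff)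
  thus ?thesis using residue(1,2)[OF x, of n] by simp
qed

lemma residue_eq_iff:
  fixes x y :: "'p::prime_card padic"
  assumes x: "x \<in> padic_ints" and y: "y \<in> padic_ints"
  shows "residue n x = residue n y \<longleftrightarrow> padic_norm (x - y) \<le> 1 / real CARD('p) ^ n"
proof
  assume "residue n x = residue n y"
  thus "padic_norm (x - y) \<le> 1 / real CARD('p) ^ n"
    using padic_norm_trans[OF residue(3)[OF x, of n], of y] residue(3)[OF y, of n] padic_norm_minus_commute by metis
next
  assume "padic_norm (x - y) \<le> 1 / real CARD('p) ^ n"
  hence "padic_norm (x - of_int (residue n y)) \<le> 1 / real CARD('p) ^ n"
    using residue(3)[OF y, of n] padic_norm_trans by blast
  hence "residue n x = residue n y mod int CARD('p) ^ n" by (rule residue_eqI[OF x])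
  thus "residue n x = residue n y" using residue(1,2)[OF y, of n] by simp
qed

lemma residue_mod:
  fixes x :: "'p::prime_card padic"
  assumes x: "x \<in> padic_ints" and jn: "j \<le> n"
  shows "residue n x mod int CARD('p) ^ j = residue j x"
proof -
  have "1 / real CARD('p) ^ n \<le> 1 / real CARD('p) ^ j"
    using card_prime_gt_1[where 'p = 'p] jn by (intro divide_left_mono power_increasing) auto
  hence "padic_norm (x - of_int (residue n x)) \<le> 1 / real CARD('p) ^ j"
    using residue(3)[OF x, of n] by linarith
  from residue_eqI[OF x this] show ?thesis by simp
qed

lemma residue_line:
  fixes a b x y :: "'p::prime_card padic"
  assumes "a \<in> padic_ints" "b \<in> padic_ints" "x \<in> padic_ints" "y \<in> padic_ints" "y = a * x + b"
  shows "int CARD('p) ^ n dvd residue n a * residue n x + residue n b - residue n y"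
proof -
  let ?e = "1 / real CARD('p) ^ n"
  let ?a = "of_int (residue n a) :: 'p padic" and ?b = "of_int (residue n b) :: 'p padic"
   and ?x = "of_int (residue n x) :: 'p padic"
  have "padic_norm ((a - ?a) * x) \<le> ?e"
    using mult_mono[OF residue(3)[OF assms(1), of n], of "padic_norm x" 1] assms(3) by (simp add: padic_norm_mult padic_ints_def)
  moreover have "padic_norm (?a * (x - ?x)) \<le> ?e"
    using mult_mono[OF padic_norm_of_int_le_1[of "residue n a", where 'p = 'p] residue(3)[OF assms(3), of n]] by (simp add: padic_norm_mult)
  ultimately have "padic_norm ((a - ?a) * x + ?a * (x - ?x) + (b - ?b)) \<le> ?e"
    using residue(3)[OF assms(2), of n] by (intro padic_norm_add_le)
  also have "(a - ?a) * x + ?a * (x - ?x) + (b - ?b) = y - of_int (residue n a * residue n x + residue n b)"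
    unfolding assms(5) by (simp add: algebra_simps)
  finally have "residue n y = (residue n a * residue n x + residue n b) mod int CARD('p) ^ n"
    by (rule residue_eqI[OF assms(4)])
  thus ?thesis by (metis dvd_minus_mod)
qed

text \<open>
  Completeness, in the form in which points are constructed later on: compatible residues define a
  p-adic integer.
\<close>

lemma coherent_residues:
  fixes c :: "nat \<Rightarrow> int"
  assumes c: "\<And>n. 0 \<le> c n" "\<And>n. c n < int CARD('p) ^ n" and coh: "\<And>n. c (Suc n) mod int CARD('p) ^ n = c n"
  shows "\<exists>x :: 'p::prime_card padic. x \<in> padic_ints \<and> (\<forall>n. residue n x = c n)"
proof -
  have cm: "c m mod int CARD('p) ^ n = c n" if "n \<le> m" for m n
    using that
  proof (induction rule: dec_induct)
    case base
    show ?case using c by simp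
  next
    case (step m)
    have "int CARD('p) ^ n dvd int CARD('p) ^ m" using step by (intro le_imp_power_dvd) auto
    thus ?case using step coh[of m] by (metis mod_mod_cancel)
  qed
  let ?X = "\<lambda>n. of_int (c n) :: rat"
  have abs: "rat_padic_abs CARD('p) (?X m - ?X n) \<le> 1 / real CARD('p) ^ M" if "m \<ge> M" "n \<ge> M" for m n M
  proof -
    have "rat_padic_abs CARD('p) (?X m - ?X n) = padic_norm (of_int (c m - c n) :: 'p padic)"
      unfolding of_int_padic by (simp add: padic_norm.abs_eq padic_rel_def)
    also have "\<dots> \<le> 1 / real CARD('p) ^ M"
      using cm[OF that(1)] cm[OF that(2)] by (subst padic_norm_of_int_le_iff) (simp add: mod_eq_dvd_iff[symmetric])
    finally show ?thesis .
  qed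
  have cau: "padic_cauchy CARD('p) ?X"
    unfolding padic_cauchy_def
  proof (intro allI impI)
    fix e :: real assume "e > 0"
    then obtain M where "1 / real CARD('p) ^ M < e"
      using real_arch_pow_inv[of e "1 / real CARD('p)"] card_prime_gt_1[where 'p = 'p] by (auto simp: power_one_over)
    thus "\<exists>M. \<forall>m\<ge>M. \<forall>n\<ge>M. rat_padic_abs CARD('p) (?X m - ?X n) < e"
      using abs by (meson order.strict_trans1)
  qed
  let ?x = "Padic ?X :: 'p padic"
  have near: "padic_norm (?x - of_int (c n)) \<le> 1 / real CARD('p) ^ n" for n
  proof -
    have "(\<lambda>m. rat_padic_abs CARD('p) (?X m - ?X n)) \<longlonglongrightarrow> padic_norm (?x - of_int (c n))"
      unfolding of_int_padic by (rule padic_norm_diff_Padic(2)[OF cau]) simp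
    thus ?thesis by (rule LIMSEQ_le_const2) (use abs in \<open>auto intro!: exI[of _ n]\<close>)
  qed
  have xi: "?x \<in> padic_ints"
    using padic_norm_add_le[of "?x - of_int (c 0)" 1 "of_int (c 0)"] near[of 0] by (simp add: padic_ints_def padic_norm_of_int_le_1)
  have "residue n ?x = c n" for n using residue_eqI[OF xi near[of n]] cm[of n n] by simp
  thus ?thesis using xi by blast
qed

section \<open>Null sets and Hausdorff dimension\<close>

lemma plane_dist_self [simp]: "plane_dist u (u :: 'p::prime_card padic_plane) = 0"
  by (simp add: plane_dist_def plane_norm_def)

lemma plane_dist_le_iff:
  "plane_dist u (v :: 'p::prime_card padic_plane) \<le> r \<longleftrightarrow> padic_norm (fst u - fst v) \<le> r \<and> padic_norm (snd u - snd v) \<le> r"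
  by (simp add: plane_dist_def plane_norm_def)

lemma plane_dist_nonneg [simp]: "plane_dist u (v :: 'p::prime_card padic_plane) \<ge> 0"
  by (simp add: plane_dist_def plane_norm_def le_max_iff_disj)

lemma plane_dist_commute: "plane_dist u (v :: 'p::prime_card padic_plane) = plane_dist v u"
  unfolding plane_dist_def plane_norm_def
  by (simp add: padic_norm_minus_commute[of "fst u"] padic_norm_minus_commute[of "snd u"])

lemma plane_dist_ultra:
  assumes "plane_dist u v \<le> r" "plane_dist v w \<le> r"
  shows "plane_dist u (w :: 'p::prime_card padic_plane) \<le> r"
  using assms unfolding plane_dist_le_iff by (auto intro: padic_norm_trans)

text \<open>
  For positive exponents these are the Hausdorff null sets, described with closed balls of free centres
  instead of arbitrary sets of small diameter. Radius 0 is admitted, so that finite covers and covering sets with one point need no padding.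
\<close>

definition ball_null :: "real \<Rightarrow> 'p::prime_card padic_plane set \<Rightarrow> bool" where
  "ball_null s S \<longleftrightarrow> (\<forall>e>0. \<exists>u r. (\<forall>i::nat. 0 \<le> r i) \<and> S \<subseteq> (\<Union>i. {v. plane_dist (u i) v \<le> r i}) \<and>
      (\<Sum>i. ennreal (r i powr s)) < ennreal e)"

lemma ball_nullE:
  assumes "ball_null s S" "e > 0"
  obtains r u where "\<forall>i::nat. 0 \<le> r i" "S \<subseteq> (\<Union>i. {v. plane_dist (u i) v \<le> r i})"
    "(\<Sum>i. ennreal (r i powr s)) < ennreal e"
  using assms unfolding ball_null_def by meson

lemma ball_null_mono: "ball_null s T \<Longrightarrow> S \<subseteq> T \<Longrightarrow> ball_null s S"
  unfolding ball_null_def by (meson order.trans)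

text \<open>
  The exponent may grow, which makes the statement meaningful for \<open>s0 = 0\<close>: there a single point has
  cost 1 for the measure, but a ball of radius 0 has cost \<open>0 powr 0 = 0\<close>.
\<close>

lemma hausdorff_measure_0_imp_ball_null:
  fixes S :: "'p::prime_card padic_plane set"
  assumes s: "0 \<le> s0" "s0 \<le> s" "0 < s" and H: "hausdorff_measure plane_dist s0 S = 0"
  shows "ball_null s S"
  unfolding ball_null_def
proof (intro allI impI)
  fix e :: real assume e: "e > 0"
  have "hausdorff_premeasure plane_dist s0 1 S \<le> hausdorff_measure plane_dist s0 S"
    unfolding hausdorff_measure_def by (intro SUP_upper) auto
  hence "hausdorff_premeasure plane_dist s0 1 S < ennreal e" using H e by simp
  then obtain U :: "nat \<Rightarrow> 'p padic_plane set" where U: "S \<subseteq> (\<Union>i. U i)" "\<And>i x y. x \<in> U i \<Longrightarrow> y \<in> U i \<Longrightarrow> plane_dist x y \<le> 1"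
    and sum: "(\<Sum>i. ennreal (diam_powr plane_dist s0 (U i))) < ennreal e"
    unfolding hausdorff_premeasure_def INF_less_iff by blast
  define D where "D i = (if U i = {} then 0 else (SUP (x, y)\<in>U i \<times> U i. plane_dist x y))" for i
  define u where "u i = (SOME x. x \<in> U i)" for i
  have up: "plane_dist x y \<le> D i" if "x \<in> U i" "y \<in> U i" for i x y
  proof -
    have "bdd_above ((\<lambda>(x, y). plane_dist x y) ` (U i \<times> U i))" using U(2) by (intro bdd_aboveI[of _ 1]) auto
    from cSUP_upper[OF _ this, of "(x, y)"] that show ?thesis by (auto simp: D_def)
  qed
  have uU: "u i \<in> U i" if "U i \<noteq> {}" for i using that unfolding u_def by (simp add: some_in_eq)
  have D0: "0 \<le> D i" for i
    using up[of "u i" i "u i"] uU[of i] by (cases "U i = {}") (simp_all add: D_def)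
  have D1: "D i \<le> 1" for i
    unfolding D_def using U(2) by (auto intro!: cSUP_least)
  have "D i powr s \<le> diam_powr plane_dist s0 (U i)" for i
  proof (cases "U i = {}")
    case False
    show ?thesis
    proof (cases "s0 = 0")
      case True
      thus ?thesis using D0 D1 s False by (simp add: diam_powr_def powr_le1)
    next
      case s0: False
      have "D i powr s \<le> D i powr s0" by (intro powr_mono' s D0 D1)
      thus ?thesis using s0 False by (simp add: diam_powr_def D_def)
    qed
  qed (simp add: D_def diam_powr_def)
  hence "(\<Sum>i. ennreal (D i powr s)) \<le> (\<Sum>i. ennreal (diam_powr plane_dist s0 (U i)))"
    by (intro suminf_le ennreal_leI) auto
  moreover have "S \<subseteq> (\<Union>i. {v. plane_dist (u i) v \<le> D i})" using U(1) up uU by blast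
  ultimately show "\<exists>u r. (\<forall>i::nat. 0 \<le> r i) \<and> S \<subseteq> (\<Union>i. {v. plane_dist (u i) v \<le> r i}) \<and> (\<Sum>i. ennreal (r i powr s)) < ennreal e"
    using sum D0 by (intro exI[of _ u] exI[of _ D]) auto
qed

text \<open>
  A cheap cover automatically consists of small balls: a single term of the sum bounds its radius.
  By the ultrametric inequality a ball has diameter at most its radius, so no constant is lost.
\<close>

lemma ball_null_imp_hausdorff_measure_0:
  fixes S :: "'p::prime_card padic_plane set"
  assumes s: "0 < s" and S: "ball_null s S"
  shows "hausdorff_measure plane_dist s S = 0"
proof -
  have "hausdorff_premeasure plane_dist s \<delta> S \<le> 0 + ennreal e" if d: "\<delta> > 0" and e: "e > 0" for \<delta> e
  proof -
    have pos: "min e (\<delta> powr s) > 0" using d e by simp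
    obtain r u where r: "\<forall>i::nat. 0 \<le> r i" and cov: "S \<subseteq> (\<Union>i. {v. plane_dist (u i) v \<le> r i})"
      and sum: "(\<Sum>i. ennreal (r i powr s)) < ennreal (min e (\<delta> powr s))"
      by (rule ball_nullE[OF S pos])
    let ?U = "\<lambda>i. {v. plane_dist (u i) v \<le> r i}"
    have rd: "r i \<le> \<delta>" for i
    proof (rule ccontr)
      assume "\<not> r i \<le> \<delta>"
      hence ge: "\<delta> powr s \<le> r i powr s" using d s by (intro powr_mono2) auto
      have "sum (\<lambda>i. ennreal (r i powr s)) {i} \<le> (\<Sum>i. ennreal (r i powr s))"
        by (rule sum_le_suminf[OF summableI]) auto
      hence "ennreal (r i powr s) \<le> (\<Sum>i. ennreal (r i powr s))" by simp
      also note sum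
      also have "ennreal (min e (\<delta> powr s)) \<le> ennreal (\<delta> powr s)" by (intro ennreal_leI) simp
      finally have "ennreal (r i powr s) < ennreal (\<delta> powr s)" .
      thus False using ge by (simp add: ennreal_less_iff)
    qed
    have diam: "plane_dist x y \<le> r i" if "x \<in> ?U i" "y \<in> ?U i" for i x y
      using that plane_dist_ultra[of x "u i" "r i" y] by (simp add: plane_dist_commute)
    have "diam_powr plane_dist s (?U i) \<le> r i powr s" for i
    proof -
      have "(SUP (x, y)\<in>?U i \<times> ?U i. plane_dist x y) \<le> r i"
      proof (rule cSUP_least)
        have "(u i, u i) \<in> ?U i \<times> ?U i" using r by simp
        thus "?U i \<times> ?U i \<noteq> {}" by blast
      qed (use diam in auto)
      moreover have "0 \<le> (SUP (x, y)\<in>?U i \<times> ?U i. plane_dist x y)"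
      proof -
        have "bdd_above ((\<lambda>(x, y). plane_dist x y) ` (?U i \<times> ?U i))"
          using diam by (intro bdd_aboveI[of _ "r i"]) auto
        from cSUP_upper[OF _ this, of "(u i, u i)"] r[rule_format, of i] show ?thesis by simp
      qed
      ultimately show ?thesis using s by (simp add: diam_powr_def powr_mono2)
    qed
    hence "(\<Sum>i. ennreal (diam_powr plane_dist s (?U i))) \<le> (\<Sum>i. ennreal (r i powr s))"
      by (intro suminf_le ennreal_leI) auto
    also have "\<dots> \<le> ennreal e"
      using less_imp_le[OF sum] by (rule order.trans) (intro ennreal_leI, simp)
    finally have le: "(\<Sum>i. ennreal (diam_powr plane_dist s (?U i))) \<le> ennreal e" .
    have "\<forall>i. \<forall>x\<in>?U i. \<forall>y\<in>?U i. plane_dist x y \<le> \<delta>" using diam rd order.trans by blast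
    hence "hausdorff_premeasure plane_dist s \<delta> S \<le> (\<Sum>i. ennreal (diam_powr plane_dist s (?U i)))"
      unfolding hausdorff_premeasure_def using cov by (intro INF_lower) auto
    thus ?thesis using le by simp
  qed
  hence "hausdorff_premeasure plane_dist s \<delta> S \<le> 0" if "\<delta> > 0" for \<delta>
    by (rule ennreal_le_epsilon) (use that in simp)
  thus ?thesis unfolding hausdorff_measure_def by (auto intro!: antisym SUP_least)
qed

lemma hausdorff_dim_ge_iff:
  fixes S :: "'p::prime_card padic_plane set"
  assumes t: "0 < t"
  shows "hausdorff_dim plane_dist S \<ge> ereal t \<longleftrightarrow> (\<forall>s. 0 < s \<longrightarrow> s < t \<longrightarrow> \<not> ball_null s S)"
proof
  assume ge: "hausdorff_dim plane_dist S \<ge> ereal t"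
  show "\<forall>s. 0 < s \<longrightarrow> s < t \<longrightarrow> \<not> ball_null s S"
  proof (intro allI impI notI)
    fix s assume s: "0 < s" "s < t" "ball_null s S"
    hence "hausdorff_dim plane_dist S \<le> ereal s"
      unfolding hausdorff_dim_def using ball_null_imp_hausdorff_measure_0 by (intro Inf_lower) fastforce
    thus False using ge s by (metis ereal_less_eq(3) linorder_not_less order.trans)
  qed
next
  assume nn: "\<forall>s. 0 < s \<longrightarrow> s < t \<longrightarrow> \<not> ball_null s S"
  show "hausdorff_dim plane_dist S \<ge> ereal t"
    unfolding hausdorff_dim_def
  proof (rule Inf_greatest, safe)
    fix s assume s: "0 \<le> s" "hausdorff_measure plane_dist s S = 0"
    show "ereal t \<le> ereal s"
    proof (rule ccontr)
      assume "\<not> ereal t \<le> ereal s"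
      hence st: "s < t" by simp
      have "ball_null (max s (t / 2)) S"
        by (rule hausdorff_measure_0_imp_ball_null[OF s(1) _ _ s(2)]) (use t in auto)
      moreover have "0 < max s (t / 2)" "max s (t / 2) < t" using t st by auto
      ultimately show False using nn by blast
    qed
  qed
qed

lemma hausdorff_dim_le:
  fixes S :: "'p::prime_card padic_plane set"
  assumes "0 \<le> t" and null: "\<And>s. t < s \<Longrightarrow> ball_null s S"
  shows "hausdorff_dim plane_dist S \<le> ereal t"
proof (rule ereal_le_epsilon2)
  fix e :: real assume e: "e > 0"
  have "hausdorff_measure plane_dist (t + e) S = 0"
    using assms e by (intro ball_null_imp_hausdorff_measure_0) auto
  thus "hausdorff_dim plane_dist S \<le> ereal t + ereal e"
    unfolding hausdorff_dim_def using assms(1) e by (intro Inf_lower) (auto intro!: exI[of _ "t + e"])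
qed

lemma suminf_half_powers: "e \<ge> 0 \<Longrightarrow> (\<Sum>n. ennreal (e * (1 / 2) ^ Suc n)) = ennreal e"
  using sums_mult[OF power_half_series, of e] by (intro suminf_ennreal_eq) auto

lemma ball_null_UN:
  fixes S :: "nat \<Rightarrow> 'p::prime_card padic_plane set"
  assumes null: "\<And>m. ball_null s (S m)"
  shows "ball_null s (\<Union>m. S m)"
  unfolding ball_null_def
proof (intro allI impI)
  fix e :: real assume e: "e > 0"
  define Q where "Q m p \<longleftrightarrow> (\<forall>i. 0 \<le> snd p i) \<and> S m \<subseteq> (\<Union>i. {v. plane_dist (fst p i) v \<le> snd p i}) \<and>
      (\<Sum>i. ennreal (snd p i powr s)) < ennreal (e / 2 * (1 / 2) ^ Suc m)"
    for m and p :: "(nat \<Rightarrow> 'p padic_plane) \<times> (nat \<Rightarrow> real)"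
  have "\<exists>p. Q m p" for m
  proof -
    have pos: "e / 2 * (1 / 2) ^ Suc m > 0" using e by simp
    obtain r u where "\<forall>i::nat. 0 \<le> r i" "S m \<subseteq> (\<Union>i. {v. plane_dist (u i) v \<le> r i})"
      "(\<Sum>i. ennreal (r i powr s)) < ennreal (e / 2 * (1 / 2) ^ Suc m)"
      by (rule ball_nullE[OF null[of m] pos])
    thus ?thesis unfolding Q_def by (intro exI[of _ "(u, r)"]) simp
  qed
  then obtain f where f: "\<And>m. Q m (f m)" by metis
  define u where "u m = fst (f m)" for m
  define r where "r m = snd (f m)" for m
  have r: "\<And>m i. 0 \<le> r m i" and cov: "\<And>m. S m \<subseteq> (\<Union>i. {v. plane_dist (u m i) v \<le> r m i})"
    and sum: "\<And>m. (\<Sum>i. ennreal (r m i powr s)) < ennreal (e / 2 * (1 / 2) ^ Suc m)"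
    using f unfolding Q_def u_def r_def by auto
  have "(\<Sum>i. ennreal ((\<lambda>(m, i). r m i) (prod_decode i) powr s)) = (\<Sum>m. \<Sum>i. ennreal (r m i powr s))"
    by (rule suminf_ennreal_2dimen[where f = "\<lambda>x. ennreal ((\<lambda>(m, i). r m i) x powr s)"]) simp
  also have "\<dots> \<le> (\<Sum>m. ennreal (e / 2 * (1 / 2) ^ Suc m))" by (intro suminf_le less_imp_le sum) auto
  also have "\<dots> = ennreal (e / 2)" using e by (intro suminf_half_powers) auto
  also have "\<dots> < ennreal e" using e by (simp add: ennreal_less_iff)
  finally have "(\<Sum>i. ennreal ((\<lambda>(m, i). r m i) (prod_decode i) powr s)) < ennreal e" .
  moreover have "(\<Union>m. S m) \<subseteq> (\<Union>i. {v. plane_dist ((\<lambda>(m, i). u m i) (prod_decode i)) v \<le> (\<lambda>(m, i). r m i) (prod_decode i)})"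
  proof
    fix z assume "z \<in> (\<Union>m. S m)"
    then obtain m i where "plane_dist (u m i) z \<le> r m i" using cov by blast
    thus "z \<in> (\<Union>i. {v. plane_dist ((\<lambda>(m, i). u m i) (prod_decode i)) v \<le> (\<lambda>(m, i). r m i) (prod_decode i)})"
      by (intro UN_I[of "prod_encode (m, i)"]) auto
  qed
  ultimately show "\<exists>u r. (\<forall>i::nat. 0 \<le> r i) \<and> (\<Union>m. S m) \<subseteq> (\<Union>i. {v. plane_dist (u i) v \<le> r i}) \<and> (\<Sum>i. ennreal (r i powr s)) < ennreal e"
    using r by (intro exI[of _ "\<lambda>i. (\<lambda>(m, i). u m i) (prod_decode i)"] exI[of _ "\<lambda>i. (\<lambda>(m, i). r m i) (prod_decode i)"])
      (auto split: prod.splits)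
qed

lemma ball_null_lipschitz:
  fixes S :: "'p::prime_card padic_plane set"
  assumes null: "ball_null s S" and C: "C > 0" and f: "\<And>x y. plane_dist (f x) (f y) \<le> C * plane_dist x y"
  shows "ball_null s (f ` S)"
  unfolding ball_null_def
proof (intro allI impI)
  fix e :: real assume e: "e > 0"
  have pos: "e / C powr s > 0" using e C by simp
  obtain r u where r: "\<forall>i::nat. 0 \<le> r i" and cov: "S \<subseteq> (\<Union>i. {v. plane_dist (u i) v \<le> r i})"
    and sum: "(\<Sum>i. ennreal (r i powr s)) < ennreal (e / C powr s)"
    by (rule ball_nullE[OF null pos])
  have "(\<Sum>i. ennreal ((C * r i) powr s)) = ennreal (C powr s) * (\<Sum>i. ennreal (r i powr s))"
    using r C by (simp add: powr_mult ennreal_mult)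
  also have "\<dots> < ennreal (C powr s) * ennreal (e / C powr s)"
    using sum C by (intro ennreal_mult_strict_left_mono) auto
  also have "\<dots> = ennreal e" using C e by (subst ennreal_mult[symmetric]) auto
  finally have "(\<Sum>i. ennreal ((C * r i) powr s)) < ennreal e" .
  moreover have "f ` S \<subseteq> (\<Union>i. {v. plane_dist (f (u i)) v \<le> C * r i})"
  proof (rule image_subsetI)
    fix x assume "x \<in> S"
    with cov have "x \<in> (\<Union>i. {v. plane_dist (u i) v \<le> r i})" by (rule subsetD)
    then obtain i where "plane_dist (u i) x \<le> r i" by auto
    hence "plane_dist (f (u i)) (f x) \<le> C * r i"
      using f[of "u i" x] C by (meson mult_left_mono less_imp_le order.trans)
    thus "f x \<in> (\<Union>i. {v. plane_dist (f (u i)) v \<le> C * r i})" by blast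
  qed
  ultimately show "\<exists>u r. (\<forall>i::nat. 0 \<le> r i) \<and> f ` S \<subseteq> (\<Union>i. {v. plane_dist (u i) v \<le> r i}) \<and> (\<Sum>i. ennreal (r i powr s)) < ennreal e"
    using r C by (intro exI[of _ "\<lambda>i. f (u i)"] exI[of _ "\<lambda>i. C * r i"]) auto
qed

section \<open>Cylinders and content in the unit square\<close>

definition residue_pair :: "nat \<Rightarrow> 'p::prime_card padic_plane \<Rightarrow> int \<times> int" where
  "residue_pair n z = (residue n (fst z), residue n (snd z))"

definition unit_square :: "'p::prime_card padic_plane set" where
  "unit_square = padic_ints \<times> padic_ints"

text \<open>
  A cylinder of level \<open>n\<close> is the trace on the unit square of a ball of radius \<open>q\<^sup>-\<^sup>n\<close>.
\<close>

definition cylinder :: "nat \<times> int \<times> int \<Rightarrow> 'p::prime_card padic_plane set" where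
  "cylinder x = {z \<in> unit_square. residue_pair (fst x) z = snd x}"

lemma residue_pair_eq_iff:
  assumes "z \<in> unit_square" "w \<in> unit_square"
  shows "residue_pair n z = residue_pair n (w :: 'p::prime_card padic_plane) \<longleftrightarrow> plane_dist z w \<le> 1 / real CARD('p) ^ n"
  using assms unfolding residue_pair_def unit_square_def plane_dist_le_iff by (auto simp: residue_eq_iff)

lemma residue_pair_mod:
  assumes "z \<in> unit_square" "j \<le> n"
  shows "pair_mod (int CARD('p) ^ j) (residue_pair n (z :: 'p::prime_card padic_plane)) = residue_pair j z"
  using assms unfolding residue_pair_def unit_square_def pair_mod_def by (auto simp: residue_mod)

lemma residue_pair_range:
  assumes "z \<in> unit_square"
  shows "residue_pair n (z :: 'p::prime_card padic_plane) \<in> {0..<int CARD('p) ^ n} \<times> {0..<int CARD('p) ^ n}"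
  using assms unfolding residue_pair_def unit_square_def by (auto simp: residue)

definition cost :: "nat \<Rightarrow> real \<Rightarrow> nat \<times> int \<times> int \<Rightarrow> real" where
  "cost q s x = real q powr (- s * real (fst x))"

text \<open>
  A cover by cylinders is a set of indices, and its cost is the value of this measure. Countable
  subadditivity and disjoint additivity of costs are then facts of measure theory.
\<close>

definition cost_measure :: "nat \<Rightarrow> real \<Rightarrow> (nat \<times> int \<times> int) measure" where
  "cost_measure q s = point_measure UNIV (\<lambda>x. ennreal (cost q s x))"

lemma sets_cost_measure [simp]: "sets (cost_measure q s) = UNIV"
  by (simp add: cost_measure_def sets_point_measure)

lemma cost_nonneg [simp]: "cost q s x \<ge> 0"
  by (simp add: cost_def)

lemma emeasure_cost_measure_finite:
  "finite K \<Longrightarrow> emeasure (cost_measure q s) K = ennreal (\<Sum>x\<in>K. cost q s x)"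
  unfolding cost_measure_def by (subst emeasure_point_measure_finite2) auto

lemma emeasure_cost_measure_singleton: "emeasure (cost_measure q s) {x} = ennreal (cost q s x)"
  by (simp add: emeasure_cost_measure_finite)

definition cyl_content :: "real \<Rightarrow> 'p::prime_card padic_plane set \<Rightarrow> ennreal" where
  "cyl_content s S = (INF K \<in> {K. S \<subseteq> (\<Union>x\<in>K. cylinder x)}. emeasure (cost_measure CARD('p) s) K)"

lemma cyl_content_le: "S \<subseteq> (\<Union>x\<in>K. cylinder x) \<Longrightarrow> cyl_content s (S :: 'p::prime_card padic_plane set) \<le> emeasure (cost_measure CARD('p) s) K"
  unfolding cyl_content_def by (intro INF_lower) auto

lemma cyl_content_lessE:
  assumes "cyl_content s (S :: 'p::prime_card padic_plane set) < e"
  obtains K where "S \<subseteq> (\<Union>x\<in>K. cylinder x)" "emeasure (cost_measure CARD('p) s) K < e"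
proof -
  have "\<exists>K. S \<subseteq> (\<Union>x\<in>K. cylinder x) \<and> emeasure (cost_measure CARD('p) s) K < e"
    using assms unfolding cyl_content_def INF_less_iff by simp
  thus thesis using that by (elim exE conjE)
qed

lemma cyl_content_le_finite:
  assumes "finite K" "S \<subseteq> (\<Union>x\<in>K. cylinder x)"
  shows "cyl_content s (S :: 'p::prime_card padic_plane set) \<le> ennreal (\<Sum>x\<in>K. cost CARD('p) s x)"
  using cyl_content_le[OF assms(2), of s] by (simp add: emeasure_cost_measure_finite assms(1))

lemma cyl_content_UN:
  fixes S :: "nat \<Rightarrow> 'p::prime_card padic_plane set"
  shows "cyl_content s (\<Union>m. S m) \<le> (\<Sum>m. cyl_content s (S m))"
proof (cases "(\<Sum>m. cyl_content s (S m)) = \<infinity>")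
  case False
  let ?M = "cost_measure CARD('p) s"
  have fin: "cyl_content s (S m) < \<infinity>" for m
  proof -
    have "sum (\<lambda>m. cyl_content s (S m)) {m} \<le> (\<Sum>m. cyl_content s (S m))"
      by (rule sum_le_suminf[OF summableI]) auto
    hence "cyl_content s (S m) \<le> (\<Sum>m. cyl_content s (S m))" by simp
    thus ?thesis using False by (metis infinity_ennreal_def less_top order.strict_trans1)
  qed
  show ?thesis
  proof (rule ennreal_le_epsilon)
    fix e :: real assume e: "e > 0"
    have "\<exists>K. S m \<subseteq> (\<Union>x\<in>K. cylinder x) \<and> emeasure ?M K \<le> cyl_content s (S m) + ennreal (e * (1 / 2) ^ Suc m)" for m
    proof -
      have "ennreal (e * (1 / 2) ^ Suc m) > 0" using e by simp
      hence "cyl_content s (S m) < cyl_content s (S m) + ennreal (e * (1 / 2) ^ Suc m)"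
        using fin[of m] ennreal_add_left_cancel_less[of "cyl_content s (S m)" 0] by (simp del: power_Suc)
      then obtain K where "S m \<subseteq> (\<Union>x\<in>K. cylinder x)" "emeasure ?M K < cyl_content s (S m) + ennreal (e * (1 / 2) ^ Suc m)"
        by (rule cyl_content_lessE)
      thus ?thesis using less_imp_le by blast
    qed
    then obtain K where K: "\<And>m. S m \<subseteq> (\<Union>x\<in>K m. cylinder x)"
       "\<And>m. emeasure ?M (K m) \<le> cyl_content s (S m) + ennreal (e * (1 / 2) ^ Suc m)" by metis
    have "cyl_content s (\<Union>m. S m) \<le> emeasure ?M (\<Union>m. K m)"
      using K(1) by (intro cyl_content_le) fastforce
    also have "\<dots> \<le> (\<Sum>m. emeasure ?M (K m))" by (intro emeasure_subadditive_countably) simp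
    also have "\<dots> \<le> (\<Sum>m. cyl_content s (S m) + ennreal (e * (1 / 2) ^ Suc m))" by (intro suminf_le K(2)) auto
    also have "\<dots> = (\<Sum>m. cyl_content s (S m)) + (\<Sum>m. ennreal (e * (1 / 2) ^ Suc m))"
      by (intro suminf_add[symmetric]) auto
    also have "(\<Sum>m. ennreal (e * (1 / 2) ^ Suc m)) = ennreal e" using e by (intro suminf_half_powers) auto
    finally show "cyl_content s (\<Union>m. S m) \<le> (\<Sum>m. cyl_content s (S m)) + ennreal e" .
  qed
qed simp

lemma cyl_content_0_imp_ball_null:
  fixes S :: "'p::prime_card padic_plane set"
  assumes null: "cyl_content s S = 0"
  shows "ball_null s S"
  unfolding ball_null_def
proof (intro allI impI)
  fix e :: real assume e: "e > 0"
  let ?M = "cost_measure CARD('p) s"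
  have "cyl_content s S < ennreal e" using null e by simp
  then obtain K where K: "S \<subseteq> (\<Union>x\<in>K. cylinder x)" "emeasure ?M K < ennreal e" by (rule cyl_content_lessE)
  define r where "r i = (if i \<in> to_nat ` K then 1 / real CARD('p) ^ fst (from_nat i :: nat \<times> int \<times> int) else 0)" for i
  define u :: "nat \<Rightarrow> 'p padic_plane" where "u i = (SOME z. z \<in> cylinder (from_nat i))" for i
  have r0: "r i \<ge> 0" for i by (simp add: r_def)
  have "ennreal (r i powr s) = emeasure ?M {x \<in> K. to_nat x = i}" for i
  proof (cases "i \<in> to_nat ` K")
    case True
    then obtain x where x: "x \<in> K" "i = to_nat x" by blast
    hence eq: "{x \<in> K. to_nat x = i} = {x}" by auto
    have "r i powr s = cost CARD('p) s x"
      using x unfolding r_def cost_def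
      using card_prime_gt_1[where 'p = 'p]
      by (simp add: powr_divide powr_minus_divide powr_powr powr_realpow[symmetric] mult.commute)
    thus ?thesis unfolding eq emeasure_cost_measure_singleton by simp
  next
    case False
    hence eq: "{x \<in> K. to_nat x = i} = {}" by auto
    show ?thesis unfolding eq using False by (simp add: r_def)
  qed
  hence "(\<Sum>i. ennreal (r i powr s)) = (\<Sum>i. emeasure ?M {x \<in> K. to_nat x = i})" by simp
  also have "\<dots> = emeasure ?M (\<Union>i. {x \<in> K. to_nat x = i})"
    by (rule suminf_emeasure) (auto simp: disjoint_family_on_def)
  also have "(\<Union>i. {x \<in> K. to_nat x = i}) = K" by auto
  finally have "(\<Sum>i. ennreal (r i powr s)) < ennreal e" using K(2) by simp
  moreover have "S \<subseteq> (\<Union>i. {v. plane_dist (u i) v \<le> r i})"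
  proof
    fix z assume "z \<in> S"
    then obtain x where x: "x \<in> K" "z \<in> cylinder x" using K(1) by auto
    have "u (to_nat x) \<in> cylinder x"
      unfolding u_def from_nat_to_nat using x(2) by (rule someI)
    hence "residue_pair (fst x) (u (to_nat x)) = residue_pair (fst x) z" "u (to_nat x) \<in> unit_square" "z \<in> unit_square"
      using x by (auto simp: cylinder_def)
    hence "plane_dist (u (to_nat x)) z \<le> r (to_nat x)"
      using residue_pair_eq_iff[of "u (to_nat x)" z "fst x"] x by (simp add: r_def)
    thus "z \<in> (\<Union>i. {v. plane_dist (u i) v \<le> r i})" by blast
  qed
  ultimately show "\<exists>u r. (\<forall>i::nat. 0 \<le> r i) \<and> S \<subseteq> (\<Union>i. {v. plane_dist (u i) v \<le> r i}) \<and> (\<Sum>i. ennreal (r i powr s)) < ennreal e"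
    using r0 by (intro exI[of _ u] exI[of _ r] conjI allI)
qed

text \<open>
  Radii are rounded up to powers of \<open>1 / q\<close> at the expense of the factor \<open>q\<^sup>s\<close>.
\<close>

lemma level_of_radius:
  assumes q: "1 < (q::real)" and r: "0 < r" "r \<le> 1" and s: "s > 0"
  shows "\<exists>n::nat. r \<le> 1 / q ^ n \<and> q powr (- s * real n) \<le> q powr s * r powr s"
proof -
  have "\<exists>n. (1 / q) ^ n < r" using real_arch_pow_inv[of r "1 / q"] r q by simp
  hence ex: "\<exists>n. 1 / q ^ n < r" by (simp add: power_one_over)
  define m where "m = (LEAST n. 1 / q ^ n < r)"
  have m: "1 / q ^ m < r" unfolding m_def using ex by (rule LeastI_ex)
  have "m \<noteq> 0" using m r by (intro notI) simp
  then obtain n where n: "m = Suc n" using not0_implies_Suc by blast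
  have "\<not> 1 / q ^ n < r" using not_less_Least[of n "\<lambda>n. 1 / q ^ n < r"] n m_def by simp
  moreover have "q powr (- s * real n) \<le> q powr s * r powr s"
  proof -
    have "1 / q ^ n \<le> q * r" using m q unfolding n by (simp add: field_simps)
    hence "(1 / q ^ n) powr s \<le> (q * r) powr s" using s q by (intro powr_mono2) auto
    moreover have "(1 / q ^ n) powr s = q powr (- s * real n)"
      using q by (simp add: powr_divide powr_minus_divide powr_powr powr_realpow[symmetric] mult.commute)
    ultimately show ?thesis using q r by (simp add: powr_mult)
  qed
  ultimately show ?thesis by (intro exI[of _ n]) simp
qed

text \<open>
  Balls of radius 0 correspond to no cylinder. They are enlarged to radius \<open>\<tau> i\<close>, with total cost less
  than any prescribed bound.
\<close>

lemma ball_null_imp_cyl_content_0: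
  fixes S :: "'p::prime_card padic_plane set"
  assumes s: "s > 0" and S: "S \<subseteq> unit_square" and null: "ball_null s S"
  shows "cyl_content s S = 0"
proof -
  let ?q = "real CARD('p)" and ?M = "cost_measure CARD('p) s"
  have q: "?q > 1" by (rule card_prime_gt_1)
  have "cyl_content s S \<le> 0 + ennreal e" if e: "e > 0" for e
  proof -
    \<comment> \<open>The original radii and the enlargements each get the share \<open>e'\<close>; the bound by 1 keeps all radii at most 1.\<close>
  define e' where "e' = min e 1 / (2 * ?q powr s)"
    have e': "e' > 0" using e q by (simp add: e'_def)
    have e'1: "e' \<le> 1"
    proof -
      have "1 \<le> ?q powr s" using q s by (simp add: ge_one_powr_ge_zero)
      thus ?thesis unfolding e'_def by (auto simp: divide_le_eq min_def)
    qed
    obtain r u where r: "\<forall>i::nat. 0 \<le> r i" and cov: "S \<subseteq> (\<Union>i. {v. plane_dist (u i) v \<le> r i})"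
      and sum: "(\<Sum>i. ennreal (r i powr s)) < ennreal e'"
      by (rule ball_nullE[OF null e'])
    define \<tau> where "\<tau> i = (e' * (1 / 2) ^ Suc i) powr (1 / s)" for i :: nat
    have \<tau>: "\<tau> i > 0" "\<tau> i powr s = e' * (1 / 2) ^ Suc i" for i
      using e' s by (simp_all add: \<tau>_def powr_powr del: power_Suc)
    have small: "e' * (1 / 2) ^ Suc i \<le> 1" for i
      using mult_mono[OF e'1 power_le_one[of "1 / 2 :: real" "Suc i"]] by simp
    have \<tau>1: "\<tau> i \<le> 1" for i unfolding \<tau>_def using small[of i] e' s by (intro powr_le1) auto
    have r1: "r i \<le> 1" for i
    proof (rule ccontr)
      assume "\<not> r i \<le> 1"
      hence "1 \<le> r i powr s" using s by (simp add: ge_one_powr_ge_zero)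
      moreover have "sum (\<lambda>i. ennreal (r i powr s)) {i} \<le> (\<Sum>i. ennreal (r i powr s))"
        by (rule sum_le_suminf[OF summableI]) auto
      hence "ennreal (r i powr s) < ennreal e'" using sum by simp
      ultimately show False using e'1 by (simp add: ennreal_less_iff)
    qed
    have "\<exists>n::nat. max (r i) (\<tau> i) \<le> 1 / ?q ^ n \<and> ?q powr (- s * real n) \<le> ?q powr s * max (r i) (\<tau> i) powr s" for i
      using \<tau>(1)[of i] \<tau>1[of i] r1[of i] by (intro level_of_radius q s) auto
    then obtain n where n: "\<And>i. max (r i) (\<tau> i) \<le> 1 / ?q ^ n i"
       "\<And>i. ?q powr (- s * real (n i)) \<le> ?q powr s * max (r i) (\<tau> i) powr s" by metis
    define B where "B i = {v. plane_dist (u i) v \<le> r i} \<inter> S" for i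
    define x where "x i = (n i, residue_pair (n i) (SOME z. z \<in> B i))" for i
    have "S \<subseteq> (\<Union>y\<in>range x. cylinder y)"
    proof
      fix z assume z: "z \<in> S"
      then obtain i where i: "plane_dist (u i) z \<le> r i" using cov by auto
      hence zB: "z \<in> B i" using z by (simp add: B_def)
      hence wB: "(SOME z. z \<in> B i) \<in> B i" by (rule someI)
      let ?w = "SOME z. z \<in> B i"
      have "plane_dist z ?w \<le> r i"
        using wB i plane_dist_ultra[of z "u i" "r i" ?w] by (simp add: B_def plane_dist_commute)
      also have "r i \<le> 1 / ?q ^ n i" using n(1)[of i] by simp
      finally have "residue_pair (n i) z = residue_pair (n i) ?w"
        using z wB S by (subst residue_pair_eq_iff) (auto simp: B_def)
      hence "z \<in> cylinder (x i)" using z S by (auto simp: cylinder_def x_def)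
      thus "z \<in> (\<Union>y\<in>range x. cylinder y)" by blast
    qed
    hence "cyl_content s S \<le> emeasure ?M (range x)" by (rule cyl_content_le)
    also have "range x = (\<Union>i. {x i})" by auto
    also have "emeasure ?M (\<Union>i. {x i}) \<le> (\<Sum>i. emeasure ?M {x i})" by (rule emeasure_subadditive_countably) simp
    also have "\<dots> \<le> (\<Sum>i. ennreal (?q powr s) * (ennreal (r i powr s) + ennreal (e' * (1 / 2) ^ Suc i)))"
    proof (intro suminf_le)
      fix i
      have "cost CARD('p) s (x i) \<le> ?q powr s * max (r i) (\<tau> i) powr s" using n(2)[of i] by (simp add: cost_def x_def)
      also have "\<dots> \<le> ?q powr s * (r i powr s + \<tau> i powr s)" by (intro mult_left_mono) (auto simp: max_def)
      finally have "ennreal (cost CARD('p) s (x i)) \<le> ennreal (?q powr s * (r i powr s + \<tau> i powr s))" by (rule ennreal_leI)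
      also have "\<dots> = ennreal (?q powr s) * (ennreal (r i powr s) + ennreal (e' * (1 / 2) ^ Suc i))"
        unfolding \<tau>(2) using e' by (simp add: ennreal_mult del: power_Suc)
      finally show "emeasure ?M {x i} \<le> \<dots>" by (simp add: emeasure_cost_measure_singleton del: power_Suc)
    qed auto
    also have "\<dots> = ennreal (?q powr s) * ((\<Sum>i. ennreal (r i powr s)) + (\<Sum>i. ennreal (e' * (1 / 2) ^ Suc i)))"
      unfolding ennreal_suminf_cmult by (subst suminf_add) auto
    also have "(\<Sum>i. ennreal (e' * (1 / 2) ^ Suc i)) = ennreal e'" using e' by (intro suminf_half_powers) auto
    also have "ennreal (?q powr s) * ((\<Sum>i. ennreal (r i powr s)) + ennreal e') \<le> ennreal (?q powr s) * (ennreal e' + ennreal e')"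
      using sum by (intro mult_left_mono add_mono) auto
    also have "\<dots> = ennreal (?q powr s * (e' + e'))" using e' by (simp flip: ennreal_plus ennreal_mult)
    also have "?q powr s * (e' + e') = min e 1" using q by (simp add: e'_def)
    also have "ennreal (min e 1) \<le> ennreal e" by (intro ennreal_leI) simp
    finally show ?thesis by simp
  qed
  note le = this
  have "cyl_content s S \<le> 0" by (rule ennreal_le_epsilon) (use le in simp)
  thus ?thesis by simp
qed

section \<open>The estimate in the unit square\<close>

text \<open>
  Points of the finite set receive, one after the other, the largest mass that keeps every class
  within its capacity \<open>w j\<close>. Each new point thereby saturates one of its classes, and a saturated class
  remains saturated, since later points in it receive mass 0.
\<close>

lemma greedy_mass:
  fixes \<pi> :: "nat \<Rightarrow> 'a \<Rightarrow> 'b" and w :: "nat \<Rightarrow> real"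
  assumes F: "finite F" and w: "\<And>j. w j \<ge> 0"
  shows "\<exists>\<mu>. (\<forall>x. 0 \<le> \<mu> x) \<and> (\<forall>j\<le>k. \<forall>b. (\<Sum>x | x \<in> F \<and> \<pi> j x = b. \<mu> x) \<le> w j) \<and>
     (\<forall>x\<in>F. \<exists>j\<le>k. (\<Sum>y | y \<in> F \<and> \<pi> j y = \<pi> j x. \<mu> y) = w j)"
  using F
proof (induction F rule: finite_induct)
  case empty
  show ?case using w by (intro exI[of _ "\<lambda>_. 0"]) simp
next
  case (insert z F)
  then obtain \<mu> where \<mu>: "\<forall>x. 0 \<le> \<mu> x" "\<And>j b. j \<le> k \<Longrightarrow> (\<Sum>x | x \<in> F \<and> \<pi> j x = b. \<mu> x) \<le> w j"
     "\<And>x. x \<in> F \<Longrightarrow> \<exists>j\<le>k. (\<Sum>y | y \<in> F \<and> \<pi> j y = \<pi> j x. \<mu> y) = w j" by auto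
  \<comment> \<open>The mass that the class of \<open>z\<close> at level \<open>j\<close> can still take.\<close>
  define room where "room j = w j - (\<Sum>y | y \<in> F \<and> \<pi> j y = \<pi> j z. \<mu> y)" for j
  define m where "m = Min (room ` {..k})"
  have m_le: "m \<le> room j" if "j \<le> k" for j unfolding m_def using that by (intro Min_le) auto
  have m_in: "m \<in> room ` {..k}" unfolding m_def by (intro Min_in) auto
  have m0: "m \<ge> 0" using m_in \<mu>(2) by (auto simp: room_def)
  define \<nu> where "\<nu> = \<mu>(z := m)"
  have sum: "(\<Sum>x | x \<in> insert z F \<and> \<pi> j x = b. \<nu> x) =
     (\<Sum>x | x \<in> F \<and> \<pi> j x = b. \<mu> x) + (if \<pi> j z = b then m else 0)" for j b
  proof -
    have old: "(\<Sum>x | x \<in> F \<and> \<pi> j x = b. \<nu> x) = (\<Sum>x | x \<in> F \<and> \<pi> j x = b. \<mu> x)"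
      using insert.hyps by (intro sum.cong) (auto simp: \<nu>_def)
    show ?thesis
    proof (cases "\<pi> j z = b")
      case True
      hence "{x. x \<in> insert z F \<and> \<pi> j x = b} = insert z {x. x \<in> F \<and> \<pi> j x = b}" by auto
      thus ?thesis using insert.hyps True old by (simp add: \<nu>_def)
    next
      case False
      hence "{x. x \<in> insert z F \<and> \<pi> j x = b} = {x. x \<in> F \<and> \<pi> j x = b}" by auto
      thus ?thesis using False old by simp
    qed
  qed
  show ?case
  proof (intro exI[of _ \<nu>] conjI allI impI ballI)
    show "0 \<le> \<nu> x" for x using \<mu>(1) m0 by (simp add: \<nu>_def)
    show "(\<Sum>x | x \<in> insert z F \<and> \<pi> j x = b. \<nu> x) \<le> w j" if "j \<le> k" for j b
      unfolding sum using m_le[OF that] \<mu>(2)[OF that, of b] by (auto simp: room_def)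
    fix x assume x: "x \<in> insert z F"
    show "\<exists>j\<le>k. (\<Sum>y | y \<in> insert z F \<and> \<pi> j y = \<pi> j x. \<nu> y) = w j"
    proof (cases "x = z")
      case True
      obtain j where "j \<le> k" "m = room j" using m_in by auto
      thus ?thesis unfolding sum using True by (intro exI[of _ j]) (simp add: room_def)
    next
      case False
      then obtain j where j: "j \<le> k" "(\<Sum>y | y \<in> F \<and> \<pi> j y = \<pi> j x. \<mu> y) = w j" using \<mu>(3) x by blast
      have "\<pi> j z \<noteq> \<pi> j x \<or> m \<le> 0"
        using m_le[OF j(1)] j(2) by (auto simp: room_def)
      thus ?thesis unfolding sum using j m0 by (intro exI[of _ j]) auto
    qed
  qed
qed

text \<open>
  The minimal saturated level depends only on the class, so the largest classes that are saturated
  are pairwise disjoint. They cover the set and their total capacity is the total mass.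
\<close>

lemma saturated_cover:
  fixes \<pi> :: "nat \<Rightarrow> 'a \<Rightarrow> 'b" and w :: "nat \<Rightarrow> real"
  assumes F: "finite F" and \<mu>: "\<And>x. 0 \<le> \<mu> x"
    and sat: "\<And>x. x \<in> F \<Longrightarrow> \<exists>j\<le>k. (\<Sum>y | y \<in> F \<and> \<pi> j y = \<pi> j x. \<mu> y) = w j"
    and nest: "\<And>i j x y. i \<le> j \<Longrightarrow> \<pi> j x = \<pi> j y \<Longrightarrow> \<pi> i x = \<pi> i y"
  obtains Q where "finite Q" "\<And>x. x \<in> F \<Longrightarrow> \<exists>j\<le>k. (j, \<pi> j x) \<in> Q" "(\<Sum>x\<in>Q. w (fst x)) \<le> sum \<mu> F"
proof -
  let ?sat = "\<lambda>x j. (\<Sum>y | y \<in> F \<and> \<pi> j y = \<pi> j x. \<mu> y) = w j"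
  define lev where "lev x = (LEAST j. ?sat x j)" for x
  define ball where "ball x = (lev x, \<pi> (lev x) x)" for x
  have ex: "\<exists>j. ?sat x j" if "x \<in> F" for x using sat[OF that] by blast
  have levs: "?sat x (lev x)" if "x \<in> F" for x
    unfolding lev_def using ex[OF that] by (rule LeastI_ex)
  have lev_le: "lev x \<le> j" if "?sat x j" for x j unfolding lev_def using that by (rule Least_le)
  have lev_k: "lev x \<le> k" if "x \<in> F" for x using sat[OF that] lev_le order.trans by blast
  have ball_eq: "ball y = ball x" if x: "x \<in> F" and y: "y \<in> F" and eq: "\<pi> (lev x) y = \<pi> (lev x) x" for x y
  proof -
    have le: "lev y \<le> lev x" using levs[OF x] unfolding eq[symmetric] by (rule lev_le)
    hence eq': "\<pi> (lev y) y = \<pi> (lev y) x" using nest eq by blast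
    have "lev x \<le> lev y" using levs[OF y] unfolding eq' by (rule lev_le)
    thus ?thesis using le eq by (simp add: ball_def)
  qed
  show ?thesis
  proof (rule that[of "ball ` F"])
    show "finite (ball ` F)" using F by simp
    show "\<exists>j\<le>k. (j, \<pi> j x) \<in> ball ` F" if "x \<in> F" for x
      using that lev_k[OF that] by (intro exI[of _ "lev x"]) (auto simp: ball_def)
    have "(\<Sum>q\<in>ball ` F. w (fst q)) = (\<Sum>q\<in>ball ` F. \<Sum>y | y \<in> F \<and> ball y = q. \<mu> y)"
    proof (rule sum.cong[OF refl])
      fix q assume "q \<in> ball ` F"
      then obtain x where x: "x \<in> F" "q = ball x" by blast
      have "\<pi> (lev x) y = \<pi> (lev x) x" if "ball y = ball x" for y
        using that unfolding ball_def by (metis prod.inject)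
      hence "{y. y \<in> F \<and> ball y = q} = {y. y \<in> F \<and> \<pi> (lev x) y = \<pi> (lev x) x}"
        using ball_eq[OF x(1)] unfolding x(2) by blast
      thus "w (fst q) = (\<Sum>y | y \<in> F \<and> ball y = q. \<mu> y)" using levs[OF x(1)] x by (simp add: ball_def)
    qed
    also have "\<dots> = sum \<mu> F" using sum.image_gen[OF F, of \<mu> ball] by simp
    finally show "(\<Sum>x\<in>ball ` F. w (fst x)) \<le> sum \<mu> F" by simp
  qed
qed

lemma pair_mod_pair_mod: "i \<le> j \<Longrightarrow> pair_mod (q ^ i) (pair_mod (q ^ j) z) = pair_mod (q ^ i) z"
  unfolding pair_mod_def by (simp add: mod_mod_cancel le_imp_power_dvd)

text \<open>
  Frostman's lemma at a fixed scale, where it concerns only the finitely many residue classes that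
  \<open>A\<close> meets: the greedy masses are a Frostman measure, and the saturated classes are a cover that
  shows that their total is not too small.
\<close>

lemma discrete_frostman:
  fixes A :: "'p::prime_card padic_plane set"
  assumes A: "A \<subseteq> unit_square"
  obtains \<mu> where "finite (residue_pair k ` A)" "\<forall>l. \<mu> l \<ge> (0 :: real)"
    "\<forall>j\<le>k. \<forall>c. (\<Sum>l | l \<in> residue_pair k ` A \<and> pair_mod (int CARD('p) ^ j) l = c. \<mu> l) \<le> real CARD('p) powr (- real j * t)"
    "cyl_content t A \<le> ennreal (sum \<mu> (residue_pair k ` A))"
proof -
  let ?F = "residue_pair k ` A" and ?\<pi> = "\<lambda>j. pair_mod (int CARD('p) ^ j)"
  define w where "w j = real CARD('p) powr (- real j * t)" for j :: nat
  have fin: "finite ?F"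
    by (rule finite_subset[of _ "{0..<int CARD('p) ^ k} \<times> {0..<int CARD('p) ^ k}"]) (use A residue_pair_range in blast, simp)
  obtain \<mu> where \<mu>: "\<forall>x. 0 \<le> \<mu> x" "\<forall>j\<le>k. \<forall>b. (\<Sum>x | x \<in> ?F \<and> ?\<pi> j x = b. \<mu> x) \<le> w j"
     "\<forall>x\<in>?F. \<exists>j\<le>k. (\<Sum>y | y \<in> ?F \<and> ?\<pi> j y = ?\<pi> j x. \<mu> y) = w j"
    using greedy_mass[OF fin, of w k ?\<pi>] unfolding w_def by auto
  obtain Q where Q: "finite Q" "\<And>x. x \<in> ?F \<Longrightarrow> \<exists>j\<le>k. (j, ?\<pi> j x) \<in> Q" "(\<Sum>x\<in>Q. w (fst x)) \<le> sum \<mu> ?F"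
  proof (rule saturated_cover[OF fin, of \<mu> k ?\<pi> w])
    show "?\<pi> i x = ?\<pi> i y" if "i \<le> j" "?\<pi> j x = ?\<pi> j y" for i j x y
      using pair_mod_pair_mod[OF that(1), of "int CARD('p)"] that(2) by metis
  qed (use \<mu> in auto)
  have "A \<subseteq> (\<Union>x\<in>Q. cylinder x)"
  proof
    fix z assume z: "z \<in> A"
    then obtain j where j: "j \<le> k" "(j, ?\<pi> j (residue_pair k z)) \<in> Q" using Q(2) by blast
    have "z \<in> cylinder (j, ?\<pi> j (residue_pair k z))" using residue_pair_mod[of z j k] j z A by (auto simp: cylinder_def)
    thus "z \<in> (\<Union>x\<in>Q. cylinder x)" using j by blast
  qed
  hence "cyl_content t A \<le> ennreal (\<Sum>x\<in>Q. cost CARD('p) t x)" by (rule cyl_content_le_finite[OF Q(1)])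
  also have "(\<Sum>x\<in>Q. cost CARD('p) t x) = (\<Sum>x\<in>Q. w (fst x))" by (simp add: w_def cost_def mult.commute)
  also have "ennreal \<dots> \<le> ennreal (sum \<mu> ?F)" by (intro ennreal_leI Q(3))
  finally show thesis using \<mu>(1,2) fin by (intro that[of \<mu>]) (auto simp: w_def)
qed

text \<open>
  A class is called heavy if the given cylinders inside it cost at least as much as the class. The
  new cover consists of the largest heavy classes. A class that strictly contains some of them is not
  heavy, and the cost of the new cover inside it is at most the cost of the old one, which gives the
  bound on the number of classes. Every class used costs less than the old cover,
  so a cheap cover contains only small classes.
\<close>

lemma balanced_cover:
  fixes E :: "'p::prime_card padic_plane set"
  assumes small: "cyl_content \<sigma> E < ennreal \<tau>"
  obtains P where
    "\<And>k. P k \<subseteq> {0..<int CARD('p) ^ k} \<times> {0..<int CARD('p) ^ k}"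
    "\<And>k j c. j \<le> k \<Longrightarrow> real (card {z \<in> P k. pair_mod (int CARD('p) ^ j) z = c}) \<le> real CARD('p) powr ((real k - real j) * \<sigma>)"
    "\<And>z. z \<in> E \<Longrightarrow> \<exists>k. residue_pair k z \<in> P k"
    "\<And>k. P k \<noteq> {} \<Longrightarrow> real CARD('p) powr (- \<sigma> * real k) < \<tau>"
proof -
  let ?M = "cost_measure CARD('p) \<sigma>" and ?\<pi> = "\<lambda>j. pair_mod (int CARD('p) ^ j)"
  have q0: "real CARD('p) > 0" using card_prime_gt_1[where 'p = 'p] by simp
  obtain K where K: "E \<subseteq> (\<Union>x\<in>K. cylinder x)" "emeasure ?M K < ennreal \<tau>"
    using small by (rule cyl_content_lessE)
  define inside where "inside n c = {x \<in> K. n \<le> fst x \<and> ?\<pi> n (snd x) = c}" for n c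
  define heavy where "heavy n c \<longleftrightarrow> ennreal (real CARD('p) powr (- \<sigma> * real n)) \<le> emeasure ?M (inside n c)" for n c
  define P where "P k = {c \<in> {0..<int CARD('p) ^ k} \<times> {0..<int CARD('p) ^ k}. heavy k c \<and> (\<forall>j<k. \<not> heavy j (?\<pi> j c))}" for k
  have finP: "finite (P k)" for k
    by (rule finite_subset[of _ "{0..<int CARD('p) ^ k} \<times> {0..<int CARD('p) ^ k}"]) (auto simp: P_def)
  show thesis
  proof (rule that[of P])
    show "P k \<subseteq> {0..<int CARD('p) ^ k} \<times> {0..<int CARD('p) ^ k}" for k by (auto simp: P_def)
  next
    fix k :: nat assume "P k \<noteq> {}"
    then obtain c where "heavy k c" by (auto simp: P_def)
    hence "ennreal (real CARD('p) powr (- \<sigma> * real k)) \<le> emeasure ?M (inside k c)" by (simp add: heavy_def)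
    also have "\<dots> \<le> emeasure ?M K" by (intro emeasure_mono) (auto simp: inside_def)
    also note K(2)
    finally show "real CARD('p) powr (- \<sigma> * real k) < \<tau>" by (simp add: ennreal_less_iff)
  next
    fix z assume z: "z \<in> E"
    then obtain x where x: "x \<in> K" "z \<in> cylinder x" using K(1) by blast
    hence zU: "z \<in> unit_square" and cz: "residue_pair (fst x) z = snd x" by (auto simp: cylinder_def)
    have "x \<in> inside (fst x) (residue_pair (fst x) z)"
      using x residue_pair_mod[OF zU order.refl, of "fst x"] cz by (simp add: inside_def)
    hence "emeasure ?M {x} \<le> emeasure ?M (inside (fst x) (residue_pair (fst x) z))" by (intro emeasure_mono) auto
    hence hv: "heavy (fst x) (residue_pair (fst x) z)"
      by (simp add: heavy_def emeasure_cost_measure_singleton cost_def)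
    define k where "k = (LEAST n. heavy n (residue_pair n z))"
    have k: "heavy k (residue_pair k z)" unfolding k_def by (rule LeastI[of _ "fst x"]) (rule hv)
    have "\<not> heavy j (?\<pi> j (residue_pair k z))" if "j < k" for j
      using not_less_Least[of j "\<lambda>n. heavy n (residue_pair n z)"] that residue_pair_mod[OF zU, of j k] by (simp add: k_def)
    hence "residue_pair k z \<in> P k" using k residue_pair_range[OF zU] by (simp add: P_def)
    thus "\<exists>k. residue_pair k z \<in> P k" by blast
  next
    fix k j :: nat and c assume jk: "j \<le> k"
    let ?Z = "{z \<in> P k. ?\<pi> j z = c}"
    have fin: "finite ?Z" using finP by simp
    show "real (card ?Z) \<le> real CARD('p) powr ((real k - real j) * \<sigma>)"
    proof (cases "j = k \<or> ?Z = {}")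
      case True
      show ?thesis
      proof (cases "?Z = {}")
        case empty: True
        have "card ?Z = 0" unfolding empty by simp
        thus ?thesis by simp
      next
        case False
        hence jk': "j = k" using True by blast
        hence "?Z \<subseteq> {c}" by (auto simp: P_def pair_mod_def)
        hence "card ?Z \<le> card {c}" by (intro card_mono) simp_all
        hence "card ?Z \<le> 1" by simp
        moreover have "real CARD('p) powr ((real k - real j) * \<sigma>) = 1" using jk' q0 by simp
        ultimately show ?thesis by simp
      qed
    next
      case False
      hence jk': "j < k" using jk by simp
      from False have "\<not> heavy j c" using jk' by (auto simp: P_def)
      hence lt: "emeasure ?M (inside j c) < ennreal (real CARD('p) powr (- \<sigma> * real j))" by (simp add: heavy_def not_le)
      have "ennreal (real (card ?Z) * real CARD('p) powr (- \<sigma> * real k)) = (\<Sum>z\<in>?Z. ennreal (real CARD('p) powr (- \<sigma> * real k)))"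
        by (simp add: ennreal_mult ennreal_of_nat_eq_real_of_nat)
      also have "\<dots> \<le> (\<Sum>z\<in>?Z. emeasure ?M (inside k z))"
        by (intro sum_mono) (auto simp: P_def heavy_def)
      also have "\<dots> = emeasure ?M (\<Union>z\<in>?Z. inside k z)"
        by (rule sum_emeasure) (auto simp: fin disjoint_family_on_def inside_def)
      also have "\<dots> \<le> emeasure ?M (inside j c)"
      proof (rule emeasure_mono)
        show "(\<Union>z\<in>?Z. inside k z) \<subseteq> inside j c"
        proof
          fix x assume "x \<in> (\<Union>z\<in>?Z. inside k z)"
          hence x: "x \<in> K" "k \<le> fst x" "?\<pi> j (?\<pi> k (snd x)) = c" unfolding inside_def by blast+
          thus "x \<in> inside j c" using jk pair_mod_pair_mod[OF jk, of "int CARD('p)" "snd x"] by (simp add: inside_def)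
        qed
      qed simp
      also note lt
      finally have "real (card ?Z) * real CARD('p) powr (- \<sigma> * real k) < real CARD('p) powr (- \<sigma> * real j)"
        by (simp add: ennreal_less_iff)
      hence "real (card ?Z) < real CARD('p) powr (- \<sigma> * real j) / real CARD('p) powr (- \<sigma> * real k)"
        using q0 by (simp add: pos_less_divide_eq)
      also have "\<dots> = real CARD('p) powr ((real k - real j) * \<sigma>)"
        by (simp add: powr_diff[symmetric] algebra_simps)
      finally show ?thesis by simp
    qed
  qed
qed


text \<open>
  After division by \<open>B\<^sup>4\<^sup>k\<close> the left hand side tends to 0.
\<close>

lemma eventually_geometric_beats_linear:
  fixes B C c :: real
  assumes B: "1 < B" and C: "0 \<le> C" and c: "0 < c"
  shows "\<exists>k0. \<forall>k\<ge>k0. 1 + real k * C * B ^ k < c * B ^ (4 * k)"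
proof -
  define x where "x = 1 / B"
  have x: "0 < x" "x < 1" using B by (auto simp: x_def)
  have "(\<lambda>k. x ^ k + C * (real k * x ^ k)) \<longlonglongrightarrow> 0 + C * 0"
    using x by (intro tendsto_intros LIMSEQ_realpow_zero powser_times_n_limit_0) auto
  hence "eventually (\<lambda>k. x ^ k + C * (real k * x ^ k) < c) sequentially"
    using c by (intro order_tendstoD(2)[of _ "0 + C * 0"]) auto
  then obtain k0 where k0: "\<And>k. k \<ge> k0 \<Longrightarrow> x ^ k + C * (real k * x ^ k) < c"
    unfolding eventually_sequentially by blast
  have "1 + real k * C * B ^ k < c * B ^ (4 * k)" if k: "k \<ge> k0" for k
  proof -
    have xB: "x ^ n * B ^ n = 1" for n using B by (simp add: x_def power_one_over)
    have 1: "1 \<le> x ^ k * B ^ (4 * k)"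
    proof -
      have "x ^ k * B ^ (4 * k) = (x ^ k * B ^ k) * B ^ (3 * k)"
        by (simp add: power_add[symmetric] mult.assoc)
      thus ?thesis using B by (simp add: xB)
    qed
    have 2: "B ^ k \<le> x ^ k * B ^ (4 * k)"
    proof -
      have "x ^ k * B ^ (4 * k) = (x ^ k * B ^ k) * (B ^ k * B ^ (2 * k))"
        by (simp add: power_add[symmetric] mult.assoc)
      moreover have "B ^ k * 1 \<le> B ^ k * B ^ (2 * k)" using B by (intro mult_left_mono) auto
      ultimately show ?thesis by (simp add: xB)
    qed
    have "1 + real k * C * B ^ k \<le> x ^ k * B ^ (4 * k) + real k * C * (x ^ k * B ^ (4 * k))"
      using C by (intro add_mono 1 mult_left_mono 2) auto
    also have "\<dots> = (x ^ k + C * (real k * x ^ k)) * B ^ (4 * k)" by (simp add: algebra_simps)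
    also have "\<dots> < c * B ^ (4 * k)" using k0[OF k] B by (intro mult_strict_right_mono) auto
    finally show ?thesis .
  qed
  thus ?thesis by blast
qed

text \<open>
  The exponents on the right of the incidence bound depend linearly on \<open>j\<close>, so they are at most
  \<open>k (s - 3 \<eta>)\<close> because this holds at \<open>j = 0\<close> and at \<open>j = k\<close>: this is where the two
  inequalities for \<open>\<sigma>\<close> come from. The losses \<open>q\<^sup>\<eta>\<^sup>k\<close> of the pigeonhole steps are smaller than the gain.
\<close>

lemma incidence_bound_fails_at_fine_scales:
  fixes q c \<eta> :: real and k :: nat
  assumes q: "1 < q" and c: "0 < c" and M: "c * q powr (- \<eta> * real k) \<le> M"
    and \<sigma>: "\<sigma> - 1 \<le> s - 3 * \<eta>" "(\<sigma> + 1 - t) / 2 \<le> s - 3 * \<eta>"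
    and inc: "c * q powr ((s - \<eta>) * real k) * M \<le> q powr (real k * (\<sigma> - 1)) * M +
       (\<Sum>j=1..k. q powr (real k * (\<sigma> - 1) + real j * ((3 - \<sigma> - t) / 2)) * sqrt M)"
    and large: "1 + real k * (1 / sqrt c) * (q powr (\<eta> / 2)) ^ k < c * (q powr (\<eta> / 2)) ^ (4 * k)"
  shows False
proof -
  have M0: "M > 0" using M c q by (intro less_le_trans[OF _ M]) simp
  define W where "W = q powr (real k * (s - 3 * \<eta>))"
  have W0: "W > 0" using q by (simp add: W_def)
  have e1: "q powr (real k * (\<sigma> - 1)) \<le> W"
    unfolding W_def using q \<sigma>(1) by (intro powr_mono mult_left_mono) auto
  have e2: "q powr (real k * (\<sigma> - 1) + real j * ((3 - \<sigma> - t) / 2)) \<le> W" if j: "j \<le> k" for j :: nat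
    unfolding W_def
  proof (rule powr_mono)
    show "real k * (\<sigma> - 1) + real j * ((3 - \<sigma> - t) / 2) \<le> real k * (s - 3 * \<eta>)"
    proof (cases "(3 - \<sigma> - t) / 2 \<le> 0")
      case True
      hence "real j * ((3 - \<sigma> - t) / 2) \<le> 0" by (intro mult_nonneg_nonpos) auto
      moreover have "real k * (\<sigma> - 1) \<le> real k * (s - 3 * \<eta>)" using \<sigma>(1) by (intro mult_left_mono) auto
      ultimately show ?thesis by linarith
    next
      case False
      hence "real j * ((3 - \<sigma> - t) / 2) \<le> real k * ((3 - \<sigma> - t) / 2)" using j by (intro mult_right_mono) auto
      hence "real k * (\<sigma> - 1) + real j * ((3 - \<sigma> - t) / 2) \<le> real k * ((\<sigma> + 1 - t) / 2)"
        by (simp add: field_simps)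
      also have "\<dots> \<le> real k * (s - 3 * \<eta>)" using \<sigma>(2) by (intro mult_left_mono) auto
      finally show ?thesis .
    qed
  qed (use q in simp)
  have "c * q powr ((s - \<eta>) * real k) * M \<le> W * M + (\<Sum>j=1..k. W * sqrt M)"
    using inc e1 e2 M0 by (elim order.trans) (intro add_mono sum_mono mult_right_mono, auto)
  also have "\<dots> = W * (M + real k * sqrt M)" by (simp add: algebra_simps)
  finally have le: "c * q powr ((s - \<eta>) * real k) * M \<le> W * (M + real k * sqrt M)" .
  have pw: "q powr ((s - \<eta>) * real k) = W * q powr (2 * \<eta> * real k)"
    unfolding W_def powr_add[symmetric] by (simp add: algebra_simps)
  have "c * q powr (2 * \<eta> * real k) * M \<le> M + real k * sqrt M"
    using le W0 unfolding pw by (simp add: mult.assoc mult.left_commute[of c W])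
  also have "\<dots> = (1 + real k * (1 / sqrt M)) * M"
  proof -
    have "(1 / sqrt M) * M = sqrt M" using M0 real_div_sqrt[of M] by simp
    thus ?thesis by (simp only: distrib_right mult_1_left mult.assoc)
  qed
  finally have "c * q powr (2 * \<eta> * real k) \<le> 1 + real k * (1 / sqrt M)"
    using M0 by (simp only: mult_le_cancel_right_pos)
  also have "1 / sqrt M \<le> 1 / sqrt c * q powr (\<eta> / 2 * real k)"
  proof -
    have "sqrt (c * q powr (- \<eta> * real k)) = sqrt c * q powr (- \<eta> * real k / 2)"
      unfolding real_sqrt_mult using powr_half_sqrt_powr[of q "- \<eta> * real k"] q by simp
    hence "sqrt c * q powr (- (\<eta> / 2 * real k)) \<le> sqrt M" using real_sqrt_le_mono[OF M] by simp
    hence "1 / sqrt M \<le> 1 / (sqrt c * q powr (- (\<eta> / 2 * real k)))"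
      using c q M0 by (intro divide_left_mono) auto
    thus ?thesis using q by (simp add: powr_minus_divide)
  qed
  finally have "c * q powr (2 * \<eta> * real k) \<le> 1 + real k * (1 / sqrt c * q powr (\<eta> / 2 * real k))"
    by (simp add: mult_left_mono)
  moreover have "q powr (\<eta> / 2 * real k) = (q powr (\<eta> / 2)) ^ k" using q by (simp add: powr_powr powr_realpow[symmetric])
  moreover have "q powr (2 * \<eta> * real k) = (q powr (\<eta> / 2)) ^ (4 * k)"
    using q by (simp add: powr_powr powr_realpow[symmetric] mult.assoc)
  ultimately show False using large by (simp add: mult.assoc)
qed

definition graph_line :: "'p::prime_card padic_plane \<Rightarrow> 'p padic_plane set" where
  "graph_line l = {(x, y). y = fst l * x + snd l}"

text \<open>
  The two pigeonhole steps use the summable weights \<open>c1 * \<rho> ^ k\<close> with total \<open>c / 2\<close>: a line whose trace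
  has content at least \<open>c\<close> is rich at some level, and for some level the lines that are rich there have
  content at least the weight.
\<close>

lemma furstenberg_unit_square:
  fixes E A :: "'p::prime_card padic_plane set"
  assumes E: "E \<subseteq> unit_square" and A: "A \<subseteq> unit_square"
    and \<eta>: "\<eta> > 0" and \<sigma>: "0 < \<sigma>" "\<sigma> - 1 \<le> s - 3 * \<eta>" "(\<sigma> + 1 - t) / 2 \<le> s - 3 * \<eta>"
    and c: "c > 0" and lines: "ennreal c \<le> cyl_content t A"
    and fibres: "\<And>l. l \<in> A \<Longrightarrow> ennreal c \<le> cyl_content s (E \<inter> graph_line l)"
  shows "cyl_content \<sigma> E \<noteq> 0"
proof
  assume E0: "cyl_content \<sigma> E = 0"
  define q where "q = real CARD('p)"
  have q: "q > 1" unfolding q_def by (rule card_prime_gt_1)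
  define \<rho> where "\<rho> = q powr (- \<eta>)"
  have \<rho>: "0 < \<rho>" "\<rho> < 1" using q \<eta> by (auto simp: \<rho>_def powr_less_one)
  have \<rho>k: "\<rho> ^ k = q powr (- \<eta> * real k)" for k using q by (simp add: \<rho>_def powr_powr powr_realpow[symmetric])
  define c1 where "c1 = c / 2 * (1 - \<rho>)"
  have c1: "c1 > 0" using c \<rho> by (simp add: c1_def)
  have sum_c1: "(\<Sum>k. ennreal (c1 * \<rho> ^ k)) = ennreal (c / 2)"
  proof (rule suminf_ennreal_eq)
    have "(\<lambda>k. c1 * \<rho> ^ k) sums (c1 * (1 / (1 - \<rho>)))" using \<rho> by (intro sums_mult geometric_sums) auto
    moreover have "(1 - \<rho>) * (1 / (1 - \<rho>)) = 1" using \<rho> by simp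
    hence "c1 * (1 / (1 - \<rho>)) = c / 2" by (simp only: c1_def mult.assoc mult_1_right)
    ultimately show "(\<lambda>k. c1 * \<rho> ^ k) sums (c / 2)" by (simp only:)
  qed (use c1 \<rho> in auto)
  have "1 < q powr (\<eta> / 2)" using q \<eta> by simp
  then obtain k0 where k0: "\<And>k. k \<ge> k0 \<Longrightarrow> 1 + real k * (1 / sqrt c1) * (q powr (\<eta> / 2)) ^ k < c1 * (q powr (\<eta> / 2)) ^ (4 * k)"
    using eventually_geometric_beats_linear[of "q powr (\<eta> / 2)" "1 / sqrt c1" c1] c1 by auto
  have "cyl_content \<sigma> E < ennreal (q powr (- \<sigma> * real k0))" using E0 q by simp
  then obtain P where P: "\<And>k. P k \<subseteq> {0..<int CARD('p) ^ k} \<times> {0..<int CARD('p) ^ k}"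
    "\<And>k j c. j \<le> k \<Longrightarrow> real (card {z \<in> P k. pair_mod (int CARD('p) ^ j) z = c}) \<le> real CARD('p) powr ((real k - real j) * \<sigma>)"
    "\<And>z. z \<in> E \<Longrightarrow> \<exists>k. residue_pair k z \<in> P k"
    "\<And>k. P k \<noteq> {} \<Longrightarrow> real CARD('p) powr (- \<sigma> * real k) < q powr (- \<sigma> * real k0)"
    by (rule balanced_cover) blast
  have large: "k \<ge> k0" if "P k \<noteq> {}" for k
  proof -
    have "- \<sigma> * real k < - \<sigma> * real k0" using P(4)[OF that] q by (simp add: q_def)
    thus ?thesis using \<sigma>(1) by simp
  qed
  have finP: "finite (P k)" for k by (rule finite_subset[OF P(1)]) simp
  define Q where "Q k l = {z \<in> P k. on_line_mod (int CARD('p) ^ k) (residue_pair k l) z}" for k and l :: "'p padic_plane"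
  \<comment> \<open>\<open>Q k l\<close> consists of the classes of level \<open>k\<close> on \<open>l\<close>, and \<open>Ak k\<close> of the lines that are rich at level \<open>k\<close>.\<close>
  define Ak where "Ak k = {l \<in> A. c1 * \<rho> ^ k \<le> real (card (Q k l)) * q powr (- s * real k)}" for k
  have rich: "\<exists>k. l \<in> Ak k" if l: "l \<in> A" for l
  proof (rule ccontr)
    assume "\<nexists>k. l \<in> Ak k"
    hence poor: "real (card (Q k l)) * q powr (- s * real k) \<le> c1 * \<rho> ^ k" for k
      using l unfolding Ak_def by (auto simp: not_le intro: less_imp_le)
    define S where "S k = {z \<in> E \<inter> graph_line l. residue_pair k z \<in> P k}" for k
    have "cyl_content s (S k) \<le> ennreal (c1 * \<rho> ^ k)" for k
    proof -
      have "S k \<subseteq> (\<Union>x\<in>{k} \<times> Q k l. cylinder x)"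
      proof
        fix z assume z: "z \<in> S k"
        hence zU: "z \<in> unit_square" using E by (auto simp: S_def)
        have "snd z = fst l * fst z + snd l" using z by (auto simp: S_def graph_line_def)
        hence "on_line_mod (int CARD('p) ^ k) (residue_pair k l) (residue_pair k z)"
          unfolding on_line_mod_def residue_pair_def fst_conv snd_conv
          using zU l A by (intro residue_line) (auto simp: unit_square_def)
        hence "residue_pair k z \<in> Q k l" using z by (simp add: Q_def S_def)
        thus "z \<in> (\<Union>x\<in>{k} \<times> Q k l. cylinder x)" using zU by (auto simp: cylinder_def)
      qed
      hence "cyl_content s (S k) \<le> ennreal (\<Sum>x\<in>{k} \<times> Q k l. cost CARD('p) s x)"
        using finP by (intro cyl_content_le_finite) (auto simp: Q_def)
      also have "(\<Sum>x\<in>{k} \<times> Q k l. cost CARD('p) s x) = real (card (Q k l)) * q powr (- s * real k)"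
        by (subst sum.cong[OF refl, of _ _ "\<lambda>_. q powr (- s * real k)"]) (auto simp: cost_def q_def card_cartesian_product)
      also have "ennreal \<dots> \<le> ennreal (c1 * \<rho> ^ k)" by (intro ennreal_leI poor)
      finally show ?thesis .
    qed
    hence "(\<Sum>k. cyl_content s (S k)) \<le> ennreal (c / 2)"
      unfolding sum_c1[symmetric] by (intro suminf_le) auto
    moreover have "E \<inter> graph_line l = (\<Union>k. S k)" using P(3) by (auto simp: S_def)
    hence "cyl_content s (E \<inter> graph_line l) \<le> (\<Sum>k. cyl_content s (S k))" using cyl_content_UN[of s S] by simp
    ultimately have "ennreal c \<le> ennreal (c / 2)" using fibres[OF l] by (meson order.trans)
    thus False using c by simp
  qed
  have "\<exists>k. ennreal (c1 * \<rho> ^ k) \<le> cyl_content t (Ak k)"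
  proof (rule ccontr)
    assume "\<nexists>k. ennreal (c1 * \<rho> ^ k) \<le> cyl_content t (Ak k)"
    hence "(\<Sum>k. cyl_content t (Ak k)) \<le> ennreal (c / 2)"
      unfolding sum_c1[symmetric] by (intro suminf_le) (auto simp: not_le intro: less_imp_le)
    moreover have "A = (\<Union>k. Ak k)" using rich by (auto simp: Ak_def)
    hence "cyl_content t A \<le> (\<Sum>k. cyl_content t (Ak k))" using cyl_content_UN[of t Ak] by simp
    ultimately have "ennreal c \<le> ennreal (c / 2)" using lines by (meson order.trans)
    thus False using c by simp
  qed
  then obtain k where k: "ennreal (c1 * \<rho> ^ k) \<le> cyl_content t (Ak k)" by blast
  have AkU: "Ak k \<subseteq> unit_square" using A by (auto simp: Ak_def)
  obtain \<mu> where \<mu>: "finite (residue_pair k ` Ak k)" "\<forall>l. \<mu> l \<ge> (0 :: real)"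
    "\<forall>j\<le>k. \<forall>c. (\<Sum>l | l \<in> residue_pair k ` Ak k \<and> pair_mod (int CARD('p) ^ j) l = c. \<mu> l) \<le> real CARD('p) powr (- real j * t)"
    "cyl_content t (Ak k) \<le> ennreal (sum \<mu> (residue_pair k ` Ak k))"
    by (rule discrete_frostman[OF AkU])
  let ?M = "sum \<mu> (residue_pair k ` Ak k)"
  have "ennreal (c1 * \<rho> ^ k) \<le> ennreal ?M" using k \<mu>(4) by (rule order.trans)
  moreover have "0 \<le> ?M" using \<mu>(2) by (intro sum_nonneg) blast
  ultimately have M: "c1 * \<rho> ^ k \<le> ?M" by (simp add: ennreal_le_iff)
  have kk0: "k \<ge> k0"
  proof (rule large, rule notI)
    assume "P k = {}"
    hence "Ak k = {}" using c1 \<rho> by (auto simp: Ak_def Q_def not_le)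
    hence "?M = 0" by simp
    moreover have "0 < c1 * \<rho> ^ k" using c1 \<rho> by simp
    ultimately show False using M by linarith
  qed
  have N: "c1 * q powr ((s - \<eta>) * real k) \<le> real (card {z \<in> P k. on_line_mod (int CARD('p) ^ k) l z})"
    if l: "l \<in> residue_pair k ` Ak k" for l
  proof -
    obtain l' where l': "l' \<in> Ak k" "l = residue_pair k l'" using l by blast
    have "c1 * \<rho> ^ k * q powr (s * real k) \<le> (real (card (Q k l')) * q powr (- s * real k)) * q powr (s * real k)"
      using l'(1) by (intro mult_right_mono) (auto simp: Ak_def)
    also have "\<dots> = real (card (Q k l'))" using q by (simp add: powr_minus_divide)
    also have "c1 * \<rho> ^ k * q powr (s * real k) = c1 * q powr ((s - \<eta>) * real k)"
      unfolding \<rho>k mult.assoc powr_add[symmetric] by (simp add: algebra_simps)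
    finally show ?thesis using l'(2) by (simp add: Q_def)
  qed
  have "c1 * q powr ((s - \<eta>) * real k) * ?M \<le> q powr (real k * (\<sigma> - 1)) * ?M +
     (\<Sum>j=1..k. q powr (real k * (\<sigma> - 1) + real j * ((3 - \<sigma> - t) / 2)) * sqrt ?M)"
    unfolding q_def
    by (rule incidence_bound[OF prime_card P(1) \<mu>(1) \<mu>(2)[rule_format] P(2) \<mu>(3)[rule_format] N[unfolded q_def]])
  thus False
    by (intro incidence_bound_fails_at_fine_scales[OF q c1 _ \<sigma>(2,3) _ k0[OF kk0]]) (use M \<rho>k in auto)
qed

section \<open>The lower bound in the p-adic plane\<close>

text \<open>
  Squaring the factor in the second coordinate makes one map serve for points and for lines: a point on
  the line \<open>(a, b)\<close> is mapped to a point on the line \<open>(c a, c\<^sup>2 b)\<close>.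
\<close>

definition dilate :: "'p::prime_card padic \<Rightarrow> 'p padic_plane \<Rightarrow> 'p padic_plane" where
  "dilate c z = (c * fst z, c ^ 2 * snd z)"

lemma dilate_dilate_inverse: "c \<noteq> 0 \<Longrightarrow> dilate (inverse c) (dilate c z) = z"
  by (simp add: dilate_def power_inverse[symmetric] field_simps)

lemma plane_dist_dilate:
  assumes "padic_norm c \<le> r" "r \<ge> 1"
  shows "plane_dist (dilate c z) (dilate c w) \<le> r ^ 2 * plane_dist z (w :: 'p::prime_card padic_plane)"
proof -
  have r: "padic_norm c ^ 2 \<le> r ^ 2" using assms by (intro power_mono) auto
  have "padic_norm c * 1 \<le> r * r" using assms by (intro mult_mono) auto
  hence r': "padic_norm c \<le> r ^ 2" by (simp add: power2_eq_square)
  have d: "padic_norm (fst z - fst w) \<le> plane_dist z w" "padic_norm (snd z - snd w) \<le> plane_dist z w"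
    by (simp_all add: plane_dist_def plane_norm_def)
  show ?thesis
    unfolding plane_dist_le_iff dilate_def fst_conv snd_conv right_diff_distrib[symmetric] padic_norm_mult padic_norm_power
    using r r' d by (intro conjI mult_mono) auto
qed

lemma dilate_graph_line:
  assumes "z \<in> graph_line l" shows "dilate c z \<in> graph_line (dilate c l)"
  using assms by (auto simp: graph_line_def dilate_def power2_eq_square algebra_simps)

lemma ennreal_pos_lower_bound:
  assumes "x > (0 :: ennreal)" obtains c :: real where "c > 0" "ennreal c \<le> x"
proof (cases x)
  case (real r)
  thus ?thesis using assms that[of r] by auto
next
  case top
  thus ?thesis using that[of 1] by simp
qed

lemma ball_null_exhaustion:
  assumes "\<not> ball_null s (\<Union>m::nat. S m)" obtains m where "\<not> ball_null s (S m)"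
  using assms ball_null_UN by blast

lemma padic_norm_le_prime_power: "\<exists>m::nat. padic_norm (x :: 'p::prime_card padic) \<le> real CARD('p) ^ m"
  using real_arch_pow[OF card_prime_gt_1[where 'p = 'p], of "padic_norm x"] less_imp_le by blast

text \<open>
  Countable unions of null sets are null. So it may be assumed that the parameters and the first
  coordinates of the points are bounded, whence the dilation by a power of the prime moves
  everything that matters into the unit square, and then that the contents of the traces on the
  lines are bounded below uniformly.
\<close>

lemma graph_family_lower_bound:
  fixes E A :: "'p::prime_card padic_plane set"
  assumes st: "0 < s" "0 < t" "s + t \<ge> 2"
    and A: "\<And>t'. 0 < t' \<Longrightarrow> t' < t \<Longrightarrow> \<not> ball_null t' A"
    and fib: "\<And>l s'. l \<in> A \<Longrightarrow> 0 < s' \<Longrightarrow> s' < s \<Longrightarrow> \<not> ball_null s' (E \<inter> graph_line l)"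
    and \<sigma>: "0 < \<sigma>" "\<sigma> < s + 1"
  shows "\<not> ball_null \<sigma> E"
proof
  assume null: "ball_null \<sigma> E"
  let ?q = "real CARD('p)"
  have q: "?q > 1" by (rule card_prime_gt_1)
  \<comment> \<open>The factor 9: in twice the second inequality for \<open>\<sigma>\<close> below, \<open>t'\<close> costs \<open>\<eta>\<close>, \<open>s'\<close> costs \<open>2 \<eta>\<close> and the slack costs \<open>6 \<eta>\<close>.\<close>
  define \<eta> where "\<eta> = min ((s + 1 - \<sigma>) / 9) (min (s / 2) (t / 2))"
  have \<eta>: "\<eta> > 0" "9 * \<eta> \<le> s + 1 - \<sigma>" "\<eta> < s" "\<eta> < t" using st \<sigma> by (auto simp: \<eta>_def min_def)
  define s' where "s' = s - \<eta>"
  define t' where "t' = t - \<eta>"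
  have s': "0 < s'" "s' < s" and t': "0 < t'" "t' < t" using \<eta> by (auto simp: s'_def t'_def)
  define part where "part m l = E \<inter> graph_line l \<inter> {z. padic_norm (fst z) \<le> ?q ^ m}" for m :: nat and l :: "'p padic_plane"
  define Am where "Am m = {l \<in> A. padic_norm (fst l) \<le> ?q ^ m \<and> padic_norm (snd l) \<le> ?q ^ m \<and> \<not> ball_null s' (part m l)}" for m
  have pw: "?q ^ i \<le> ?q ^ j" if "i \<le> j" for i j using q that by (intro power_increasing) auto
  have "A \<subseteq> (\<Union>m. Am m)"
  proof
    fix l assume l: "l \<in> A"
    have "E \<inter> graph_line l = (\<Union>m. part m l)"
      using padic_norm_le_prime_power by (auto simp: part_def)
    hence "\<not> ball_null s' (\<Union>m. part m l)" using fib[OF l s'] by simp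
    then obtain m1 where m1: "\<not> ball_null s' (part m1 l)" by (rule ball_null_exhaustion)
    obtain m2 where m2: "padic_norm (fst l) \<le> ?q ^ m2" using padic_norm_le_prime_power by blast
    obtain m3 where m3: "padic_norm (snd l) \<le> ?q ^ m3" using padic_norm_le_prime_power by blast
    define m where "m = max m1 (max m2 m3)"
    have mm: "?q ^ m1 \<le> ?q ^ m" "?q ^ m2 \<le> ?q ^ m" "?q ^ m3 \<le> ?q ^ m" by (auto simp: m_def intro!: pw)
    have "part m1 l \<subseteq> part m l" using mm(1) by (auto simp: part_def)
    hence "\<not> ball_null s' (part m l)" using m1 ball_null_mono by blast
    hence "l \<in> Am m" using l m2 m3 mm by (auto simp: Am_def)
    thus "l \<in> (\<Union>m. Am m)" by blast
  qed
  hence "\<not> ball_null t' (\<Union>m. Am m)" using A[OF t'] ball_null_mono by blast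
  then obtain m where m: "\<not> ball_null t' (Am m)" by (rule ball_null_exhaustion)
  define c :: "'p padic" where "c = of_nat CARD('p) ^ m"
  have nc: "padic_norm c = 1 / ?q ^ m"
    by (simp add: c_def padic_norm_power padic_norm_of_nat_prime power_one_over)
  have c0: "c \<noteq> 0" using nc q by auto
  have c1: "padic_norm c \<le> 1" unfolding nc using q by simp
  have lip: "plane_dist (dilate c z) (dilate c w) \<le> 1 * plane_dist z w" for z w
    using plane_dist_dilate[OF c1, of z w] by simp
  have nci: "padic_norm (inverse c) \<le> ?q ^ m" by (simp add: padic_norm_inverse nc)
  have lip': "plane_dist (dilate (inverse c) z) (dilate (inverse c) w) \<le> (?q ^ m) ^ 2 * plane_dist z w" for z w
    using q by (intro plane_dist_dilate nci) auto
  have pos: "(?q ^ m) ^ 2 > 0" using q by simp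
  have int: "c * x \<in> padic_ints" if "padic_norm x \<le> ?q ^ m" for x
    using that q by (simp add: padic_ints_def padic_norm_mult nc)
  define E' where "E' = dilate c ` E \<inter> unit_square"
  define A' where "A' = dilate c ` Am m"
  have A'U: "A' \<subseteq> unit_square"
  proof
    fix z assume "z \<in> A'"
    then obtain l where l: "l \<in> Am m" "z = dilate c l" by (auto simp: A'_def)
    have "c * (c * snd l) \<in> padic_ints" using l c1 by (intro padic_ints_mult int) (auto simp: Am_def padic_ints_def)
    thus "z \<in> unit_square" using l int by (auto simp: Am_def dilate_def unit_square_def power2_eq_square mult.assoc)
  qed
  have "ball_null \<sigma> E'"
    using ball_null_lipschitz[OF null zero_less_one lip] by (rule ball_null_mono) (auto simp: E'_def)
  hence E'0: "cyl_content \<sigma> E' = 0" using \<sigma> by (intro ball_null_imp_cyl_content_0) (auto simp: E'_def)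
  have A'0: "cyl_content t' A' \<noteq> 0"
  proof
    assume "cyl_content t' A' = 0"
    hence "ball_null t' A'" by (rule cyl_content_0_imp_ball_null)
    hence "ball_null t' (dilate (inverse c) ` A')" by (rule ball_null_lipschitz[OF _ pos lip'])
    moreover have "dilate (inverse c) ` A' = Am m"
      using dilate_dilate_inverse[OF c0] by (simp add: A'_def image_image)
    ultimately show False using m by simp
  qed
  have fib': "cyl_content s' (E' \<inter> graph_line l') \<noteq> 0" if l': "l' \<in> A'" for l'
  proof
    assume "cyl_content s' (E' \<inter> graph_line l') = 0"
    hence "ball_null s' (E' \<inter> graph_line l')" by (rule cyl_content_0_imp_ball_null)
    hence null': "ball_null s' (dilate (inverse c) ` (E' \<inter> graph_line l'))" by (rule ball_null_lipschitz[OF _ pos lip'])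
    obtain l where l: "l \<in> Am m" "l' = dilate c l" using l' by (auto simp: A'_def)
    have "part m l \<subseteq> dilate (inverse c) ` (E' \<inter> graph_line l')"
    proof
      fix z assume z: "z \<in> part m l"
      have ln: "dilate c z \<in> graph_line l'" using z unfolding l(2) by (intro dilate_graph_line) (auto simp: part_def)
      have x: "fst (dilate c z) \<in> padic_ints" using z int by (auto simp: part_def dilate_def)
      have "fst l' \<in> padic_ints" "snd l' \<in> padic_ints" using l' A'U by (auto simp: unit_square_def)
      hence "snd (dilate c z) \<in> padic_ints"
        using ln x by (auto simp: graph_line_def intro!: padic_ints_add padic_ints_mult)
      hence "dilate c z \<in> E' \<inter> graph_line l'" using ln x z by (auto simp: E'_def unit_square_def part_def mem_Times_iff)
      moreover have "z = dilate (inverse c) (dilate c z)" using dilate_dilate_inverse[OF c0] by simp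
      ultimately show "z \<in> dilate (inverse c) ` (E' \<inter> graph_line l')" by blast
    qed
    hence "ball_null s' (part m l)" by (rule ball_null_mono[OF null'])
    thus False using l(1) by (simp add: Am_def)
  qed
  define Ai where "Ai i = {l \<in> A'. ennreal (1 / real (Suc i)) \<le> cyl_content s' (E' \<inter> graph_line l)}" for i :: nat
  have cover: "A' = (\<Union>i. Ai i)"
  proof
    show "A' \<subseteq> (\<Union>i. Ai i)"
    proof
      fix l assume l: "l \<in> A'"
      have "cyl_content s' (E' \<inter> graph_line l) > 0" using fib'[OF l] by (simp add: zero_less_iff_neq_zero)
      then obtain e where e: "e > 0" "ennreal e \<le> cyl_content s' (E' \<inter> graph_line l)" by (rule ennreal_pos_lower_bound)
      obtain i where "inverse (real (Suc i)) < e" using reals_Archimedean[OF e(1)] by blast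
      hence "ennreal (1 / real (Suc i)) \<le> ennreal e" by (intro ennreal_leI) (simp add: inverse_eq_divide)
      hence "l \<in> Ai i" using l e(2) by (auto simp: Ai_def simp del: of_nat_Suc)
      thus "l \<in> (\<Union>i. Ai i)" by blast
    qed
  qed (auto simp: Ai_def)
  have "\<exists>i. cyl_content t' (Ai i) \<noteq> 0"
  proof (rule ccontr)
    assume "\<nexists>i. cyl_content t' (Ai i) \<noteq> 0"
    hence "(\<Sum>i. cyl_content t' (Ai i)) = 0" by simp
    thus False using cyl_content_UN[of t' Ai] A'0 unfolding cover[symmetric] by simp
  qed
  then obtain i where "cyl_content t' (Ai i) > 0" by (auto simp: zero_less_iff_neq_zero)
  then obtain e where e: "e > 0" "ennreal e \<le> cyl_content t' (Ai i)" by (rule ennreal_pos_lower_bound)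
  define d where "d = min e (1 / real (Suc i))"
  have "cyl_content \<sigma> E' \<noteq> 0"
  proof (rule furstenberg_unit_square[where \<eta> = \<eta> and c = d and s = s' and t = t' and A = "Ai i"])
    show "E' \<subseteq> unit_square" by (simp add: E'_def)
    show "Ai i \<subseteq> unit_square" using A'U by (auto simp: Ai_def)
    show "d > 0" using e by (simp add: d_def)
    have "ennreal d \<le> ennreal e" by (intro ennreal_leI) (simp add: d_def)
    thus "ennreal d \<le> cyl_content t' (Ai i)" using e(2) by (rule order.trans)
    show "ennreal d \<le> cyl_content s' (E' \<inter> graph_line l)" if "l \<in> Ai i" for l
    proof -
      have "ennreal d \<le> ennreal (1 / real (Suc i))" by (intro ennreal_leI) (simp add: d_def)
      also have "\<dots> \<le> cyl_content s' (E' \<inter> graph_line l)" using that by (simp add: Ai_def)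
      finally show ?thesis .
    qed
    show "\<sigma> - 1 \<le> s' - 3 * \<eta>" using \<eta> by (simp add: s'_def)
    show "(\<sigma> + 1 - t') / 2 \<le> s' - 3 * \<eta>" using \<eta> st(3) by (simp add: s'_def t'_def field_simps)
  qed (use \<eta> \<sigma> in auto)
  thus False using E'0 by simp
qed

lemma plane_dist_swap: "plane_dist (prod.swap z) (prod.swap w) = plane_dist z (w :: 'p::prime_card padic_plane)"
  by (simp add: plane_dist_def plane_norm_def max.commute)

lemma ball_null_swap: "ball_null s S \<Longrightarrow> ball_null s (prod.swap ` (S :: 'p::prime_card padic_plane set))"
  by (rule ball_null_lipschitz[of s S 1]) (auto simp: plane_dist_swap)

text \<open>
  Exchanging the coordinates exchanges the two charts on the set of lines.
\<close>

lemma furstenberg_lower_bound: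
  fixes E :: "'p::prime_card padic_plane set"
  assumes st: "0 < s" "0 < t" "s + t \<ge> 2" and E: "furstenberg_set s t E"
  shows "hausdorff_dim plane_dist E \<ge> ereal (s + 1)"
proof -
  obtain L where L: "line_family_dim L \<ge> ereal t" "\<And>l. l \<in> L \<Longrightarrow> hausdorff_dim plane_dist (E \<inter> l) \<ge> ereal s"
    using E unfolding furstenberg_set_def by blast
  have fib: "\<not> ball_null s' (E \<inter> l)" if "l \<in> L" "0 < s'" "s' < s" for l s'
    using L(2)[OF that(1)] that(2,3) hausdorff_dim_ge_iff[OF st(1)] by blast
  have "\<not> ball_null \<sigma> E" if \<sigma>: "0 < \<sigma>" "\<sigma> < s + 1" for \<sigma>
  proof (cases "hausdorff_dim plane_dist {(a, b). {(x, y). y = a * x + b} \<in> L} \<ge> ereal t")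
    case True
    hence "\<not> ball_null t' {l. graph_line l \<in> L}" if "0 < t'" "t' < t" for t'
      using that hausdorff_dim_ge_iff[OF st(2), of "{l. graph_line l \<in> L}"] by (simp add: graph_line_def case_prod_unfold)
    thus ?thesis using fib by (intro graph_family_lower_bound[OF st _ _ \<sigma>, of "{l. graph_line l \<in> L}"]) auto
  next
    case False
    have sw: "{(x, y). x = fst l * y + snd l} = prod.swap ` graph_line l" for l :: "'p padic_plane"
      by (force simp: graph_line_def)
    from False L(1) have "hausdorff_dim plane_dist {(a, b). {(x, y). x = a * y + b} \<in> L} \<ge> ereal t"
      by (simp add: line_family_dim_def le_max_iff_disj)
    hence A: "\<not> ball_null t' {l. prod.swap ` graph_line l \<in> L}" if "0 < t'" "t' < t" for t'
      using that hausdorff_dim_ge_iff[OF st(2), of "{l. prod.swap ` graph_line l \<in> L}"]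
      unfolding sw[symmetric] by (simp add: case_prod_unfold)
    have "\<not> ball_null \<sigma> (prod.swap ` E)"
    proof (rule graph_family_lower_bound[OF st A _ \<sigma>])
      fix l s' assume l: "l \<in> {l. prod.swap ` graph_line l \<in> L}" "0 < s'" "s' < s"
      show "\<not> ball_null s' (prod.swap ` E \<inter> graph_line l)"
      proof
        assume "ball_null s' (prod.swap ` E \<inter> graph_line l)"
        hence "ball_null s' (prod.swap ` (prod.swap ` E \<inter> graph_line l))" by (rule ball_null_swap)
        moreover have "E \<inter> prod.swap ` graph_line l \<subseteq> prod.swap ` (prod.swap ` E \<inter> graph_line l)" by force
        ultimately have "ball_null s' (E \<inter> prod.swap ` graph_line l)" by (rule ball_null_mono)
        thus False using fib l by blast
      qed
    qed
    thus ?thesis using ball_null_swap by blast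
  qed
  thus ?thesis using st by (subst hausdorff_dim_ge_iff) auto
qed

section \<open>Digit sets and sharpness\<close>

lemma padic_with_digits:
  fixes d :: "nat \<Rightarrow> int"
  assumes d: "\<And>n. 0 \<le> d n" "\<And>n. d n < int CARD('p)"
  shows "\<exists>x :: 'p::prime_card padic. x \<in> padic_ints \<and> (\<forall>n. residue n x = (\<Sum>k<n. d k * int CARD('p) ^ k))"
proof (rule coherent_residues)
  let ?c = "\<lambda>n. \<Sum>k<n. d k * int CARD('p) ^ k"
  show "0 \<le> ?c n" for n using d(1) by (intro sum_nonneg) auto
  show lt: "?c n < int CARD('p) ^ n" for n
  proof (induction n)
    case (Suc n)
    have "d n * int CARD('p) ^ n \<le> (int CARD('p) - 1) * int CARD('p) ^ n"
      using d(2)[of n] by (intro mult_right_mono) auto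
    thus ?case using Suc by (simp add: algebra_simps)
  qed simp
  show "?c (Suc n) mod int CARD('p) ^ n = ?c n" for n
    using lt[of n] d(1) by (simp add: sum_nonneg)
qed

text \<open>
  The digit of a p-adic integer at position \<open>n\<close> vanishes iff the residues modulo \<open>q\<^sup>n\<close> and \<open>q\<^sup>n\<^sup>+\<^sup>1\<close> agree. Points
  whose digits vanish outside \<open>N1\<close> and \<open>N2\<close> form the set; both the extremal set and its
  line traces, up to projection, have this shape.
\<close>

definition digit_set :: "nat set \<Rightarrow> nat set \<Rightarrow> 'p::prime_card padic_plane set" where
  "digit_set N1 N2 = {z \<in> unit_square. \<forall>n.
     (n \<notin> N1 \<longrightarrow> residue (Suc n) (fst z) = residue n (fst z)) \<and>
     (n \<notin> N2 \<longrightarrow> residue (Suc n) (snd z) = residue n (snd z))}"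

fun residues_with_digits :: "int \<Rightarrow> nat set \<Rightarrow> nat \<Rightarrow> int set" where
  "residues_with_digits q N 0 = {0}"
| "residues_with_digits q N (Suc n) = (\<lambda>(a, i). a + i * q ^ n) ` (residues_with_digits q N n \<times> (if n \<in> N then {0..<q} else {0}))"

lemma finite_residues_with_digits [simp]: "finite (residues_with_digits q N n)"
  by (induction n) auto

lemma card_residues_with_digits: "card (residues_with_digits (int q) N n) \<le> q ^ card (N \<inter> {..<n})"
proof (induction n)
  case (Suc n)
  have "card (residues_with_digits (int q) N (Suc n)) \<le> card (residues_with_digits (int q) N n \<times> (if n \<in> N then {0..<int q} else {0}))"
    unfolding residues_with_digits.simps by (intro card_image_le) auto
  also have "\<dots> = card (residues_with_digits (int q) N n) * (if n \<in> N then q else 1)"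
    by (simp add: card_cartesian_product)
  also have "\<dots> \<le> q ^ card (N \<inter> {..<n}) * (if n \<in> N then q else 1)" by (intro mult_right_mono Suc) auto
  also have "\<dots> = q ^ card (N \<inter> {..<Suc n})"
  proof (cases "n \<in> N")
    case True
    hence "N \<inter> {..<Suc n} = insert n (N \<inter> {..<n})" by (auto simp: lessThan_Suc)
    thus ?thesis using True by simp
  next
    case False
    hence "N \<inter> {..<Suc n} = N \<inter> {..<n}" by (auto simp: lessThan_Suc)
    thus ?thesis using False by simp
  qed
  finally show ?case .
qed simp

lemma residue_in_residues_with_digits:
  fixes x :: "'p::prime_card padic"
  assumes x: "x \<in> padic_ints" and N: "\<And>n. n \<notin> N \<Longrightarrow> residue (Suc n) x = residue n x"
  shows "residue n x \<in> residues_with_digits (int CARD('p)) N n"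
proof (induction n)
  case 0
  show ?case using residue(1,2)[OF x, of 0] by simp
next
  case (Suc n)
  let ?q = "int CARD('p)"
  have q0: "?q ^ n > 0" using card_prime_gt_1[where 'p = 'p] by simp
  let ?i = "residue (Suc n) x div ?q ^ n"
  have eq: "residue (Suc n) x = residue n x + ?i * ?q ^ n"
    using residue_mod[OF x, of n "Suc n"] mod_mult_div_eq[of "residue (Suc n) x" "?q ^ n"] by (simp add: mult.commute)
  have "0 \<le> ?i" using residue(1)[OF x, of "Suc n"] q0 by (simp add: pos_imp_zdiv_nonneg_iff)
  moreover have "?i < ?q"
  proof (rule ccontr)
    assume "\<not> ?i < ?q"
    hence "?q * ?q ^ n \<le> ?i * ?q ^ n" using q0 by (intro mult_right_mono) auto
    hence "?q ^ Suc n \<le> residue (Suc n) x" using eq residue(1)[OF x, of n] unfolding power_Suc by linarith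
    thus False using residue(2)[OF x, of "Suc n"] by linarith
  qed
  moreover have "?i = 0" if "n \<notin> N" using eq N[OF that] q0 by simp
  ultimately have "(residue n x, ?i) \<in> residues_with_digits ?q N n \<times> (if n \<in> N then {0..<?q} else {0})"
    using Suc by auto
  thus ?case unfolding residues_with_digits.simps using eq by (intro image_eqI[of _ _ "(residue n x, ?i)"]) auto
qed

definition digit_count :: "nat set \<Rightarrow> nat set \<Rightarrow> nat \<Rightarrow> nat" where
  "digit_count N1 N2 n = card (N1 \<inter> {..<n}) + card (N2 \<inter> {..<n})"

lemma digit_count_0 [simp]: "digit_count N1 N2 0 = 0"
  by (simp add: digit_count_def)

lemma digit_count_Suc: "digit_count N1 N2 (Suc n) = digit_count N1 N2 n + (of_bool (n \<in> N1) + of_bool (n \<in> N2))"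
proof -
  have "card (N \<inter> {..<Suc n}) = card (N \<inter> {..<n}) + of_bool (n \<in> N)" for N :: "nat set"
  proof (cases "n \<in> N")
    case True
    hence "N \<inter> {..<Suc n} = insert n (N \<inter> {..<n})" by (auto simp: lessThan_Suc)
    thus ?thesis using True by simp
  next
    case False
    hence "N \<inter> {..<Suc n} = N \<inter> {..<n}" by (auto simp: lessThan_Suc)
    thus ?thesis using False by simp
  qed
  thus ?thesis by (simp add: digit_count_def)
qed

lemma digit_set_content_le:
  "cyl_content \<sigma> (digit_set N1 N2 :: 'p::prime_card padic_plane set)
     \<le> ennreal (real CARD('p) ^ digit_count N1 N2 n * real CARD('p) powr (- \<sigma> * real n))"
proof -
  let ?q = "int CARD('p)"
  let ?D = "residues_with_digits ?q N1 n \<times> residues_with_digits ?q N2 n"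
  have "(digit_set N1 N2 :: 'p padic_plane set) \<subseteq> (\<Union>x\<in>{n} \<times> ?D. cylinder x)"
  proof
    fix z :: "'p padic_plane" assume z: "z \<in> digit_set N1 N2"
    hence "residue_pair n z \<in> ?D"
      by (auto simp: digit_set_def residue_pair_def unit_square_def intro!: residue_in_residues_with_digits)
    thus "z \<in> (\<Union>x\<in>{n} \<times> ?D. cylinder x)" using z by (auto simp: cylinder_def digit_set_def)
  qed
  hence "cyl_content \<sigma> (digit_set N1 N2 :: 'p padic_plane set) \<le> ennreal (\<Sum>x\<in>{n} \<times> ?D. cost CARD('p) \<sigma> x)"
    by (intro cyl_content_le_finite) auto
  also have "(\<Sum>x\<in>{n} \<times> ?D. cost CARD('p) \<sigma> x) = real (card ?D) * real CARD('p) powr (- \<sigma> * real n)"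
    by (subst sum.cong[OF refl, of _ _ "\<lambda>_. real CARD('p) powr (- \<sigma> * real n)"]) (auto simp: cost_def card_cartesian_product)
  also have "\<dots> \<le> real CARD('p) ^ digit_count N1 N2 n * real CARD('p) powr (- \<sigma> * real n)"
  proof (rule mult_right_mono)
    have "card ?D \<le> CARD('p) ^ digit_count N1 N2 n"
      unfolding card_cartesian_product digit_count_def power_add
      by (intro mult_mono card_residues_with_digits) auto
    thus "real (card ?D) \<le> real CARD('p) ^ digit_count N1 N2 n" by (metis of_nat_le_iff of_nat_power)
  qed simp
  finally show ?thesis by (simp add: ennreal_leI)
qed

lemma floor_mult_int_bounds:
  fixes y :: real and m :: int
  assumes "m > 0"
  shows "0 \<le> \<lfloor>of_int m * y\<rfloor> - m * \<lfloor>y\<rfloor>" "\<lfloor>of_int m * y\<rfloor> - m * \<lfloor>y\<rfloor> < m"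
proof -
  have "of_int m * of_int \<lfloor>y\<rfloor> \<le> of_int m * y" using assms by (intro mult_left_mono) auto
  hence "m * \<lfloor>y\<rfloor> \<le> \<lfloor>of_int m * y\<rfloor>" by (simp add: le_floor_iff)
  thus "0 \<le> \<lfloor>of_int m * y\<rfloor> - m * \<lfloor>y\<rfloor>" by simp
  have "of_int m * y < of_int m * (of_int \<lfloor>y\<rfloor> + 1)" using assms by (intro mult_strict_left_mono) (linarith, simp)
  hence "\<lfloor>of_int m * y\<rfloor> < m * (\<lfloor>y\<rfloor> + 1)" by (simp add: floor_less_iff)
  thus "\<lfloor>of_int m * y\<rfloor> - m * \<lfloor>y\<rfloor> < m" by (simp add: algebra_simps)
qed

text \<open>
  The digits of \<open>x\<close> in base \<open>q\<close> are distributed in order over the free positions, with both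
  coordinates served at position \<open>n\<close> before the next position: \<open>r x n\<close> collects the
  digits that belong to position \<open>n\<close>. Hence the residues modulo \<open>q\<^sup>n\<close> determine the first digits of \<open>x\<close>, as
  many as there are free positions below \<open>n\<close>.
\<close>

lemma digit_set_parametrization:
  fixes N1 N2 :: "nat set"
  defines "f \<equiv> digit_count N1 N2"
  obtains z :: "real \<Rightarrow> 'p::prime_card padic_plane" where
    "\<And>x. 0 \<le> x \<Longrightarrow> x < 1 \<Longrightarrow> z x \<in> digit_set N1 N2"
    "\<And>n x y. 0 \<le> x \<Longrightarrow> x < 1 \<Longrightarrow> 0 \<le> y \<Longrightarrow> y < 1 \<Longrightarrow> residue_pair n (z x) = residue_pair n (z y) \<Longrightarrow>
       \<lfloor>real CARD('p) ^ f n * x\<rfloor> = \<lfloor>real CARD('p) ^ f n * y\<rfloor>"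
proof -
  define q where "q = int CARD('p)"
  have q: "q > 1" using card_prime_gt_1[where 'p = 'p] by (simp add: q_def)
  define X where "X x n = \<lfloor>real CARD('p) ^ f n * x\<rfloor>" for x n
  define e where "e n = (of_bool (n \<in> N1) + of_bool (n \<in> N2) :: nat)" for n
  \<comment> \<open>\<open>e n\<close> is the number of digits that position \<open>n\<close> takes: 0, 1 or 2.\<close>
  define r where "r x n = X x (Suc n) - q ^ e n * X x n" for x n
  define j where "j x n = (if n \<in> N2 then r x n mod q else 0)" for x n
  define i where "i x n = (if n \<in> N1 then (if n \<in> N2 then r x n div q else r x n) else 0)" for x n
  have r: "0 \<le> r x n" "r x n < q ^ e n" for x n
  proof -
    have "real CARD('p) ^ f (Suc n) * x = of_int (q ^ e n) * (real CARD('p) ^ f n * x)"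
      by (simp add: f_def digit_count_Suc e_def q_def power_add mult_ac)
    hence eq: "r x n = \<lfloor>of_int (q ^ e n) * (real CARD('p) ^ f n * x)\<rfloor> - q ^ e n * \<lfloor>real CARD('p) ^ f n * x\<rfloor>"
      unfolding r_def X_def by (simp only:)
    have "q ^ e n > 0" using q by simp
    from floor_mult_int_bounds[OF this] show "0 \<le> r x n" "r x n < q ^ e n" unfolding eq by auto
  qed
  have j: "0 \<le> j x n" "j x n < q" for x n using q by (auto simp: j_def)
  have i: "0 \<le> i x n" "i x n < q" for x n
  proof -
    show "0 \<le> i x n" using q r[of x n] by (auto simp: i_def pos_imp_zdiv_nonneg_iff)
    show "i x n < q"
    proof (cases "n \<in> N1 \<and> n \<in> N2")
      case True
      hence rq: "r x n < q * q" using r(2)[of x n] by (simp add: e_def power2_eq_square)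
      have "r x n div q < q"
      proof (rule ccontr)
        assume "\<not> r x n div q < q"
        hence "q * q \<le> q * (r x n div q)" using q by (intro mult_left_mono) auto
        moreover have "q * (r x n div q) \<le> r x n" using q mult_div_mod_eq[of q "r x n"] pos_mod_sign[of q "r x n"] by linarith
        ultimately show False using rq by linarith
      qed
      thus ?thesis using True by (simp add: i_def)
    next
      case False
      thus ?thesis using q r(2)[of x n] by (auto simp: i_def e_def)
    qed
  qed
  have r_eq: "r x n = r y n" if "i x n = i y n" "j x n = j y n" for x y n
  proof -
    consider "n \<in> N1" "n \<in> N2" | "n \<in> N1" "n \<notin> N2" | "n \<notin> N1" "n \<in> N2" | "n \<notin> N1" "n \<notin> N2" by blast
    thus ?thesis
    proof cases
      case 1
      have "r x n = q * (r x n div q) + r x n mod q" for x by simp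
      thus ?thesis using that 1 unfolding i_def j_def by (metis (full_types))
    next
      case 3
      have "r x n mod q = r x n" for x using r[of x n] 3 by (simp add: e_def)
      thus ?thesis using that 3 by (simp add: j_def)
    next
      case 4
      have "r x n = 0" for x using r[of x n] 4 by (simp add: e_def)
      thus ?thesis by simp
    qed (use that in \<open>simp add: i_def\<close>)
  qed
  have "\<exists>z :: 'p padic_plane. z \<in> unit_square \<and>
      (\<forall>n. residue_pair n z = ((\<Sum>k<n. i x k * q ^ k), (\<Sum>k<n. j x k * q ^ k)))" for x
  proof -
    obtain u :: "'p padic" where u: "u \<in> padic_ints" "\<forall>n. residue n u = (\<Sum>k<n. i x k * q ^ k)"
      using padic_with_digits[of "i x", where 'p = 'p] i by (auto simp: q_def)
    obtain v :: "'p padic" where v: "v \<in> padic_ints" "\<forall>n. residue n v = (\<Sum>k<n. j x k * q ^ k)"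
      using padic_with_digits[of "j x", where 'p = 'p] j by (auto simp: q_def)
    show ?thesis using u v by (intro exI[of _ "(u, v)"]) (simp add: unit_square_def residue_pair_def)
  qed
  then obtain z :: "real \<Rightarrow> 'p padic_plane" where z: "\<And>x. z x \<in> unit_square"
      "\<And>x n. residue_pair n (z x) = ((\<Sum>k<n. i x k * q ^ k), (\<Sum>k<n. j x k * q ^ k))" by metis
  have dig: "z x \<in> digit_set N1 N2" for x
  proof -
    have "residue (Suc n) (fst (z x)) = residue n (fst (z x))" if "n \<notin> N1" for n
      using z(2)[of n x] z(2)[of "Suc n" x] that by (simp add: residue_pair_def i_def)
    moreover have "residue (Suc n) (snd (z x)) = residue n (snd (z x))" if "n \<notin> N2" for n
      using z(2)[of n x] z(2)[of "Suc n" x] that by (simp add: residue_pair_def j_def)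
    ultimately show ?thesis using z(1) by (simp add: digit_set_def)
  qed
  have inj: "X x n = X y n" if "0 \<le> x" "x < 1" "0 \<le> y" "y < 1" "residue_pair n (z x) = residue_pair n (z y)" for x y n
    using that(5)
  proof (induction n)
    case 0
    have "\<lfloor>x\<rfloor> = 0" "\<lfloor>y\<rfloor> = 0" using that by (auto simp: floor_eq_iff)
    thus ?case by (simp add: X_def f_def)
  next
    case (Suc n)
    have "residue_pair n (z x) = residue_pair n (z y)"
      using Suc.prems residue_pair_mod[OF z(1), of n "Suc n" x] residue_pair_mod[OF z(1), of n "Suc n" y] by simp
    hence IH: "X x n = X y n" and low: "(\<Sum>k<n. i x k * q ^ k) = (\<Sum>k<n. i y k * q ^ k)" "(\<Sum>k<n. j x k * q ^ k) = (\<Sum>k<n. j y k * q ^ k)"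
      using Suc.IH by (auto simp: z(2))
    have "i x n = i y n" "j x n = j y n" using Suc.prems low q by (auto simp: z(2))
    hence "r x n = r y n" by (rule r_eq)
    thus ?case using IH by (simp add: r_def)
  qed
  show thesis using dig inj unfolding X_def by (intro that[of z]) blast+
qed

text \<open>
  The mass distribution principle, with Lebesgue measure on the unit interval as the mass: the
  preimage of a cylinder under the parametrization lies in an interval whose length is the reciprocal
  of the number of classes of this level, and these intervals must cover \<open>[0, 1)\<close>.
\<close>

lemma digit_set_content_pos:
  fixes N1 N2 :: "nat set" and C s :: real
  assumes C: "C > 0"
    and bound: "\<And>n. C * real CARD('p) powr (s * real n) \<le> real CARD('p) ^ digit_count N1 N2 n"
  shows "ennreal C \<le> cyl_content s (digit_set N1 N2 :: 'p::prime_card padic_plane set)"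
proof -
  let ?q = "real CARD('p)" and ?f = "digit_count N1 N2" and ?M = "cost_measure CARD('p) s"
  have q: "?q > 1" by (rule card_prime_gt_1)
  obtain z :: "real \<Rightarrow> 'p padic_plane" where z: "\<And>x. 0 \<le> x \<Longrightarrow> x < 1 \<Longrightarrow> z x \<in> digit_set N1 N2"
    "\<And>n x y. 0 \<le> x \<Longrightarrow> x < 1 \<Longrightarrow> 0 \<le> y \<Longrightarrow> y < 1 \<Longrightarrow> residue_pair n (z x) = residue_pair n (z y) \<Longrightarrow> \<lfloor>?q ^ ?f n * x\<rfloor> = \<lfloor>?q ^ ?f n * y\<rfloor>"
    using digit_set_parametrization by metis
  have "ennreal C \<le> emeasure ?M K" if K: "digit_set N1 N2 \<subseteq> (\<Union>x\<in>K. cylinder x :: 'p padic_plane set)" for K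
  proof -
    define T where "T x = {y. 0 \<le> y \<and> y < 1 \<and> z y \<in> cylinder x}" for x
    have "\<exists>J. T x \<subseteq> J \<and> J \<in> sets lborel \<and> ennreal C * emeasure lborel J \<le> emeasure ?M {x}" for x
    proof (cases "T x = {}")
      case True
      thus ?thesis by (intro exI[of _ "{}"]) simp
    next
      case False
      then obtain y0 where y0: "y0 \<in> T x" by blast
      define m where "m = ?q ^ ?f (fst x)"
      have m: "m > 0" using q by (simp add: m_def)
      define J where "J = {of_int \<lfloor>m * y0\<rfloor> / m .. (of_int \<lfloor>m * y0\<rfloor> + 1) / m}"
      have "T x \<subseteq> J"
      proof
        fix y assume y: "y \<in> T x"
        have "\<lfloor>m * y\<rfloor> = \<lfloor>m * y0\<rfloor>" unfolding m_def using y y0 by (intro z(2)) (auto simp: T_def cylinder_def)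
        hence "of_int \<lfloor>m * y0\<rfloor> \<le> m * y" "m * y \<le> of_int \<lfloor>m * y0\<rfloor> + 1" by linarith+
        thus "y \<in> J" using m by (auto simp: J_def field_simps)
      qed
      moreover have "emeasure lborel J = ennreal (1 / m)"
        using m unfolding J_def by (subst emeasure_lborel_Icc) (auto simp: divide_right_mono diff_divide_distrib[symmetric])
      moreover have "C / m \<le> cost CARD('p) s x"
      proof -
        have "C \<le> m * ?q powr (- s * real (fst x))"
          using mult_right_mono[OF bound[of "fst x"], of "?q powr (- s * real (fst x))"] q
          by (simp add: m_def mult.assoc powr_add[symmetric])
        thus ?thesis using m by (simp add: cost_def field_simps)
      qed
      hence "ennreal C * ennreal (1 / m) \<le> emeasure ?M {x}"
        using C m by (simp add: emeasure_cost_measure_singleton ennreal_mult[symmetric] ennreal_leI)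
      ultimately show ?thesis by (intro exI[of _ J]) (auto simp: J_def)
    qed
    then obtain J where J: "\<And>x. T x \<subseteq> J x" "\<And>x. J x \<in> sets lborel" "\<And>x. ennreal C * emeasure lborel (J x) \<le> emeasure ?M {x}" by metis
    define V where "V i = (if i \<in> to_nat ` K then J (from_nat i) else {})" for i :: nat
    have "{0..<1} \<subseteq> (\<Union>i. V i)"
    proof
      fix y :: real assume y: "y \<in> {0..<1}"
      hence "z y \<in> digit_set N1 N2" using z(1) by simp
      then obtain x where x: "x \<in> K" "z y \<in> cylinder x" using K by blast
      hence "y \<in> T x" using y by (simp add: T_def)
      hence "y \<in> J x" using J(1) by blast
      hence "y \<in> V (to_nat x)" using x(1) by (simp add: V_def)
      thus "y \<in> (\<Union>i. V i)" by blast
    qed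
    moreover have V: "V i \<in> sets lborel" for i using J(2) by (simp add: V_def)
    ultimately have "emeasure lborel {0..<1::real} \<le> emeasure lborel (\<Union>i. V i)" by (intro emeasure_mono) auto
    also have "\<dots> \<le> (\<Sum>i. emeasure lborel (V i))" using V by (intro emeasure_subadditive_countably) auto
    finally have one: "1 \<le> (\<Sum>i. emeasure lborel (V i))" by simp
    have "ennreal C \<le> ennreal C * (\<Sum>i. emeasure lborel (V i))" using mult_left_mono[OF one, of "ennreal C"] by simp
    also have "\<dots> = (\<Sum>i. ennreal C * emeasure lborel (V i))" by simp
    also have "\<dots> \<le> (\<Sum>i. emeasure ?M {x \<in> K. to_nat x = i})"
    proof (intro suminf_le)
      fix i
      show "ennreal C * emeasure lborel (V i) \<le> emeasure ?M {x \<in> K. to_nat x = i}"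
      proof (cases "i \<in> to_nat ` K")
        case True
        then obtain x where x: "x \<in> K" "i = to_nat x" by blast
        hence "{x \<in> K. to_nat x = i} = {x}" by auto
        thus ?thesis using x J(3)[of x] by (simp add: V_def)
      qed (simp add: V_def)
    qed auto
    also have "\<dots> = emeasure ?M (\<Union>i. {x \<in> K. to_nat x = i})"
      by (rule suminf_emeasure) (auto simp: disjoint_family_on_def)
    also have "(\<Union>i. {x \<in> K. to_nat x = i}) = K" by auto
    finally show ?thesis .
  qed
  thus ?thesis unfolding cyl_content_def by (intro INF_greatest) auto
qed

lemma digit_set_not_null:
  fixes N1 N2 :: "nat set"
  assumes s: "0 < s'" "s' < s" and bound: "\<And>n. s * real n - 1 \<le> real (digit_count N1 N2 n)"
  shows "\<not> ball_null s' (digit_set N1 N2 :: 'p::prime_card padic_plane set)"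
proof
  let ?q = "real CARD('p)"
  have q: "?q > 1" by (rule card_prime_gt_1)
  assume "ball_null s' (digit_set N1 N2 :: 'p padic_plane set)"
  hence "cyl_content s' (digit_set N1 N2 :: 'p padic_plane set) = 0"
    using s by (intro ball_null_imp_cyl_content_0) (auto simp: digit_set_def)
  moreover have "ennreal (1 / ?q) \<le> cyl_content s' (digit_set N1 N2 :: 'p padic_plane set)"
  proof (rule digit_set_content_pos)
    fix n
    have "1 / ?q * ?q powr (s' * real n) = ?q powr (s' * real n - 1)"
      using q by (simp add: powr_diff)
    also have "\<dots> \<le> ?q powr real (digit_count N1 N2 n)"
    proof (rule powr_mono)
      have "s' * real n \<le> s * real n" using s by (intro mult_right_mono) auto
      thus "s' * real n - 1 \<le> real (digit_count N1 N2 n)" using bound[of n] by linarith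
    qed (use q in simp)
    also have "\<dots> = ?q ^ digit_count N1 N2 n" using q by (simp add: powr_realpow)
    finally show "1 / ?q * ?q powr (s' * real n) \<le> ?q ^ digit_count N1 N2 n" .
  qed (use q in simp)
  ultimately show False using q by simp
qed

lemma digit_set_null:
  fixes N1 N2 :: "nat set"
  assumes \<sigma>: "\<beta> < \<sigma>" and bound: "\<And>n. real (digit_count N1 N2 n) \<le> \<beta> * real n"
  shows "ball_null \<sigma> (digit_set N1 N2 :: 'p::prime_card padic_plane set)"
proof (rule cyl_content_0_imp_ball_null)
  let ?q = "real CARD('p)" and ?S = "digit_set N1 N2 :: 'p padic_plane set"
  have q: "?q > 1" by (rule card_prime_gt_1)
  have "cyl_content \<sigma> ?S \<le> ennreal ((?q powr (\<beta> - \<sigma>)) ^ n)" for n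
  proof -
    have "?q ^ digit_count N1 N2 n * ?q powr (- \<sigma> * real n) = ?q powr (real (digit_count N1 N2 n) - \<sigma> * real n)"
      using q by (simp add: powr_realpow[symmetric] powr_add[symmetric])
    also have "\<dots> \<le> ?q powr ((\<beta> - \<sigma>) * real n)"
      using q bound[of n] by (intro powr_mono) (auto simp: left_diff_distrib)
    also have "\<dots> = (?q powr (\<beta> - \<sigma>)) ^ n" using q by (simp add: powr_powr[symmetric] powr_realpow)
    finally have "ennreal (?q ^ digit_count N1 N2 n * ?q powr (- \<sigma> * real n)) \<le> ennreal ((?q powr (\<beta> - \<sigma>)) ^ n)" by (rule ennreal_leI)
    thus ?thesis using digit_set_content_le[of \<sigma> N1 N2 n, where 'p = 'p] by (rule order.trans[rotated])
  qed
  moreover have "(\<lambda>n. ennreal ((?q powr (\<beta> - \<sigma>)) ^ n)) \<longlonglongrightarrow> ennreal 0"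
    using q \<sigma> by (intro tendsto_ennrealI LIMSEQ_realpow_zero) (auto simp: powr_less_one)
  ultimately have "cyl_content \<sigma> ?S \<le> ennreal 0" by (intro LIMSEQ_le_const) auto
  thus "cyl_content \<sigma> ?S = 0" by simp
qed

text \<open>
  The positions at which \<open>\<lfloor>s n\<rfloor>\<close> jumps.
\<close>

lemma digits_of_density:
  fixes s :: real
  assumes s: "0 \<le> s" "s \<le> 1"
  obtains N :: "nat set" where "\<And>n. s * real n - 1 \<le> real (card (N \<inter> {..<n}))" "\<And>n. real (card (N \<inter> {..<n})) \<le> s * real n"
proof -
  define N where "N = {n::nat. \<lfloor>s * real (Suc n)\<rfloor> \<noteq> \<lfloor>s * real n\<rfloor>}"
  have card: "int (card (N \<inter> {..<n})) = \<lfloor>s * real n\<rfloor>" for n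
  proof (induction n)
    case (Suc n)
    have step: "\<lfloor>s * real (Suc n)\<rfloor> = \<lfloor>s * real n\<rfloor> \<or> \<lfloor>s * real (Suc n)\<rfloor> = \<lfloor>s * real n\<rfloor> + 1"
    proof -
      have "s * real (Suc n) = s * real n + s" by (simp add: algebra_simps)
      hence "s * real n \<le> s * real (Suc n)" "s * real (Suc n) \<le> s * real n + 1" using s by linarith+
      hence "\<lfloor>s * real n\<rfloor> \<le> \<lfloor>s * real (Suc n)\<rfloor>" "\<lfloor>s * real (Suc n)\<rfloor> \<le> \<lfloor>s * real n\<rfloor> + 1" by linarith+
      thus ?thesis by linarith
    qed
    show ?case
    proof (cases "n \<in> N")
      case True
      hence "N \<inter> {..<Suc n} = insert n (N \<inter> {..<n})" by (auto simp: lessThan_Suc)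
      thus ?thesis using True step Suc by (auto simp: N_def)
    next
      case False
      hence "N \<inter> {..<Suc n} = N \<inter> {..<n}" by (auto simp: lessThan_Suc)
      thus ?thesis using False Suc by (simp add: N_def)
    qed
  qed simp
  show thesis
  proof (rule that[of N])
    fix n
    have "real (card (N \<inter> {..<n})) = of_int \<lfloor>s * real n\<rfloor>" using card[of n] by (metis of_int_of_nat_eq)
    thus "s * real n - 1 \<le> real (card (N \<inter> {..<n}))" "real (card (N \<inter> {..<n})) \<le> s * real n" by linarith+
  qed
qed

lemma affine_line_graph_line: "affine_line (graph_line (l :: 'p::prime_card padic_plane))"
proof -
  have "graph_line l = {(0 + r * 1, snd l + r * fst l) | r. True}" by (auto simp: graph_line_def mult.commute add.commute)
  moreover have "(1 :: 'p padic, fst l) \<noteq> (0, 0)" by simp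
  ultimately show ?thesis unfolding affine_line_def by blast
qed

text \<open>
  Projecting to the first coordinate does not increase distances and maps the trace on an integral line
  onto the digit set \<open>C \<times> {0}\<close>, so the trace has dimension at least \<open>s\<close>. The lower bound for \<open>E\<close> itself is
  the general one.
\<close>

lemma furstenberg_sharp:
  fixes s t :: real
  assumes st: "0 < s" "s \<le> 1" "0 < t" "t \<le> 2" "s + t \<ge> 2"
  shows "\<exists>E :: 'p::prime_card padic_plane set. furstenberg_set s t E \<and> hausdorff_dim plane_dist E = ereal (s + 1)"
proof -
  obtain N where N: "\<And>n. s * real n - 1 \<le> real (card (N \<inter> {..<n}))" "\<And>n. real (card (N \<inter> {..<n})) \<le> s * real n"
    using digits_of_density[of s] st by auto
  define E :: "'p padic_plane set" where "E = digit_set N UNIV"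
  define L :: "'p padic_plane set set" where "L = graph_line ` unit_square"
  have fib: "hausdorff_dim plane_dist (E \<inter> l) \<ge> ereal s" if l: "l \<in> L" for l
  proof -
    obtain ab where ab: "ab \<in> unit_square" "l = graph_line ab" using l by (auto simp: L_def)
    have "\<not> ball_null s' (E \<inter> l)" if s': "0 < s'" "s' < s" for s'
    proof
      assume "ball_null s' (E \<inter> l)"
      hence "ball_null s' ((\<lambda>z. (fst z, 0)) ` (E \<inter> l))"
        by (rule ball_null_lipschitz[of _ _ 1]) (auto simp: plane_dist_def plane_norm_def)
      moreover have "(digit_set N {} :: 'p padic_plane set) \<subseteq> (\<lambda>z. (fst z, 0)) ` (E \<inter> l)"
      proof
        fix w :: "'p padic_plane" assume w: "w \<in> digit_set N {}"
        have "residue n (snd w) = 0" for n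
        proof (induction n)
          case 0
          show ?case using w residue(1,2)[of "snd w" 0] by (auto simp: digit_set_def unit_square_def)
        qed (use w in \<open>simp add: digit_set_def\<close>)
        hence small: "padic_norm (snd w) \<le> 1 / real CARD('p) ^ n" for n
          using w residue(3)[of "snd w" n] by (auto simp: digit_set_def unit_square_def)
        have "snd w = 0"
        proof (rule ccontr)
          assume "snd w \<noteq> 0"
          hence "padic_norm (snd w) > 0" by (rule padic_norm_pos)
          then obtain n where "(1 / real CARD('p)) ^ n < padic_norm (snd w)"
            using real_arch_pow_inv[of "padic_norm (snd w)" "1 / real CARD('p)"] card_prime_gt_1[where 'p = 'p] by auto
          thus False using small[of n] by (simp add: power_one_over)
        qed
        define z where "z = (fst w, fst ab * fst w + snd ab)"
        have "z \<in> E" using w ab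
          by (auto simp: z_def E_def digit_set_def unit_square_def intro!: padic_ints_add padic_ints_mult)
        moreover have "z \<in> l" by (simp add: z_def ab graph_line_def)
        moreover have "w = (\<lambda>z. (fst z, 0)) z" using \<open>snd w = 0\<close> by (simp add: z_def prod_eq_iff)
        ultimately show "w \<in> (\<lambda>z. (fst z, 0)) ` (E \<inter> l)" by blast
      qed
      ultimately have "ball_null s' (digit_set N {} :: 'p padic_plane set)" by (rule ball_null_mono)
      moreover have "\<not> ball_null s' (digit_set N {} :: 'p padic_plane set)"
        by (rule digit_set_not_null[OF s']) (simp add: digit_count_def N)
      ultimately show False by blast
    qed
    thus ?thesis using st by (subst hausdorff_dim_ge_iff) auto
  qed
  have Ldim: "line_family_dim L \<ge> ereal t"
  proof -
    have "hausdorff_dim plane_dist {(a, b). {(x, y). y = a * x + b} \<in> L} \<ge> ereal t"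
    proof (subst hausdorff_dim_ge_iff[OF st(3)], intro allI impI notI)
      fix t' assume t': "0 < t'" "t' < t" and null: "ball_null t' {(a, b). {(x, y). y = a * x + b} \<in> L}"
      have "digit_set UNIV UNIV \<subseteq> {(a, b). {(x, y). y = a * x + b} \<in> L}"
      proof
        fix l :: "'p padic_plane" assume "l \<in> digit_set UNIV UNIV"
        hence "graph_line l \<in> L" by (simp add: L_def digit_set_def)
        thus "l \<in> {(a, b). {(x, y). y = a * x + b} \<in> L}" by (simp add: graph_line_def case_prod_unfold)
      qed
      hence "ball_null t' (digit_set UNIV UNIV :: 'p padic_plane set)" by (rule ball_null_mono[OF null])
      moreover have "\<not> ball_null t' (digit_set UNIV UNIV :: 'p padic_plane set)"
        using t' st by (intro digit_set_not_null[of t' 2]) (auto simp: digit_count_def)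
      ultimately show False by blast
    qed
    thus ?thesis by (simp add: line_family_dim_def le_max_iff_disj)
  qed
  have F: "furstenberg_set s t E"
    unfolding furstenberg_set_def using fib Ldim by (intro exI[of _ L]) (auto simp: L_def affine_line_graph_line)
  have "hausdorff_dim plane_dist E \<le> ereal (s + 1)"
  proof (rule hausdorff_dim_le)
    fix \<sigma> assume "s + 1 < \<sigma>"
    thus "ball_null \<sigma> E"
      unfolding E_def using N(2) by (intro digit_set_null[of "s + 1"]) (auto simp: digit_count_def algebra_simps)
  qed (use st in simp)
  moreover have "hausdorff_dim plane_dist E \<ge> ereal (s + 1)"
    by (rule furstenberg_lower_bound[OF st(1,3,5) F])
  ultimately show ?thesis using F by (intro exI[of _ E]) auto
qed

theorem theorem1p3:
  fixes s t :: real
  assumes "0 < s" and "s \<le> 1" and "0 < t" and "t \<le> 2" and "s + t \<ge> 2"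
  shows "(\<forall>E :: 'p::prime_card padic_plane set.
            furstenberg_set s t E \<longrightarrow> hausdorff_dim plane_dist E \<ge> ereal (s + 1)) \<and>
         (\<exists>E :: 'p padic_plane set.
            furstenberg_set s t E \<and> hausdorff_dim plane_dist E = ereal (s + 1))"
  using furstenberg_lower_bound[OF assms(1,3,5)] furstenberg_sharp[OF assms] by blast

end
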